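(* Let $(X_n)_{n\ge 0}$ be an excited random walk on $\mathbb{Z}$ with at most $M$ cookies per site whose environment law $\mathbb{P}$ on $\Omega_M$ satisfies the i.i.d. assumption (I) and the ellipticity assumption (E) stated in the context, and let $\delta$ be the average total drift per site. Then there is a deterministic $v\in[-1,1]$ such that for $\mathbb{P}$-almost all environments $\omega$, $$\lim_{n\to\infty}\frac{X_n}{n}=v\qquad P_{0,\omega}\text{-a.s.}$$ Moreover, $v<0$ if $\delta<-2$, $v=0$ if $\delta\in[-2,2]$, and $v>0$ if $\delta>2$.
   Context: Fix $M\in\mathbb{N}=\{1,2,\dots\}$. A cookie environment is an element of $\Omega_M:=\{((\omega(z,i))_{i\in\mathbb{N}})_{z\in\mathbb{Z}} : \omega(z,i)\in[0,1]\ \forall i\in\{1,\dots,M\},\ \omega(z,i)=1/2\ \forall i>M,\ \forall z\in\mathbb{Z}\}$. For $\omega\in\Omega_M$ and $x\in\mathbb{Z}$, the excited random walk (ERW) $(X_n)_{n\ge0}$ starting from $x$ in the environment $\omega$ is a process under a probability measure $P_{x,\omega}$ with $P_{x,\omega}[X_0=x]=1$, $P_{x,\omega}[X_{n+1}=X_n+1\mid (X_i)_{0\le i\le n}]=\omega(X_n,\#\{i\le n: X_i=X_n\})$ and $P_{x,\omega}[X_{n+1}=X_n-1\mid (X_i)_{0\le i\le n}]=1-\omega(X_n,\#\{i\le n: X_i=X_n\})$. The environment $\omega$ is random with law $\mathbb{P}$ on $\Omega_M$ (expectation $\mathbb{E}$). Assumptions on $\mathbb{P}$: (I) the sequence $(\omega(z,\cdot))_{z\in\mathbb{Z}}$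 is i.i.d. under $\mathbb{P}$ (different cookies at the same site may be dependent); (E) $\mathbb{E}\left[\prod_{i=1}^M\omega(0,i)\right]>0$ and $\mathbb{E}\left[\prod_{i=1}^M(1-\omega(0,i))\right]>0$. The average total drift per site is $\delta:=\mathbb{E}\left[\sum_{i=1}^M(2\omega(0,i)-1)\right]$. *)

theory Defs
  imports "HOL-Probability.Probability"
begin

text \<open>
  The cookies at a site are numbered from 1, so a row of an environment is an extensional function
  on \<open>{1..}\<close> (it carries no information at 0).
\<close>

definition cookie_row :: "(nat \<Rightarrow> real) measure" where
  "cookie_row = Pi\<^sub>M {1..} (\<lambda>_. borel)"

definition cookie_envs :: "nat \<Rightarrow> (int \<Rightarrow> nat \<Rightarrow> real) set" where
  "cookie_envs M = {\<omega>. \<forall>z. \<omega> z \<in> extensional {1..} \<and>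
     (\<forall>i\<in>{1..M}. \<omega> z i \<in> {0..1}) \<and> (\<forall>i>M. \<omega> z i = 1 / 2)}"

definition env_space :: "nat \<Rightarrow> (int \<Rightarrow> nat \<Rightarrow> real) measure" where
  "env_space M = restrict_space (Pi\<^sub>M UNIV (\<lambda>_. cookie_row)) (cookie_envs M)"

definition env_law :: "nat \<Rightarrow> (int \<Rightarrow> nat \<Rightarrow> real) measure \<Rightarrow> bool" where
  "env_law M P \<longleftrightarrow> prob_space P \<and> sets P = sets (env_space M)"

definition iid_sites :: "(int \<Rightarrow> nat \<Rightarrow> real) measure \<Rightarrow> bool" where
  "iid_sites P \<longleftrightarrow>
     prob_space.indep_vars P (\<lambda>_. cookie_row) (\<lambda>z \<omega>. \<omega> z) UNIV \<and>
     (\<forall>z. distr P cookie_row (\<lambda>\<omega>. \<omega> z) = distr P cookie_row (\<lambda>\<omega>. \<omega> 0))"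

definition elliptic :: "nat \<Rightarrow> (int \<Rightarrow> nat \<Rightarrow> real) measure \<Rightarrow> bool" where
  "elliptic M P \<longleftrightarrow>
     (\<integral>\<omega>. (\<Prod>i=1..M. \<omega> 0 i) \<partial>P) > 0 \<and> (\<integral>\<omega>. (\<Prod>i=1..M. 1 - \<omega> 0 i) \<partial>P) > 0"

definition drift :: "nat \<Rightarrow> (int \<Rightarrow> nat \<Rightarrow> real) measure \<Rightarrow> real" where
  "drift M P = (\<integral>\<omega>. (\<Sum>i=1..M. 2 * \<omega> 0 i - 1) \<partial>P)"

text \<open>The sigma-algebra generated by the process \<open>X\<close> up to time \<open>n\<close>.\<close>

definition history :: "'s measure \<Rightarrow> (nat \<Rightarrow> 's \<Rightarrow> int) \<Rightarrow> nat \<Rightarrow> 's measure" where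
  "history Q X n =
     vimage_algebra (space Q) (\<lambda>s. \<lambda>i\<in>{..n}. X i s) (Pi\<^sub>M {..n} (\<lambda>_. count_space UNIV))"

definition visits :: "(nat \<Rightarrow> 's \<Rightarrow> int) \<Rightarrow> nat \<Rightarrow> 's \<Rightarrow> nat" where
  "visits X n s = card {i. i \<le> n \<and> X i s = X n s}"

text \<open>
  Conditional probabilities given the past are conditional expectations of indicators, hence
  determined only almost surely.
\<close>

definition erw :: "(int \<Rightarrow> nat \<Rightarrow> real) \<Rightarrow> int \<Rightarrow> 's measure \<Rightarrow> (nat \<Rightarrow> 's \<Rightarrow> int) \<Rightarrow> bool" where
  "erw \<omega> x Q X \<longleftrightarrow>
     prob_space Q \<and> (\<forall>n. X n \<in> measurable Q (count_space UNIV)) \<and>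
     measure Q {s \<in> space Q. X 0 s = x} = 1 \<and>
     (\<forall>n. AE s in Q.
        real_cond_exp Q (history Q X n) (indicator {s \<in> space Q. X (Suc n) s = X n s + 1}) s
          = \<omega> (X n s) (visits X n s)) \<and>
     (\<forall>n. AE s in Q.
        real_cond_exp Q (history Q X n) (indicator {s \<in> space Q. X (Suc n) s = X n s - 1}) s
          = 1 - \<omega> (X n s) (visits X n s))"

end

theory Submission
  imports Defs
begin

text \<open>
  Realise the walk by independent coins at each site. Up to the first hitting time of level \<open>n\<close>,
  the number of steps down from \<open>k\<close> is a function of the coins at \<open>k\<close> and of the number of steps
  down from \<open>k + 1\<close>: read from right to left these numbers form a branching process with one
  immigrant per generation at the sites \<open>0, \<dots>, n - 1\<close> and none on the negative half-line, and the
  hitting time is \<open>n\<close> plus twice their sum. The process increases in \<open>n\<close>, so its limit is a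
  stationary function of the rows of coins to the right, and the ergodic theorem squeezes the
  hitting time divided by \<open>n\<close> between \<open>1 + 2 * e L\<close> and \<open>1 + 2 * sup e\<close>, where \<open>e L\<close> is the mean of
  generation \<open>L\<close>. So the speed is \<open>1 / (1 + 2 * sup e)\<close>, and only the finiteness of \<open>sup e\<close>
  is at stake.

  Write \<open>\<delta>\<close> for the drift and \<open>V\<close> for the current generation. The second moment changes in one
  step by at most \<open>- 2 * (\<delta> - 2) * V\<close> plus a constant, which bounds \<open>e\<close> if \<open>\<delta> > 2\<close>. If \<open>\<delta> \<le> 2\<close> and
  \<open>e\<close> were bounded, a stationary law with finite mean would exist; it is excluded by test functions
  of linear growth that are submartingales up to a small error and vanish near a chosen atom of the
  stationary law: \<open>max 0 (V - K)\<close> if \<open>\<delta> \<le> 1\<close>, and a rescaled and truncated version of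
  \<open>(1 - x) ^ V - 1 + x * V\<close> with \<open>x \<rightarrow> 0\<close> if \<open>1 < \<delta> \<le> 2\<close>. For \<open>\<delta> < - 2\<close> and for the matching
  lower bound, reflect the walk.
\<close>

section \<open>The walk driven by coins and its down-crossings\<close>

text \<open>The threshold 2 balances drift against variance. From population \<open>V\<close> the
  next generation has mean \<open>V + 1 - \<delta>\<close> for large \<open>V\<close> and variance
  about \<open>2 * V\<close>, so the square moves by \<open>2 * V * (1 - \<delta>) + 2 * V\<close>,
  which is \<open>- 2 * (\<delta> - 2) * V\<close>. The square cannot be tested against a stationary
  law of which only the mean is assumed finite. The function \<open>(1 - x) ^ V - 1 + x * V\<close>
  grows linearly and is close to \<open>x\<^sup>2 * V * (V - 1) / 2\<close> for small
  \<open>x\<close>, so it takes over that role.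

  Neither recurrence nor transience is established beforehand. For \<delta> \<le> 2 it is enough
  that a high level is reached late or never; for \<delta> > 2 the bound on the time spent below a
  level itself shows that the level is reached.

  Averaged over environments, the first \<open>M\<close> coins of a row are dependent. For
  \<open>M \<le> m\<close> they enter the failures before success number \<open>m\<close> only
  through the number of their successes. The averaged result passes to almost every fixed
  environment by Fubini, and to every walk there because the path probabilities determine its
  law.\<close>

primrec walk_state :: "(int \<Rightarrow> nat \<Rightarrow> bool) \<Rightarrow> nat \<Rightarrow> int \<times> (int \<Rightarrow> nat)" where
  "walk_state c 0 = (0, \<lambda>_. 0)"
| "walk_state c (Suc n) =
    (let (x, l) = walk_state c n in (if c x (l x) then x + 1 else x - 1, l(x := l x + 1)))"

definition walk :: "(int \<Rightarrow> nat \<Rightarrow> bool) \<Rightarrow> nat \<Rightarrow> int" where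
  "walk c n = fst (walk_state c n)"

text \<open>Departures are numbered separately at each site, so every coin is consulted at most
  once. This is what turns path probabilities into products.\<close>

definition leaves :: "(int \<Rightarrow> nat \<Rightarrow> bool) \<Rightarrow> nat \<Rightarrow> int \<Rightarrow> nat" where
  "leaves c n = snd (walk_state c n)"

lemma walk_0 [simp]: "walk c 0 = 0" and leaves_0 [simp]: "leaves c 0 k = 0"
  by (simp_all add: walk_def leaves_def)

lemma walk_Suc:
  "walk c (Suc n) = (if c (walk c n) (leaves c n (walk c n)) then walk c n + 1 else walk c n - 1)"
  by (simp add: walk_def leaves_def case_prod_beta Let_def)

lemma leaves_Suc:
  "leaves c (Suc n) k = (if k = walk c n then leaves c n k + 1 else leaves c n k)"
  by (simp add: walk_def leaves_def case_prod_beta Let_def)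

lemma leaves_eq_card: "leaves c n k = card {i. i < n \<and> walk c i = k}"
proof (induction n)
  case (Suc n)
  have "{i. i < Suc n \<and> walk c i = k} =
    (if walk c n = k then insert n {i. i < n \<and> walk c i = k} else {i. i < n \<and> walk c i = k})"
    by (auto simp: less_Suc_eq)
  then show ?case using Suc by (auto simp: leaves_Suc)
qed simp

lemma leaves_eq_0: "(\<And>i. i < n \<Longrightarrow> walk c i \<noteq> k) \<Longrightarrow> leaves c n k = 0"
  by (auto simp: leaves_eq_card)

lemma abs_walk_le: "\<bar>walk c n\<bar> \<le> int n"
  by (induction n) (auto simp: walk_Suc)

lemma abs_walk_diff_le: "m \<le> n \<Longrightarrow> \<bar>walk c n - walk c m\<bar> \<le> int (n - m)"
  by (induction n rule: dec_induct) (auto simp: walk_Suc)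

section \<open>Successes and failures in one row of coins\<close>

definition succs :: "(nat \<Rightarrow> bool) \<Rightarrow> nat \<Rightarrow> nat" where
  "succs r n = card {i. i < n \<and> r i}"

definition fails :: "(nat \<Rightarrow> bool) \<Rightarrow> nat \<Rightarrow> nat" where
  "fails r n = card {i. i < n \<and> \<not> r i}"

lemma succs_0 [simp]: "succs r 0 = 0" and fails_0 [simp]: "fails r 0 = 0"
  by (simp_all add: succs_def fails_def)

lemma succs_Suc: "succs r (Suc n) = (if r n then Suc (succs r n) else succs r n)"
proof -
  have "{i. i < Suc n \<and> r i} = (if r n then insert n {i. i < n \<and> r i} else {i. i < n \<and> r i})"
    by (auto simp: less_Suc_eq)
  then show ?thesis by (simp add: succs_def)
qed

lemma fails_Suc: "fails r (Suc n) = (if r n then fails r n else Suc (fails r n))"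
proof -
  have "{i. i < Suc n \<and> \<not> r i} =
    (if r n then {i. i < n \<and> \<not> r i} else insert n {i. i < n \<and> \<not> r i})"
    by (auto simp: less_Suc_eq)
  then show ?thesis by (simp add: fails_def)
qed

lemma succs_plus_fails: "succs r n + fails r n = n"
  by (induction n) (auto simp: succs_Suc fails_Suc)

lemma succs_mono: "m \<le> n \<Longrightarrow> succs r m \<le> succs r n"
  by (induction n rule: dec_induct) (auto simp: succs_Suc)

lemma succs_le: "succs r n \<le> n"
  using succs_plus_fails[of r n] by simp

lemma succs_unbounded:
  assumes "infinite {i. r i}"
  shows "\<exists>n. m \<le> succs r n"
proof (induction m)
  case (Suc m)
  then obtain n where n: "m \<le> succs r n" by blast
  from assms obtain k where "k \<ge> n" "r k"
    by (metis infinite_nat_iff_unbounded_le mem_Collect_eq)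
  then have "Suc m \<le> succs r (Suc k)"
    using n succs_mono[of n k r] by (simp add: succs_Suc)
  then show ?case by blast
qed auto

text \<open>The value 0 on rows with finitely many successes keeps the function monotone on every row.\<close>

definition fails_before :: "(nat \<Rightarrow> bool) \<Rightarrow> nat \<Rightarrow> nat" where
  "fails_before r m = (if finite {i. r i} then 0 else card {j. \<not> r j \<and> succs r j < m})"

lemma finite_fails_before: "infinite {i. r i} \<Longrightarrow> finite {j. \<not> r j \<and> succs r j < m}"
proof -
  assume "infinite {i. r i}"
  then obtain n where "m \<le> succs r n" using succs_unbounded by blast
  then have "{j. \<not> r j \<and> succs r j < m} \<subseteq> {..<n}"
    using succs_mono[of n _ r] by (force simp: not_less[symmetric])
  then show ?thesis by (rule finite_subset) simp
qed

lemma fails_before_mono: "m \<le> n \<Longrightarrow> fails_before r m \<le> fails_before r n"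
  by (auto simp: fails_before_def intro!: card_mono finite_fails_before)

lemma fails_before_0 [simp]: "fails_before r 0 = 0"
  by (simp add: fails_before_def)

text \<open>Failures read after the last success are preceded by \<open>succs r n\<close> successes;
  the additional success on the right makes room for them.\<close>

lemma fails_le_fails_before:
  assumes "infinite {i. r i}"
  shows "fails r n \<le> fails_before r (Suc (succs r n))"
proof -
  have "{i. i < n \<and> \<not> r i} \<subseteq> {j. \<not> r j \<and> succs r j < Suc (succs r n)}"
    using succs_mono[of _ n r] by (auto simp: less_Suc_eq_le)
  then show ?thesis
    using assms finite_fails_before[OF assms] by (auto simp: fails_def fails_before_def intro!: card_mono)
qed

text \<open>A row stopped right at a success has shown exactly the failures that precede this
  success; a row not yet read is the trivial case.\<close>

lemma fails_eq_fails_before: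
  assumes "infinite {i. r i}" and last: "n > 0 \<Longrightarrow> r (n - 1)"
  shows "fails r n = fails_before r (succs r n)"
proof (cases n)
  case (Suc k)
  then have k: "r k" using last by simp
  have "{i. i < n \<and> \<not> r i} = {j. \<not> r j \<and> succs r j < succs r n}"
  proof (intro set_eqI iffI; clarsimp)
    fix i assume "i < n" "\<not> r i"
    then have "i < k" using k Suc by (cases "i = k") auto
    then show "succs r i < succs r n" using succs_mono[of i k r] k Suc by (simp add: succs_Suc)
  next
    fix i assume "succs r i < succs r n"
    then show "i < n" using succs_mono[of n i r] by (meson not_less)
  qed
  then show ?thesis using assms(1) by (simp add: fails_def fails_before_def)
qed simp

section \<open>Crossings of the edges\<close>

abbreviation ups :: "(int \<Rightarrow> nat \<Rightarrow> bool) \<Rightarrow> nat \<Rightarrow> int \<Rightarrow> nat" where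
  "ups c n k \<equiv> succs (c k) (leaves c n k)"

abbreviation downs :: "(int \<Rightarrow> nat \<Rightarrow> bool) \<Rightarrow> nat \<Rightarrow> int \<Rightarrow> nat" where
  "downs c n k \<equiv> fails (c k) (leaves c n k)"

text \<open>The crossings of the edge between \<open>k\<close> and \<open>k + 1\<close> alternate in
  direction, so their balance depends only on which sides of the edge the start 0 and the present
  position lie.\<close>

lemma ups_minus_downs:
  "int (ups c n k) - int (downs c n (k + 1)) =
     (if 0 \<le> k \<and> k < walk c n then 1 else 0) - (if walk c n \<le> k \<and> k < 0 then 1 else 0)"
proof (induction n)
  case (Suc n)
  show ?case
  proof (cases "c (walk c n) (leaves c n (walk c n))")
    case True
    have a: "ups c (Suc n) k = ups c n k + (if k = walk c n then 1 else 0)"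
      using True by (auto simp: leaves_Suc succs_Suc)
    have b: "downs c (Suc n) (k + 1) = downs c n (k + 1)"
      using True by (auto simp: leaves_Suc fails_Suc)
    have w: "walk c (Suc n) = walk c n + 1" using True by (simp add: walk_Suc)
    show ?thesis using Suc unfolding a b w by (auto split: if_splits)
  next
    case False
    have a: "ups c (Suc n) k = ups c n k"
      using False by (auto simp: leaves_Suc succs_Suc)
    have b: "downs c (Suc n) (k + 1) = downs c n (k + 1) + (if k + 1 = walk c n then 1 else 0)"
      using False by (auto simp: leaves_Suc fails_Suc)
    have w: "walk c (Suc n) = walk c n - 1" using False by (simp add: walk_Suc)
    show ?thesis using Suc unfolding a b w by (auto split: if_splits)
  qed
qed simp

text \<open>A nearest-neighbour walk that is now to the right of \<open>k\<close> must have left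
  \<open>k\<close> upwards the last time it was there.\<close>

lemma last_leave_up:
  "k < walk c n \<Longrightarrow> 0 < leaves c n k \<Longrightarrow> c k (leaves c n k - 1)"
proof (induction n)
  case (Suc n)
  show ?case
  proof (cases "k = walk c n")
    case True
    then show ?thesis using Suc.prems by (auto simp: walk_Suc leaves_Suc split: if_splits)
  next
    case False
    then have l: "leaves c (Suc n) k = leaves c n k" by (simp add: leaves_Suc)
    from False Suc.prems(1) have "k < walk c n" by (auto simp: walk_Suc split: if_splits)
    then show ?thesis using Suc l by simp
  qed
qed simp

text \<open>The branching recursion survives as an inequality at every time, wherever the walk is.
  It becomes an equality as soon as the walk is to the right of \<open>k\<close>.\<close>

lemma downs_le:
  assumes "infinite {i. c k i}"
  shows "downs c n k \<le> fails_before (c k) (downs c n (k + 1) + (if 0 \<le> k then 1 else 0))"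
proof (cases "k < walk c n")
  case True
  then have "ups c n k = downs c n (k + 1) + (if 0 \<le> k then 1 else 0)"
    using ups_minus_downs[where c=c and n=n and k=k] by (auto split: if_splits)
  then show ?thesis
    using fails_eq_fails_before[OF assms last_leave_up[OF True]] by simp
next
  case False
  \<comment> \<open>At \<open>k\<close> or to its left the balance of crossings is one lower than to
    its right, for either sign of \<open>k\<close>. The additional success in
    \<open>fails_le_fails_before\<close> makes up for it.\<close>
  then have "Suc (ups c n k) = downs c n (k + 1) + (if 0 \<le> k then 1 else 0)"
    using ups_minus_downs[where c=c and n=n and k=k] by (auto split: if_splits)
  then show ?thesis using fails_le_fails_before[OF assms, of "leaves c n k"] by simp
qed

lemma downs_eq:
  assumes "infinite {i. c k i}" "k < walk c n"
  shows "downs c n k = fails_before (c k) (downs c n (k + 1) + (if 0 \<le> k then 1 else 0))"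
proof -
  have "ups c n k = downs c n (k + 1) + (if 0 \<le> k then 1 else 0)"
    using ups_minus_downs[where c=c and n=n and k=k] assms(2) by (auto split: if_splits)
  then show ?thesis
    using fails_eq_fails_before[OF assms(1) last_leave_up[OF assms(2)]] by simp
qed

text \<open>Time is the number of up-steps plus the number of down-steps, and the position is their
  difference. No site outside the summation range is visited by time \<open>n\<close>.\<close>

lemma time_eq:
  "n \<le> N \<Longrightarrow> int n = walk c n + 2 * (\<Sum>k=-int N..int N. int (downs c n k))"
proof (induction n)
  case (Suc n)
  let ?S = "{-int N..int N}"
  have S: "walk c n \<in> ?S" using abs_walk_le[of c n] Suc.prems by auto
  have IH: "int n = walk c n + 2 * (\<Sum>k\<in>?S. int (downs c n k))" using Suc by simp
  show ?case
  proof (cases "c (walk c n) (leaves c n (walk c n))")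
    case True
    have "downs c (Suc n) k = downs c n k" for k
      using True by (auto simp: leaves_Suc fails_Suc)
    then show ?thesis using IH True by (simp add: walk_Suc)
  next
    case False
    have "int (downs c (Suc n) k) = int (downs c n k) + (if k = walk c n then 1 else 0)" for k
      using False by (auto simp: leaves_Suc fails_Suc)
    then have "(\<Sum>k\<in>?S. int (downs c (Suc n) k)) = (\<Sum>k\<in>?S. int (downs c n k)) + 1"
      using S by (simp add: sum.distrib sum.delta)
    then show ?thesis using IH False by (simp add: walk_Suc)
  qed
qed simp

section \<open>The branching process read from right to left\<close>

definition seq_tl :: "(nat \<Rightarrow> 'a) \<Rightarrow> nat \<Rightarrow> 'a" where
  "seq_tl y = (\<lambda>i. y (Suc i))"

definition rows :: "int \<Rightarrow> (int \<Rightarrow> 'a) \<Rightarrow> nat \<Rightarrow> 'a" where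
  "rows k c = (\<lambda>i. c (k + int i))"

text \<open>The recursion processes the leftmost row last, so the process starts empty at distance
  \<open>n\<close> to the right. Different \<open>n\<close> share the rows near the origin: this is
  coupling from the past, and the values increase pointwise in \<open>n\<close> instead of merely
  converging in law.\<close>

primrec immig :: "nat \<Rightarrow> (nat \<Rightarrow> nat \<Rightarrow> bool) \<Rightarrow> nat" where
  "immig 0 y = 0"
| "immig (Suc n) y = fails_before (y 0) (immig n (seq_tl y) + 1)"

text \<open>\<open>D\<close> supplies the population at the first site to the right of the
  \<open>n\<close> rows; in the application this site is the origin and \<open>D\<close> is the
  stationary limit.\<close>

primrec no_immig :: "((nat \<Rightarrow> nat \<Rightarrow> bool) \<Rightarrow> nat) \<Rightarrow> nat \<Rightarrow> (nat \<Rightarrow> nat \<Rightarrow> bool) \<Rightarrow> nat" where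
  "no_immig D 0 y = D y"
| "no_immig D (Suc n) y = fails_before (y 0) (no_immig D n (seq_tl y))"

lemma immig_Suc_ge: "immig n y \<le> immig (Suc n) y"
proof (induction n arbitrary: y)
  case (Suc n)
  show ?case using Suc[of "seq_tl y"] by (simp add: fails_before_mono)
qed simp

lemma immig_mono: "m \<le> n \<Longrightarrow> immig m y \<le> immig n y"
  by (rule lift_Suc_mono_le[of "\<lambda>n. immig n y"]) (rule immig_Suc_ge)

lemma rows_0 [simp]: "rows k c 0 = c k" and seq_tl_rows [simp]: "seq_tl (rows k c) = rows (k + 1) c"
  by (auto simp: rows_def seq_tl_def fun_eq_iff algebra_simps)

lemma downs_le_immig:
  assumes inf: "\<And>k. infinite {i. c k i}" and below: "\<And>i. i < t \<Longrightarrow> walk c i < int n"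
  shows "j \<le> n \<Longrightarrow> downs c t (int (n - j)) \<le> immig j (rows (int (n - j)) c)"
proof (induction j)
  case 0
  then show ?case using leaves_eq_0[where n=t and c=c and k="int n"] below by force
next
  case (Suc j)
  let ?k = "int (n - Suc j)"
  have k: "?k + 1 = int (n - j)" using Suc.prems by auto
  have "downs c t ?k \<le> fails_before (c ?k) (downs c t (?k + 1) + 1)"
    using downs_le[where c=c and n=t and k="?k", OF inf] by simp
  also have "\<dots> \<le> fails_before (c ?k) (immig j (rows (int (n - j)) c) + 1)"
    using Suc by (intro fails_before_mono) (simp add: k)
  also have "\<dots> = immig (Suc j) (rows ?k c)" using k by simp
  finally show ?case .
qed

lemma downs_eq_immig:
  assumes inf: "\<And>k. infinite {i. c k i}" and below: "\<And>i. i < t \<Longrightarrow> walk c i < int n"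
    and hit: "walk c t = int n"
  shows "j \<le> n \<Longrightarrow> downs c t (int (n - j)) = immig j (rows (int (n - j)) c)"
proof (induction j)
  case 0
  then show ?case using leaves_eq_0[where n=t and c=c and k="int n"] below by force
next
  case (Suc j)
  let ?k = "int (n - Suc j)"
  have k: "?k + 1 = int (n - j)" using Suc.prems by auto
  have "downs c t ?k = fails_before (c ?k) (downs c t (?k + 1) + 1)"
    using downs_eq[where c=c and n=t and k="?k", OF inf] hit Suc.prems by simp
  also have "\<dots> = immig (Suc j) (rows ?k c)" using k Suc by simp
  finally show ?case .
qed

lemma hitting_time_ge:
  assumes inf: "\<And>k. infinite {i. c k i}" and below: "\<And>i. i < t \<Longrightarrow> walk c i < int n"
    and hit: "walk c t = int n"
  shows "n + 2 * (\<Sum>k<n. immig (n - k) (rows (int k) c)) \<le> t"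
proof -
  have nt: "n \<le> t" using abs_walk_le[of c t] hit by simp
  have "(\<Sum>k<n. int (immig (n - k) (rows (int k) c))) = (\<Sum>k<n. int (downs c t (int k)))"
  proof (rule sum.cong[OF refl])
    fix k assume "k \<in> {..<n}"
    then show "int (immig (n - k) (rows (int k) c)) = int (downs c t (int k))"
      using downs_eq_immig[where c=c and t=t and n=n and j="n - k", OF inf below hit] by simp
  qed
  also have "\<dots> = (\<Sum>k\<in>int ` {..<n}. int (downs c t k))"
    by (simp add: sum.reindex)
  \<comment> \<open>The steps down from negative sites are dropped, which is harmless for a lower
    bound.\<close>
  also have "\<dots> \<le> (\<Sum>k=-int t..int t. int (downs c t k))"
    using nt by (intro sum_mono2) auto
  finally have "int n + 2 * (\<Sum>k<n. int (immig (n - k) (rows (int k) c))) \<le> int t"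
    using time_eq[where n=t and c=c, OF order_refl] hit by simp
  then have "int (n + 2 * (\<Sum>k<n. immig (n - k) (rows (int k) c))) \<le> int t"
    by simp
  then show ?thesis by (simp only: of_nat_le_iff)
qed

text \<open>It is not assumed that level \<open>n\<close> is ever reached. Once the last sum is
  bounded uniformly in \<open>t\<close>, the inequality limits the time that the walk can stay below
  \<open>n\<close>, and so forces the hitting.\<close>

lemma time_below_le:
  assumes inf: "\<And>k. infinite {i. c k i}" and below: "\<And>i. i < t \<Longrightarrow> walk c i < int n"
    and D: "\<And>n k. 0 \<le> k \<Longrightarrow> immig n (rows k c) \<le> D (rows k c)" and n: "0 < n"
  shows "t \<le> n + 2 * (\<Sum>k<n. D (rows (int k) c)) + 2 * (\<Sum>j=1..t. no_immig D j (rows (- int j) c))"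
proof -
  have neg: "downs c t (- int j) \<le> no_immig D j (rows (- int j) c)" for j
  proof (induction j)
    case 0
    have "downs c t 0 \<le> immig n (rows 0 c)"
      using downs_le_immig[where c=c and t=t and n=n and j=n, OF inf below] by simp
    then show ?case using D[of 0 n] by simp
  next
    case (Suc j)
    have "downs c t (- int (Suc j)) \<le> fails_before (c (- int (Suc j))) (downs c t (- int j))"
      using downs_le[where c=c and n=t and k="- int (Suc j)", OF inf] by simp
    also have "\<dots> \<le> fails_before (c (- int (Suc j))) (no_immig D j (rows (- int j) c))"
      by (intro fails_before_mono Suc)
    finally show ?case by simp
  qed
  have pos: "downs c t (int k) \<le> D (rows (int k) c)" if "k < n" for k
    using downs_le_immig[where c=c and t=t and n=n and j="n - k", OF inf below] D[of "int k" "n - k"] that by simp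
  have high: "downs c t (int k) = 0" if "n \<le> k" for k
    using leaves_eq_0[where n=t and c=c and k="int k"] below that by (metis fails_0 not_less of_nat_less_iff)
  have walk: "walk c t \<le> int n"
  proof (cases t)
    case (Suc s)
    then show ?thesis using below[of s] by (auto simp: walk_Suc split: if_splits)
  qed simp
  \<comment> \<open>The maximum lets the nonnegative sites cover both the range of
    \<open>time_eq\<close> and all levels below \<open>n\<close>.\<close>
  have set: "{- int t..int t} \<subseteq> int ` {..<max n (Suc t)} \<union> (\<lambda>j. - int j) ` {1..t}"
  proof
    fix k assume k: "k \<in> {- int t..int t}"
    show "k \<in> int ` {..<max n (Suc t)} \<union> (\<lambda>j. - int j) ` {1..t}"
    proof (cases "0 \<le> k")
      case True
      then show ?thesis using k by (intro UnI1 image_eqI[of _ _ "nat k"]) auto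
    next
      case False
      then show ?thesis using k by (intro UnI2 image_eqI[of _ _ "nat (- k)"]) auto
    qed
  qed
  have "(\<Sum>k=-int t..int t. int (downs c t k)) \<le>
      (\<Sum>k\<in>int ` {..<max n (Suc t)} \<union> (\<lambda>j. - int j) ` {1..t}. int (downs c t k))"
    using set by (intro sum_mono2) auto
  also have "\<dots> = (\<Sum>k\<in>int ` {..<max n (Suc t)}. int (downs c t k)) +
      (\<Sum>k\<in>(\<lambda>j. - int j) ` {1..t}. int (downs c t k))"
    by (intro sum.union_disjoint) auto
  also have "\<dots> = (\<Sum>k<max n (Suc t). int (downs c t (int k))) +
      (\<Sum>j=1..t. int (downs c t (- int j)))"
    by (simp add: sum.reindex inj_on_def)
  also have "(\<Sum>k<max n (Suc t). int (downs c t (int k))) = (\<Sum>k<n. int (downs c t (int k)))"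
    by (intro sum.mono_neutral_right) (auto simp: high)
  also have "(\<Sum>k<n. int (downs c t (int k))) + (\<Sum>j=1..t. int (downs c t (- int j))) \<le>
      (\<Sum>k<n. int (D (rows (int k) c))) + (\<Sum>j=1..t. int (no_immig D j (rows (- int j) c)))"
    using pos neg by (intro add_mono sum_mono) auto
  finally have "int t \<le> int n + 2 * ((\<Sum>k<n. int (D (rows (int k) c))) +
      (\<Sum>j=1..t. int (no_immig D j (rows (- int j) c))))"
    using time_eq[where n=t and c=c, OF order_refl] walk by simp
  also have "\<dots> = int (n + 2 * (\<Sum>k<n. D (rows (int k) c)) +
      2 * (\<Sum>j=1..t. no_immig D j (rows (- int j) c)))"
    by simp
  finally show ?thesis by (simp only: of_nat_le_iff)
qed

section \<open>The ergodic theorem for i.i.d. sequences\<close>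

lemma seq_tl_funpow: "(seq_tl ^^ k) y = (\<lambda>i. y (i + k))"
proof (induction k)
  case (Suc k)
  then show ?case by (simp add: seq_tl_def)
qed simp

text \<open>The maximum of the Birkhoff sums of \<open>g\<close> over all lengths up to
  \<open>n\<close>, the empty sum included. The recursion splits off the first term, which is the
  form that the maximal inequality needs.\<close>

primrec max_sum :: "((nat \<Rightarrow> 'a) \<Rightarrow> real) \<Rightarrow> nat \<Rightarrow> (nat \<Rightarrow> 'a) \<Rightarrow> real" where
  "max_sum g 0 x = 0"
| "max_sum g (Suc n) x = max 0 (g x + max_sum g n (seq_tl x))"

lemma max_sum_nonneg: "0 \<le> max_sum g n x"
  by (cases n) auto

lemma max_sum_Suc_ge: "max_sum g n x \<le> max_sum g (Suc n) x"
proof (induction n arbitrary: x)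
  case (Suc n)
  show ?case using Suc[of "seq_tl x"] by simp
qed simp

lemma max_sum_mono: "m \<le> n \<Longrightarrow> max_sum g m x \<le> max_sum g n x"
  by (rule lift_Suc_mono_le[of "\<lambda>n. max_sum g n x"]) (rule max_sum_Suc_ge)

lemma birkhoff_sum_le_max_sum: "(\<Sum>k<n. g ((seq_tl ^^ k) x)) \<le> max_sum g n x"
proof (induction n arbitrary: x)
  case (Suc n)
  have "(\<Sum>k<Suc n. g ((seq_tl ^^ k) x)) = g x + (\<Sum>k<n. g ((seq_tl ^^ k) (seq_tl x)))"
    by (subst sum.lessThan_Suc_shift) (simp add: funpow_swap1)
  also have "\<dots> \<le> g x + max_sum g n (seq_tl x)" using Suc[of "seq_tl x"] by simp
  also have "\<dots> \<le> max_sum g (Suc n) x" by simp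
  finally show ?case .
qed simp

context sequence_space
begin

lemma measurable_seq_tl [measurable]: "seq_tl \<in> measurable S S"
  unfolding seq_tl_def by (intro measurable_PiM_single') (auto simp: space_PiM PiE_iff)

lemma distr_seq_tl: "distr S S seq_tl = S"
  using distr_PiM_reindex[of UNIV "\<lambda>_. M" Suc UNIV] M.prob_space_axioms
  by (simp add: seq_tl_def[abs_def] restrict_def)

text \<open>
  A shift-invariant event is independent of the first \<open>n\<close> coordinates for every \<open>n\<close>, so that
  conditioning on it does not change the measure.
\<close>

lemma seq_tl_zero_one:
  assumes A: "A \<in> sets S" and inv: "\<And>x. x \<in> space S \<Longrightarrow> seq_tl x \<in> A \<longleftrightarrow> x \<in> A"
  shows "emeasure S A = 0 \<or> emeasure S A = 1"
proof (rule disjCI)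
  assume "emeasure S A \<noteq> 1"
  show "emeasure S A = 0"
  proof (rule ccontr)
    assume nz: "emeasure S A \<noteq> 0"
    have tl_space: "seq_tl x \<in> space S" if "x \<in> space S" for x
      using measurable_space[OF measurable_seq_tl that] .
    have inv_n: "(seq_tl ^^ n) x \<in> A \<longleftrightarrow> x \<in> A" if "x \<in> space S" for x n
      using that
    proof (induction n arbitrary: x)
      case (Suc n)
      then show ?case using inv[OF Suc.prems] tl_space[OF Suc.prems] by (simp add: funpow_swap1)
    qed simp
    have "uniform_measure S A = S"
    proof (rule measure_eqI_PiM_infinite)
      fix E :: "nat \<Rightarrow> 'a set" and J :: "nat set"
      assume J: "finite J" "J \<subseteq> UNIV" "\<And>i. i \<in> J \<Longrightarrow> E i \<in> sets M"
      let ?C = "prod_emb UNIV (\<lambda>_. M) J (Pi\<^sub>E J E)"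
      have C: "?C \<in> sets S" using J by (intro sets_PiM_I) auto
      obtain n where n: "J \<subseteq> {..<n}" using J(1) finite_nat_bounded by blast
      have "emeasure S (A \<inter> ?C) =
          emeasure (distr (S \<Otimes>\<^sub>M S) S (\<lambda>(\<omega>, \<omega>'). comb_seq n \<omega> \<omega>')) (A \<inter> ?C)"
        by (simp only: PiM_comb_seq)
      also have "\<dots> = emeasure (S \<Otimes>\<^sub>M S)
          ((\<lambda>(\<omega>, \<omega>'). comb_seq n \<omega> \<omega>') -` (A \<inter> ?C) \<inter> space (S \<Otimes>\<^sub>M S))"
        using A C by (intro emeasure_distr measurable_comb_seq) auto
      \<comment> \<open>The first \<open>n\<close> coordinates decide the cylinder; by invariance
        the remaining ones decide \<open>A\<close>.\<close>
      also have "(\<lambda>(\<omega>, \<omega>'). comb_seq n \<omega> \<omega>') -` (A \<inter> ?C) \<inter> space (S \<Otimes>\<^sub>M S) = ?C \<times> A"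
      proof (intro set_eqI iffI; clarsimp simp: space_pair_measure)
        fix \<omega> \<omega>' assume *: "comb_seq n \<omega> \<omega>' \<in> A" "comb_seq n \<omega> \<omega>' \<in> ?C" "\<omega> \<in> space S" "\<omega>' \<in> space S"
        have "comb_seq n \<omega> \<omega>' \<in> space S" using *(1) A sets.sets_into_space by blast
        then have "(seq_tl ^^ n) (comb_seq n \<omega> \<omega>') \<in> A" using *(1) inv_n by blast
        moreover have "\<omega> \<in> ?C" using *(2,3) n
          by (auto simp: prod_emb_def PiE_iff comb_seq_def subset_iff space_PiM split: if_splits)
        ultimately show "\<omega> \<in> ?C \<and> \<omega>' \<in> A"
          by (simp add: seq_tl_funpow comb_seq_add)
      next
        fix \<omega> \<omega>' assume *: "\<omega> \<in> ?C" "\<omega>' \<in> A"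
        have sp: "\<omega> \<in> space S" "\<omega>' \<in> space S"
          using * A C sets.sets_into_space by blast+
        then have "comb_seq n \<omega> \<omega>' \<in> space S"
          by (auto simp: space_PiM PiE_iff comb_seq_def)
        moreover have "(seq_tl ^^ n) (comb_seq n \<omega> \<omega>') \<in> A"
          using *(2) by (simp add: seq_tl_funpow comb_seq_add)
        ultimately show "comb_seq n \<omega> \<omega>' \<in> A \<and> comb_seq n \<omega> \<omega>' \<in> ?C \<and> \<omega> \<in> space S \<and> \<omega>' \<in> space S"
          using inv_n * n sp
          by (auto simp: prod_emb_def PiE_iff comb_seq_def subset_iff space_PiM split: if_splits)
      qed
      also have "emeasure (S \<Otimes>\<^sub>M S) (?C \<times> A) = emeasure S ?C * emeasure S A"
        using A C by (intro P.emeasure_pair_measure_Times)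
      finally have "emeasure S (A \<inter> ?C) = emeasure S ?C * emeasure S A" .
      then show "emeasure (uniform_measure S A) ?C = emeasure S ?C"
        using nz A C by (simp add: P.emeasure_eq_measure ennreal_mult_divide_eq)
    next
      show "finite_measure (uniform_measure S A)"
        using prob_space_uniform_measure[OF nz] P.emeasure_finite
        by (simp add: prob_space.finite_measure)
    qed auto
    then have "emeasure S A = emeasure (uniform_measure S A) A" by simp
    also have "\<dots> = 1" using nz by (intro emeasure_uniform_measure_1) auto
    finally show False using \<open>emeasure S A \<noteq> 1\<close> by simp
  qed
qed

lemma integral_seq_tl:
  fixes f :: "(nat \<Rightarrow> 'a) \<Rightarrow> real"
  assumes [measurable]: "f \<in> borel_measurable S"
  shows "(\<integral>x. f (seq_tl x) \<partial>S) = (\<integral>x. f x \<partial>S)"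
  using integral_distr[OF measurable_seq_tl assms] by (simp add: distr_seq_tl)

lemma integrable_seq_tl:
  fixes f :: "(nat \<Rightarrow> 'a) \<Rightarrow> real"
  assumes f: "integrable S f"
  shows "integrable S (\<lambda>x. f (seq_tl x))"
proof -
  have "integrable (distr S S seq_tl) f" using f by (simp only: distr_seq_tl)
  then show ?thesis by (rule integrable_distr[OF measurable_seq_tl])
qed

lemma integrable_max_sum:
  assumes g: "integrable S g"
  shows "integrable S (max_sum g n)"
proof (induction n)
  case (Suc n)
  have "integrable S (\<lambda>x. max 0 (g x + max_sum g n (seq_tl x)))"
    by (rule Bochner_Integration.integrable_max[OF P.integrable_const
          Bochner_Integration.integrable_add[OF g integrable_seq_tl[OF Suc]]])
  moreover have "max_sum g (Suc n) = (\<lambda>x. max 0 (g x + max_sum g n (seq_tl x)))"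
    by (simp add: fun_eq_iff)
  ultimately show ?case by (simp only:)
next
  case 0
  have "max_sum g 0 = (\<lambda>x. 0)" by (simp add: fun_eq_iff)
  then show ?case by (simp only: integrable_zero)
qed

lemma borel_measurable_max_sum [measurable]:
  assumes [measurable]: "g \<in> borel_measurable S"
  shows "max_sum g n \<in> borel_measurable S"
proof (induction n)
  case (Suc n)
  note [measurable] = Suc
  have "max_sum g (Suc n) = (\<lambda>x. max 0 (g x + max_sum g n (seq_tl x)))"
    by (simp add: fun_eq_iff)
  moreover have "(\<lambda>x. max 0 (g x + max_sum g n (seq_tl x))) \<in> borel_measurable S" by measurable
  ultimately show ?case by (simp only:)
next
  case 0
  have "max_sum g 0 = (\<lambda>x. 0)" by (simp add: fun_eq_iff)
  then show ?case by (simp only: borel_measurable_const)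
qed

text \<open>Garsia's argument: on the event, the maximum exceeds its shift by at most \<open>g\<close>.\<close>

lemma maximal_ergodic:
  assumes g: "integrable S g"
  shows "0 \<le> (\<integral>x. indicator {x\<in>space S. \<exists>n. 0 < max_sum g n x} x * g x \<partial>S)"
proof -
  have [measurable]: "g \<in> borel_measurable S" using g by auto
  let ?B = "\<lambda>n. {x\<in>space S. 0 < max_sum g n x}"
  have nn: "0 \<le> (\<integral>x. indicator (?B n) x * g x \<partial>S)" for n
  proof -
    have le: "max_sum g n x \<le> indicator (?B n) x * g x + max_sum g n (seq_tl x)"
      if "x \<in> space S" for x
    proof (cases n)
      case (Suc m)
      then show ?thesis
        using max_sum_Suc_ge[of g m "seq_tl x"] max_sum_nonneg[of g n "seq_tl x"]
          max_sum_nonneg[of g n x] that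
        by (auto simp: indicator_def max_def split: if_splits)
    qed simp
    have i: "integrable S (\<lambda>x. indicator (?B n) x * g x)"
      using integrable_mult_indicator[of "?B n" S g] g by simp
    have "(\<integral>x. max_sum g n x \<partial>S) \<le> (\<integral>x. indicator (?B n) x * g x + max_sum g n (seq_tl x) \<partial>S)"
      by (intro integral_mono integrable_max_sum[OF g] i Bochner_Integration.integrable_add
          integrable_seq_tl[OF integrable_max_sum[OF g]] le)
    also have "\<dots> = (\<integral>x. indicator (?B n) x * g x \<partial>S) + (\<integral>x. max_sum g n x \<partial>S)"
      by (subst Bochner_Integration.integral_add)
        (auto intro!: i integrable_seq_tl[OF integrable_max_sum[OF g]] simp: integral_seq_tl)
    finally show ?thesis by simp
  qed
  have "(\<lambda>n. \<integral>x. indicator (?B n) x * g x \<partial>S) \<longlonglongrightarrow>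
      (\<integral>x. indicator {x\<in>space S. \<exists>n. 0 < max_sum g n x} x * g x \<partial>S)"
  proof (rule integral_dominated_convergence[where w = "\<lambda>x. norm (g x)"])
    show "AE x in S. (\<lambda>n. indicator (?B n) x * g x) \<longlonglongrightarrow>
        indicator {x\<in>space S. \<exists>n. 0 < max_sum g n x} x * g x"
    proof (rule AE_I2)
      fix x assume x: "x \<in> space S"
      have "eventually (\<lambda>n. indicator (?B n) x * g x =
          indicator {x\<in>space S. \<exists>n. 0 < max_sum g n x} x * g x) sequentially"
      proof (cases "\<exists>n. 0 < max_sum g n x")
        case True
        then obtain n where "0 < max_sum g n x" by blast
        then have "0 < max_sum g m x" if "m \<ge> n" for m
          using max_sum_mono[OF that, of g x] by linarith
        then show ?thesis
          using x True by (auto simp: eventually_sequentially indicator_def)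
      qed (auto simp: indicator_def)
      then show "(\<lambda>n. indicator (?B n) x * g x) \<longlonglongrightarrow>
        indicator {x\<in>space S. \<exists>n. 0 < max_sum g n x} x * g x"
        by (rule tendsto_eventually)
    qed
  qed (use g in \<open>auto simp: indicator_def\<close>)
  then show ?thesis by (rule LIMSEQ_le_const) (use nn in auto)
qed

text \<open>Unboundedness of the maxima is a shift-invariant event, hence of probability 0 or 1. If
  it had probability 1, the event in \<open>maximal_ergodic\<close> would be almost sure and the
  integral of \<open>g\<close> would be nonnegative.\<close>

lemma AE_max_sum_bounded:
  assumes g: "integrable S g" and neg: "(\<integral>x. g x \<partial>S) < 0"
  shows "AE x in S. \<exists>C. \<forall>n. max_sum g n x \<le> C"
proof -
  have [measurable]: "g \<in> borel_measurable S" using g by auto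
  let ?A = "{x\<in>space S. \<forall>K::nat. \<exists>n. real K < max_sum g n x}"
  have A: "?A \<in> sets S" by measurable
  have tl_space: "seq_tl x \<in> space S" if "x \<in> space S" for x
    using measurable_space[OF measurable_seq_tl that] .
  have "seq_tl x \<in> ?A \<longleftrightarrow> x \<in> ?A" if x: "x \<in> space S" for x
  proof
    assume "seq_tl x \<in> ?A"
    have "\<exists>n. real K < max_sum g n x" for K
    proof -
      obtain K' where K': "real K - g x \<le> real K'" using real_arch_simple by blast
      from \<open>seq_tl x \<in> ?A\<close> obtain n where "real K' < max_sum g n (seq_tl x)" by auto
      then have "real K < max_sum g (Suc n) x" using K' by simp
      then show ?thesis by blast
    qed
    then show "x \<in> ?A" using x by simp
  next
    assume "x \<in> ?A"
    have "\<exists>n. real K < max_sum g n (seq_tl x)" for K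
    proof -
      obtain K' where K': "real K + \<bar>g x\<bar> \<le> real K'" using real_arch_simple by blast
      from \<open>x \<in> ?A\<close> obtain n where n: "real K' < max_sum g n x" by auto
      then obtain m where "n = Suc m" by (cases n) auto
      then have "real K < max_sum g m (seq_tl x)" using K' n by (auto simp: max_def split: if_splits)
      then show ?thesis by blast
    qed
    then show "seq_tl x \<in> ?A" using tl_space[OF x] by simp
  qed
  from seq_tl_zero_one[OF A this] have "emeasure S ?A = 0 \<or> emeasure S ?A = 1" by blast
  then show ?thesis
  proof
    assume "emeasure S ?A = 0"
    then have "AE x in S. x \<notin> ?A" using A by (simp add: AE_iff_measurable[OF A])
    with AE_space show ?thesis
      by eventually_elim (auto simp: not_less)
  next
    assume "emeasure S ?A = 1"
    then have ae: "AE x in S. x \<in> ?A" using P.AE_in_set_eq_1[OF A] by (simp add: P.emeasure_eq_measure)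
    have "AE x in S. indicator {x\<in>space S. \<exists>n. 0 < max_sum g n x} x * g x = g x"
      using ae by eventually_elim (auto simp: indicator_def dest: spec[of _ 0])
    then have "(\<integral>x. indicator {x\<in>space S. \<exists>n. 0 < max_sum g n x} x * g x \<partial>S) = (\<integral>x. g x \<partial>S)"
      by (intro integral_cong_AE) auto
    then show ?thesis using maximal_ergodic[OF g] neg by simp
  qed
qed

text \<open>The function \<open>f - a\<close> has negative mean, so its Birkhoff sums are bounded
  above.\<close>

lemma AE_birkhoff_sum_le:
  assumes f: "integrable S f" and a: "(\<integral>x. f x \<partial>S) < a"
  shows "AE x in S. \<exists>C. \<forall>n. (\<Sum>k<n. f ((seq_tl ^^ k) x)) \<le> real n * a + C"
proof -
  let ?g = "\<lambda>x. f x - a"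
  have "AE x in S. \<exists>C. \<forall>n. max_sum ?g n x \<le> C"
    using f a by (intro AE_max_sum_bounded) (auto simp: P.prob_space)
  then show ?thesis
  proof eventually_elim
    case (elim x)
    then obtain C where C: "\<And>n. max_sum ?g n x \<le> C" by blast
    have "(\<Sum>k<n. f ((seq_tl ^^ k) x)) \<le> real n * a + C" for n
      using birkhoff_sum_le_max_sum[of ?g x n] C[of n] by (simp add: sum_subtractf)
    then show ?case by blast
  qed
qed

text \<open>The one-sided bound is applied to \<open>f\<close> and to \<open>- f\<close> with slack
  \<open>1 / Suc j\<close>; countably many slacks suffice, so the exceptional sets can be
  united.\<close>

theorem ergodic_theorem:
  assumes f: "integrable S f"
  shows "AE x in S. (\<lambda>n. (\<Sum>k<n. f ((seq_tl ^^ k) x)) / real n) \<longlonglongrightarrow> (\<integral>x. f x \<partial>S)"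
proof -
  let ?e = "\<integral>x. f x \<partial>S"
  have up: "AE x in S. \<forall>j. \<exists>C. \<forall>n. (\<Sum>k<n. f ((seq_tl ^^ k) x)) \<le> real n * (?e + 1 / Suc j) + C"
    unfolding AE_all_countable by (intro allI AE_birkhoff_sum_le f) simp
  have lo: "AE x in S. \<forall>j. \<exists>C. \<forall>n. (\<Sum>k<n. - f ((seq_tl ^^ k) x)) \<le> real n * (- ?e + 1 / Suc j) + C"
    unfolding AE_all_countable by (intro allI AE_birkhoff_sum_le) (use f in auto)
  from up lo show ?thesis
  proof eventually_elim
    case (elim x)
    let ?s = "\<lambda>n. \<Sum>k<n. f ((seq_tl ^^ k) x)"
    show ?case
    proof (rule LIMSEQ_I)
      fix r :: real assume r: "0 < r"
      then obtain j where j: "1 / Suc j < r / 2"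
        by (metis half_gt_zero_iff nat_approx_posE)
      from elim(1) obtain C where C: "\<And>n. ?s n \<le> real n * (?e + 1 / Suc j) + C" by blast
      from elim(2) obtain D where "\<And>n. (\<Sum>k<n. - f ((seq_tl ^^ k) x)) \<le> real n * (- ?e + 1 / Suc j) + D"
        by blast
      then have D: "- ?s n \<le> real n * (- ?e + 1 / Suc j) + D" for n by (simp add: sum_negf)
      obtain N where N: "2 * (\<bar>C\<bar> + \<bar>D\<bar>) / r < real N" using reals_Archimedean2 by blast
      show "\<exists>no. \<forall>n\<ge>no. norm (?s n / real n - ?e) < r"
      proof (intro exI[of _ "Suc N"] allI impI)
        fix n assume n: "Suc N \<le> n"
        then have n0: "0 < real n" by simp
        have "2 * (\<bar>C\<bar> + \<bar>D\<bar>) < real N * r" using N r by (simp add: field_simps)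
        also have "\<dots> \<le> real n * r" using n r by (intro mult_right_mono) auto
        finally have b: "\<bar>C\<bar> + \<bar>D\<bar> < real n * (r / 2)" by simp
        have c: "real n * (1 / Suc j) < real n * (r / 2)" using n0 j by (rule mult_strict_left_mono[rotated])
        have u: "?s n - real n * ?e < real n * r"
          using C[of n] b c unfolding distrib_left by linarith
        have "real n * (- ?e + 1 / Suc j) = real n * (1 / Suc j) - real n * ?e"
          by (simp add: right_diff_distrib)
        then have l: "- (real n * r) < ?s n - real n * ?e"
          using D[of n] b c by linarith
        have "\<bar>?s n - real n * ?e\<bar> < r * real n"
          using u l by (simp add: abs_less_iff mult.commute)
        then have "\<bar>?s n - real n * ?e\<bar> / real n < r"
          using n0 by (simp only: pos_divide_less_eq)
        moreover have "?s n / real n - ?e = (?s n - real n * ?e) / real n"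
          using n0 by (simp add: diff_divide_distrib)
        ultimately show "norm (?s n / real n - ?e) < r"
          by (simp add: abs_divide)
      qed
    qed
  qed
qed

end

section \<open>Failures before the m-th success of a fair coin\<close>

abbreviation row_space :: "(nat \<Rightarrow> bool) measure" where
  "row_space \<equiv> Pi\<^sub>M UNIV (\<lambda>_. count_space UNIV)"

lemma sets_Collect_UNIV: "space N = UNIV \<Longrightarrow> {x \<in> space N. P x} \<in> sets N \<Longrightarrow> {x. P x} \<in> sets N"
  by simp

lemma space_row_space [simp]: "space row_space = UNIV"
  by (simp add: space_PiM)

lemma measurable_succs [measurable]: "(\<lambda>r. succs r n) \<in> row_space \<rightarrow>\<^sub>M count_space UNIV"
  unfolding succs_def by measurable

lemma pred_finite_row [measurable]: "Measurable.pred row_space (\<lambda>r. finite {i. r i})"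
proof -
  have "(\<lambda>r :: nat \<Rightarrow> bool. finite {i. r i}) = (\<lambda>r. \<exists>n. \<forall>i. n \<le> i \<longrightarrow> \<not> r i)"
    by (auto simp: fun_eq_iff finite_nat_set_iff_bounded) (metis not_less)+
  then show ?thesis by simp
qed

lemma measurable_fails_before [measurable]:
  "(\<lambda>r. fails_before r m) \<in> row_space \<rightarrow>\<^sub>M count_space UNIV"
  unfolding fails_before_def by measurable

abbreviation coin :: "bool measure" where
  "coin \<equiv> measure_pmf (bernoulli_pmf (1 / 2))"

definition fair :: "(nat \<Rightarrow> bool) measure" where
  "fair = Pi\<^sub>M UNIV (\<lambda>_. coin)"

lemma sets_fair [measurable_cong, simp]: "sets fair = sets row_space"
  unfolding fair_def by (intro sets_PiM_cong) auto

lemma space_fair [simp]: "space fair = UNIV"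
  by (simp add: fair_def space_PiM)

interpretation coin: sequence_space coin
  by unfold_locales

interpretation fair: prob_space fair
  unfolding fair_def by (rule coin.P.prob_space_axioms)

lemma fair_UNIV [simp]: "emeasure fair UNIV = 1" "measure fair UNIV = 1"
  using fair.emeasure_space_1 fair.prob_space by simp_all

text \<open>Conditioning on the first coin. The factor 2 stays on the left so that no halves occur
  in \<open>ennreal\<close>.\<close>

lemma nn_integral_fair_iter:
  assumes [measurable]: "f \<in> borel_measurable row_space"
  shows "2 * (\<integral>\<^sup>+b. f b \<partial>fair) =
    (\<integral>\<^sup>+b. f (case_nat True b) \<partial>fair) + (\<integral>\<^sup>+b. f (case_nat False b) \<partial>fair)"
proof -
  have f: "f \<in> borel_measurable fair" by measurable
  have "(\<integral>\<^sup>+b. f b \<partial>fair) = (\<integral>\<^sup>+b. f b \<partial>distr (coin \<Otimes>\<^sub>M fair) fair (\<lambda>(s, \<omega>). case_nat s \<omega>))"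
    using coin.PiM_iter by (simp add: fair_def)
  also have "\<dots> = (\<integral>\<^sup>+x. f (case x of (s, \<omega>) \<Rightarrow> case_nat s \<omega>) \<partial>(coin \<Otimes>\<^sub>M fair))"
    using f by (intro nn_integral_distr) (auto simp: fair_def)
  also have "\<dots> = (\<integral>\<^sup>+s. (\<integral>\<^sup>+b. f (case_nat s b) \<partial>fair) \<partial>coin)"
  proof -
    have "(\<lambda>x. f (case x of (s, \<omega>) \<Rightarrow> case_nat s \<omega>)) \<in> borel_measurable (coin \<Otimes>\<^sub>M fair)"
      using f by (intro measurable_compose[OF _ f]) (auto simp: fair_def)
    from fair.nn_integral_fst[OF this] show ?thesis by simp
  qed
  also have "\<dots> = (\<integral>\<^sup>+b. f (case_nat True b) \<partial>fair) * ennreal (1 / 2) +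
      (\<integral>\<^sup>+b. f (case_nat False b) \<partial>fair) * ennreal (1 / 2)"
    by (subst nn_integral_measure_pmf_support[where A = UNIV]) (auto simp: UNIV_bool)
  finally have "(\<integral>\<^sup>+b. f b \<partial>fair) = (\<integral>\<^sup>+b. f (case_nat True b) \<partial>fair) * ennreal (1 / 2) +
      (\<integral>\<^sup>+b. f (case_nat False b) \<partial>fair) * ennreal (1 / 2)" .
  moreover have "2 * (a * ennreal (1 / 2)) = a" for a
  proof -
    have "2 * (a * ennreal (1 / 2)) = a * (ennreal 2 * ennreal (1 / 2))"
      by (simp add: mult.left_commute)
    also have "ennreal 2 * ennreal (1 / 2) = 1" by (subst ennreal_mult[symmetric]) auto
    finally show ?thesis by simp
  qed
  ultimately show ?thesis by (simp add: distrib_left)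
qed

lemma AE_fair_infinite: "AE b in fair. infinite {i. b i}"
proof -
  have "AE b in fair. \<exists>i\<ge>n. b i" for n
  proof -
    let ?E = "{b\<in>space fair. \<forall>i\<ge>n. \<not> b i}"
    have E: "?E \<in> sets fair" by measurable
    have le: "emeasure fair ?E \<le> ennreal ((1 / 2) ^ m)" for m
    proof -
      have "emeasure fair ?E \<le> emeasure fair {b\<in>space fair. \<forall>i\<in>{n..<n + m}. b i \<in> {False}}"
      proof (rule emeasure_mono)
      have "{b\<in>space fair. \<forall>i\<in>{n..<n + m}. \<not> b i} \<in> sets fair" by measurable
      then show "{b\<in>space fair. \<forall>i\<in>{n..<n + m}. b i \<in> {False}} \<in> sets fair" by simp
    qed auto
      also have "\<dots> = (\<Prod>i\<in>{n..<n + m}. emeasure coin {False})"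
        unfolding fair_def by (intro coin.emeasure_PiM_Collect) auto
      also have "\<dots> = ennreal ((1 / 2) ^ m)"
      proof -
        have "emeasure coin {False} = ennreal (1 / 2)" by (simp add: emeasure_pmf_single)
        then show ?thesis by (simp only: prod_constant card_atLeastLessThan diff_add_inverse ennreal_power)
      qed
      finally show ?thesis .
    qed
    have "emeasure fair ?E \<le> 0"
    proof (rule LIMSEQ_le_const)
      have "(\<lambda>m. (1 / 2 :: real) ^ m) \<longlonglongrightarrow> 0" by (intro LIMSEQ_realpow_zero) auto
      then show "(\<lambda>m. ennreal ((1 / 2) ^ m)) \<longlonglongrightarrow> 0"
        by (metis ennreal_0 tendsto_ennrealI)
    qed (use le in auto)
    then have "AE b in fair. b \<notin> ?E" using E by (simp add: AE_iff_measurable[OF E])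
    then show ?thesis by eventually_elim auto
  qed
  then have "AE b in fair. \<forall>n. \<exists>i\<ge>n. b i" by (simp add: AE_all_countable)
  then show ?thesis by eventually_elim (auto simp: infinite_nat_iff_unbounded_le)
qed

lemma infinite_case_nat: "infinite {i. case_nat x b i} \<longleftrightarrow> infinite {i. b i}" for x :: bool
proof -
  have "{i. case_nat x b i} = Suc ` {i. b i} \<union> (if x then {0} else {})" (is "?A = _")
  proof (intro set_eqI iffI)
    fix i assume "i \<in> ?A"
    then show "i \<in> Suc ` {i. b i} \<union> (if x then {0} else {})" by (cases i) auto
  qed (auto split: if_splits)
  then show ?thesis by (simp add: finite_image_iff)
qed

lemma succs_case_nat:
  "succs (case_nat x b) (Suc j) = (if x then Suc (succs b j) else succs b j)"
proof (induction j)
  case (Suc j)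
  have "succs (case_nat x b) (Suc (Suc j)) =
      (if b j then Suc (succs (case_nat x b) (Suc j)) else succs (case_nat x b) (Suc j))"
    by (subst succs_Suc) simp
  then show ?case unfolding Suc by (simp add: succs_Suc)
qed (simp add: succs_Suc)

lemma fails_before_case_nat:
  assumes "infinite {i. b i}"
  shows "fails_before (case_nat True b) (Suc m) = fails_before b m"
    and "fails_before (case_nat False b) (Suc m) = Suc (fails_before b (Suc m))"
proof -
  have "{j. \<not> case_nat True b j \<and> succs (case_nat True b) j < Suc m} =
      Suc ` {j. \<not> b j \<and> succs b j < m}" (is "?A = _")
  proof (intro set_eqI iffI)
    fix j assume "j \<in> ?A"
    then show "j \<in> Suc ` {j. \<not> b j \<and> succs b j < m}"
      by (cases j) (auto simp: succs_case_nat)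
  qed (auto simp: succs_case_nat)
  then show "fails_before (case_nat True b) (Suc m) = fails_before b m"
    using assms infinite_case_nat[of True b] by (simp add: fails_before_def card_image)
  have "{j. \<not> case_nat False b j \<and> succs (case_nat False b) j < Suc m} =
      insert 0 (Suc ` {j. \<not> b j \<and> succs b j < Suc m})" (is "?A = _")
  proof (intro set_eqI iffI)
    fix j assume "j \<in> ?A"
    then show "j \<in> insert 0 (Suc ` {j. \<not> b j \<and> succs b j < Suc m})"
      by (cases j) (auto simp: succs_case_nat)
  qed (auto simp: succs_case_nat)
  then show "fails_before (case_nat False b) (Suc m) = Suc (fails_before b (Suc m))"
    using assms infinite_case_nat[of False b] finite_fails_before[OF assms, of "Suc m"]
    by (simp add: fails_before_def card_image)
qed

text \<open>A first success leaves \<open>m\<close> successes to wait for; a first failure is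
  counted and \<open>Suc m\<close> remain. This recursion characterises the negative binomial law,
  and the moments, the generating function and the support are all read off it.\<close>

lemma nn_integral_fails_before_Suc:
  fixes h :: "nat \<Rightarrow> ennreal"
  shows "2 * (\<integral>\<^sup>+b. h (fails_before b (Suc m)) \<partial>fair) =
    (\<integral>\<^sup>+b. h (fails_before b m) \<partial>fair) + (\<integral>\<^sup>+b. h (Suc (fails_before b (Suc m))) \<partial>fair)"
proof -
  have "(\<integral>\<^sup>+b. h (fails_before (case_nat True b) (Suc m)) \<partial>fair) =
      (\<integral>\<^sup>+b. h (fails_before b m) \<partial>fair)"
    using AE_fair_infinite by (intro nn_integral_cong_AE) (auto simp: fails_before_case_nat)
  moreover have "(\<integral>\<^sup>+b. h (fails_before (case_nat False b) (Suc m)) \<partial>fair) =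
      (\<integral>\<^sup>+b. h (Suc (fails_before b (Suc m))) \<partial>fair)"
    using AE_fair_infinite by (intro nn_integral_cong_AE) (auto simp: fails_before_case_nat)
  ultimately show ?thesis
    by (subst nn_integral_fair_iter) simp_all
qed

text \<open>
  The truncation in the proof makes the integral finite, so that it can be cancelled on both sides
  of the recursion: this is how the moments are seen to be finite.
\<close>

lemma nn_integral_fails_before_Suc_le:
  fixes h w :: "nat \<Rightarrow> real"
  assumes h: "mono h" "\<And>k. 0 \<le> h k" and w: "\<And>k. 0 \<le> w k" "\<And>k. h (Suc k) \<le> h k + w k"
  shows "(\<integral>\<^sup>+b. ennreal (h (fails_before b (Suc m))) \<partial>fair) \<le>
    (\<integral>\<^sup>+b. ennreal (h (fails_before b m)) \<partial>fair) + (\<integral>\<^sup>+b. ennreal (w (fails_before b (Suc m))) \<partial>fair)"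
proof -
  let ?F = "\<lambda>b. fails_before b (Suc m)"
  have eq: "ennreal (h k) = (SUP K. ennreal (h (min k K)))" for k
  proof (rule antisym)
    show "ennreal (h k) \<le> (SUP K. ennreal (h (min k K)))"
      by (rule SUP_upper2[of k]) auto
    show "(SUP K. ennreal (h (min k K))) \<le> ennreal (h k)"
      by (intro SUP_least ennreal_leI monoD[OF h(1)]) simp
  qed
  have "(\<integral>\<^sup>+b. ennreal (h (?F b)) \<partial>fair) = (\<integral>\<^sup>+b. (SUP K. ennreal (h (min (?F b) K))) \<partial>fair)"
    by (subst eq) simp
  also have "\<dots> = (SUP K. \<integral>\<^sup>+b. ennreal (h (min (?F b) K)) \<partial>fair)"
    by (intro nn_integral_monotone_convergence_SUP)
      (auto simp: incseq_def le_fun_def intro!: ennreal_leI monoD[OF h(1)])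
  also have "\<dots> \<le> (\<integral>\<^sup>+b. ennreal (h (fails_before b m)) \<partial>fair) + (\<integral>\<^sup>+b. ennreal (w (?F b)) \<partial>fair)"
  proof (rule SUP_least)
    fix K
    let ?J = "\<integral>\<^sup>+b. ennreal (h (min (?F b) K)) \<partial>fair"
    have "?J \<le> (\<integral>\<^sup>+b. ennreal (h K) \<partial>fair)"
      by (intro nn_integral_mono ennreal_leI monoD[OF h(1)]) simp
    then have fin: "?J \<noteq> \<infinity>"
      by (auto simp: fair.emeasure_space_1 top_unique)
    \<comment> \<open>Below the cap the increment is at most \<open>w k\<close>; from the cap on it
      is zero.\<close>
    have step: "h (min (Suc k) K) \<le> h (min k K) + w k" for k
      using w[of k] by (cases "k < K") (auto simp: min_def)
    have "?J + ?J = 2 * ?J" by (simp add: mult_2)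
    also have "\<dots> = (\<integral>\<^sup>+b. ennreal (h (min (fails_before b m) K)) \<partial>fair) +
        (\<integral>\<^sup>+b. ennreal (h (min (Suc (?F b)) K)) \<partial>fair)"
      by (rule nn_integral_fails_before_Suc[where h = "\<lambda>k. ennreal (h (min k K))"])
    also have "\<dots> \<le> (\<integral>\<^sup>+b. ennreal (h (fails_before b m)) \<partial>fair) +
        (\<integral>\<^sup>+b. ennreal (h (min (?F b) K)) + ennreal (w (?F b)) \<partial>fair)"
      using step h w by (intro add_mono nn_integral_mono)
        (auto intro!: ennreal_leI monoD[OF h(1)] simp flip: ennreal_plus)
    also have "(\<integral>\<^sup>+b. ennreal (h (min (?F b) K)) + ennreal (w (?F b)) \<partial>fair) =
        ?J + (\<integral>\<^sup>+b. ennreal (w (?F b)) \<partial>fair)"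
      by (intro nn_integral_add) auto
    finally have "?J + ?J \<le> ?J + ((\<integral>\<^sup>+b. ennreal (h (fails_before b m)) \<partial>fair) +
        (\<integral>\<^sup>+b. ennreal (w (?F b)) \<partial>fair))"
      by (simp add: ac_simps)
    then show "?J \<le> (\<integral>\<^sup>+b. ennreal (h (fails_before b m)) \<partial>fair) + (\<integral>\<^sup>+b. ennreal (w (?F b)) \<partial>fair)"
      using fin by (simp add: ennreal_add_left_cancel_le)
  qed
  finally show ?thesis .
qed

lemma integral_fails_before_Suc:
  fixes h :: "nat \<Rightarrow> real"
  assumes h: "\<And>k. 0 \<le> h k" and int: "integrable fair (\<lambda>b. h (fails_before b m))"
    "integrable fair (\<lambda>b. h (fails_before b (Suc m)))"
    "integrable fair (\<lambda>b. h (Suc (fails_before b (Suc m))))"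
  shows "2 * (\<integral>b. h (fails_before b (Suc m)) \<partial>fair) =
    (\<integral>b. h (fails_before b m) \<partial>fair) + (\<integral>b. h (Suc (fails_before b (Suc m))) \<partial>fair)"
  using nn_integral_fails_before_Suc[of "\<lambda>k. ennreal (h k)" m] h
  by (simp add: nn_integral_eq_integral[OF int(1)] nn_integral_eq_integral[OF int(2)]
      nn_integral_eq_integral[OF int(3)] integral_nonneg flip: ennreal_plus ennreal_numeral ennreal_mult'')

section \<open>Moments, generating function and support of the negative binomial law\<close>

lemma integrable_fails_before: "integrable fair (\<lambda>b. real (fails_before b m))"
  and integral_fails_before: "(\<integral>b. real (fails_before b m) \<partial>fair) = real m"
proof -
  have le: "(\<integral>\<^sup>+b. ennreal (real (fails_before b m)) \<partial>fair) \<le> ennreal (real m)" for m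
  proof (induction m)
    case (Suc m)
    have "(\<integral>\<^sup>+b. ennreal (real (fails_before b (Suc m))) \<partial>fair) \<le>
        (\<integral>\<^sup>+b. ennreal (real (fails_before b m)) \<partial>fair) + (\<integral>\<^sup>+b. ennreal 1 \<partial>fair)"
      by (rule nn_integral_fails_before_Suc_le[where h = real and w = "\<lambda>_. 1"]) (auto intro: monoI)
    also have "\<dots> \<le> ennreal (real m) + 1" using Suc by (simp add: fair.emeasure_space_1 add_mono)
    also have "\<dots> = ennreal (real (Suc m))" by (simp flip: ennreal_1 ennreal_plus)
    finally show ?case .
  qed simp
  show int: "integrable fair (\<lambda>b. real (fails_before b m))" for m
    using le[of m] by (intro integrableI_bounded) (auto simp: le_less_trans)
  show "(\<integral>b. real (fails_before b m) \<partial>fair) = real m"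
  proof (induction m)
    case (Suc m)
    have "2 * (\<integral>b. real (fails_before b (Suc m)) \<partial>fair) =
        (\<integral>b. real (fails_before b m) \<partial>fair) + (\<integral>b. real (Suc (fails_before b (Suc m))) \<partial>fair)"
      using int by (intro integral_fails_before_Suc) auto
    then show ?case using int Suc by (simp add: fair.prob_space)
  qed simp
qed

text \<open>The value corresponds to variance \<open>2 * m\<close>, that of \<open>m\<close>
  independent geometric variables with parameter \<open>1 / 2\<close>.\<close>

lemma integrable_fails_before_sq: "integrable fair (\<lambda>b. (real (fails_before b m))\<^sup>2)"
  and integral_fails_before_sq: "(\<integral>b. (real (fails_before b m))\<^sup>2 \<partial>fair) = (real m)\<^sup>2 + 2 * real m"
proof -
  have le: "(\<integral>\<^sup>+b. ennreal ((real (fails_before b m))\<^sup>2) \<partial>fair) < \<infinity>" for m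
  proof (induction m)
    case (Suc m)
    have i: "integrable fair (\<lambda>b. 2 * real (fails_before b (Suc m)) + 1)"
      using integrable_fails_before by simp
    have "(\<integral>\<^sup>+b. ennreal ((real (fails_before b (Suc m)))\<^sup>2) \<partial>fair) \<le>
        (\<integral>\<^sup>+b. ennreal ((real (fails_before b m))\<^sup>2) \<partial>fair) +
        (\<integral>\<^sup>+b. ennreal (2 * real (fails_before b (Suc m)) + 1) \<partial>fair)"
      by (rule nn_integral_fails_before_Suc_le[where h = "\<lambda>k. (real k)\<^sup>2" and w = "\<lambda>k. 2 * real k + 1"])
        (auto intro: monoI simp: power2_eq_square algebra_simps intro!: mult_mono)
    also have "(\<integral>\<^sup>+b. ennreal (2 * real (fails_before b (Suc m)) + 1) \<partial>fair) < \<infinity>"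
      by (subst nn_integral_eq_integral[OF i]) auto
    finally show ?case using Suc by (simp add: ennreal_add_eq_top less_top)
  qed simp
  show int: "integrable fair (\<lambda>b. (real (fails_before b m))\<^sup>2)" for m
    using le[of m] by (intro integrableI_bounded) auto
  show "(\<integral>b. (real (fails_before b m))\<^sup>2 \<partial>fair) = (real m)\<^sup>2 + 2 * real m"
  proof (induction m)
    case (Suc m)
    have eq: "(real (Suc k))\<^sup>2 = (real k)\<^sup>2 + (2 * real k + 1)" for k
      by (simp add: power2_eq_square algebra_simps)
    have i: "integrable fair (\<lambda>b. 2 * real (fails_before b (Suc m)) + 1)"
      using integrable_fails_before by simp
    have "2 * (\<integral>b. (real (fails_before b (Suc m)))\<^sup>2 \<partial>fair) =
        (\<integral>b. (real (fails_before b m))\<^sup>2 \<partial>fair) + (\<integral>b. (real (Suc (fails_before b (Suc m))))\<^sup>2 \<partial>fair)"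
      using int i by (intro integral_fails_before_Suc[where h = "\<lambda>k. (real k)\<^sup>2"]) (auto simp only: eq intro!: Bochner_Integration.integrable_add zero_le_power2)
    also have "(\<integral>b. (real (Suc (fails_before b (Suc m))))\<^sup>2 \<partial>fair) =
        (\<integral>b. (real (fails_before b (Suc m)))\<^sup>2 \<partial>fair) + (2 * real (Suc m) + 1)"
      unfolding eq using integrable_fails_before[of "Suc m"]
      by (subst Bochner_Integration.integral_add[OF int i])
        (simp add: fair.prob_space integral_fails_before)
    finally show ?case using Suc by (simp add: power2_eq_square algebra_simps)
  qed simp
qed

lemma integrable_power_fails_before:
  assumes "0 \<le> s" "s \<le> (1::real)"
  shows "integrable fair (\<lambda>b. s ^ fails_before b m)"
  using assms by (intro fair.integrable_const_bound[of _ 1]) (auto simp: power_le_one)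

text \<open>Each of the \<open>m\<close> independent geometric waiting times has generating function
  \<open>1 / (2 - s)\<close>.\<close>

lemma integral_power_fails_before:
  assumes s: "0 \<le> s" "s \<le> (1::real)"
  shows "(\<integral>b. s ^ fails_before b m \<partial>fair) = (1 / (2 - s)) ^ m"
proof (induction m)
  case (Suc m)
  note int = integrable_power_fails_before[OF s]
  have "2 * (\<integral>b. s ^ fails_before b (Suc m) \<partial>fair) =
      (\<integral>b. s ^ fails_before b m \<partial>fair) + (\<integral>b. s ^ Suc (fails_before b (Suc m)) \<partial>fair)"
    using int s by (intro integral_fails_before_Suc[where h = "\<lambda>k. s ^ k"]) auto
  then have "(2 - s) * (\<integral>b. s ^ fails_before b (Suc m) \<partial>fair) = (\<integral>b. s ^ fails_before b m \<partial>fair)"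
    by (simp add: algebra_simps)
  then show ?case using Suc s by (simp add: field_simps)
qed (simp add: fair.prob_space)

text \<open>With an indicator as \<open>h\<close>, the recursion bounds the point mass at
  \<open>(m, k)\<close> by twice that at \<open>(Suc m, k)\<close>, and the point mass at
  \<open>(Suc m, k)\<close> by twice that at \<open>(Suc m, Suc k)\<close>. Positivity thus spreads
  from the sure value 0 at \<open>m = 0\<close>.\<close>

lemma emeasure_fails_before_pos:
  "0 < m \<or> k = 0 \<Longrightarrow> 0 < emeasure fair {b\<in>space fair. fails_before b m = k}"
proof -
  let ?p = "\<lambda>m k. \<integral>\<^sup>+b. indicator {k} (fails_before b m) \<partial>fair"
  have p: "?p m k = emeasure fair {b\<in>space fair. fails_before b m = k}" for m k
  proof -
    have "?p m k = (\<integral>\<^sup>+b. indicator {b\<in>space fair. fails_before b m = k} b \<partial>fair)"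
      by (intro nn_integral_cong) (auto simp: indicator_def)
    also have "\<dots> = emeasure fair {b\<in>space fair. fails_before b m = k}"
      by (rule nn_integral_indicator) measurable
    finally show ?thesis .
  qed
  have 1: "?p m k \<le> 2 * ?p (Suc m) k" for m k
    by (subst nn_integral_fails_before_Suc) simp
  have 2: "?p (Suc m) k \<le> 2 * ?p (Suc m) (Suc k)" for m k
  proof -
    have "(\<integral>\<^sup>+b. indicator {Suc k} (Suc (fails_before b (Suc m))) \<partial>fair) = ?p (Suc m) k"
      by (intro nn_integral_cong) (auto simp: indicator_def)
    then show ?thesis by (subst nn_integral_fails_before_Suc[where h = "indicator {Suc k}"]) simp
  qed
  have pos: "0 < b" if "0 < a" "a \<le> 2 * b" for a b :: ennreal
    using that by (metis gr_zeroI le_zero_eq less_irrefl mult_zero_right)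
  have "0 < ?p m 0" for m
  proof (induction m)
    case 0
    show ?case by (simp add: fair.emeasure_space_1)
  next
    case (Suc m)
    show ?case by (rule pos[OF Suc 1[where m = m and k = 0]])
  qed
  moreover have "0 < ?p (Suc m) k" for m k
  proof (induction k)
    case (Suc k)
    show ?case by (rule pos[OF Suc 2[where m = m and k = k]])
  qed (use \<open>\<And>m. 0 < ?p m 0\<close> in auto)
  ultimately show "0 < m \<or> k = 0 \<Longrightarrow> 0 < emeasure fair {b\<in>space fair. fails_before b m = k}"
    unfolding p by (cases m) auto
qed

section \<open>Rows of coins with a fair tail\<close>

lemma succs_comb_seq:
  "j \<le> M \<Longrightarrow> succs (comb_seq M a b) j = succs a j"
  "succs (comb_seq M a b) (M + j) = succs a M + succs b j"
proof -
  show 1: "j \<le> M \<Longrightarrow> succs (comb_seq M a b) j = succs a j" for j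
    unfolding succs_def by (rule arg_cong[of _ _ card]) (auto simp: comb_seq_def)
  show "succs (comb_seq M a b) (M + j) = succs a M + succs b j"
  proof (induction j)
    case (Suc j)
    then show ?case by (simp add: succs_Suc comb_seq_def)
  qed (simp add: 1)
qed

lemma infinite_comb_seq: "infinite {i. comb_seq M a b i} \<longleftrightarrow> infinite {i. b i}"
proof -
  have "{i. comb_seq M a b i} = {i. i < M \<and> a i} \<union> (+) M ` {i. b i}" (is "?A = _")
  proof (intro set_eqI iffI)
    fix i assume "i \<in> ?A"
    then show "i \<in> {i. i < M \<and> a i} \<union> (+) M ` {i. b i}"
      by (cases "i < M") (auto simp: comb_seq_def image_iff intro: exI[of _ "i - M"])
  qed (auto simp: comb_seq_def split: if_splits)
  then show ?thesis by (simp add: finite_image_iff)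
qed

text \<open>Either assumption means that all coins of the head \<open>a\<close> are read before
  success number \<open>m\<close>. They contribute \<open>M - succs a M\<close> failures, and the
  tail has to supply the missing successes.\<close>

lemma fails_before_comb_seq:
  assumes "infinite {i. b i}" and m: "M \<le> m \<or> succs a M < m"
  shows "fails_before (comb_seq M a b) m = (M - succs a M) + fails_before b (m - succs a M)"
proof -
  have inf: "infinite {i. comb_seq M a b i}" using assms(1) by (simp add: infinite_comb_seq)
  have early: "succs a j < m" if "j < M" for j
    using m
  proof
    assume "M \<le> m"
    then show ?thesis using succs_le[of a j] that by linarith
  next
    assume "succs a M < m"
    then show ?thesis using succs_mono[of j M a] that by linarith
  qed
  have "{j. \<not> comb_seq M a b j \<and> succs (comb_seq M a b) j < m} =
      {j. j < M \<and> \<not> a j} \<union> (+) M ` {j. \<not> b j \<and> succs b j < m - succs a M}" (is "?A = ?B \<union> ?C")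
  proof (intro set_eqI iffI)
    fix j assume j: "j \<in> ?A"
    show "j \<in> ?B \<union> ?C"
    proof (cases "j < M")
      case False
      then obtain i where "j = M + i" using le_Suc_ex not_less by blast
      then show ?thesis using j by (auto simp: succs_comb_seq comb_seq_def)
    qed (use j in \<open>auto simp: comb_seq_def\<close>)
  next
    fix j assume "j \<in> ?B \<union> ?C"
    then show "j \<in> ?A"
      using early by (auto simp: succs_comb_seq comb_seq_def)
  qed
  moreover have "card (?B \<union> ?C) = card ?B + card ?C"
    using finite_fails_before[OF assms(1)] by (intro card_Un_disjoint) auto
  moreover have "card ?B = M - succs a M"
    using succs_plus_fails[of a M] by (simp add: fails_def)
  ultimately show ?thesis
    using inf assms(1) by (simp add: fails_before_def card_image)
qed

text \<open>
  All coins of a row after the first \<open>M\<close> are fair and independent of the first \<open>M\<close>: redrawing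
  them does not change the law of the row. The joint law of the first \<open>M\<close> stays arbitrary.
\<close>

locale row_law = prob_space R for R :: "(nat \<Rightarrow> bool) measure" +
  fixes M :: nat
  assumes sets_R [measurable_cong, simp]: "sets R = sets row_space"
    and tail_fair: "distr (R \<Otimes>\<^sub>M fair) row_space (\<lambda>(a, b). comb_seq M a b) = R"
begin

sublocale rows: sequence_space R
  by unfold_locales

lemma space_R [simp]: "space R = UNIV"
  using sets_eq_imp_space_eq[OF sets_R] by simp

lemma R_UNIV [simp]: "emeasure R UNIV = 1" "measure R UNIV = 1"
  using emeasure_space_1 prob_space by simp_all

lemma measurable_comb_fair [measurable]:
  "(\<lambda>(a, b). comb_seq M a b) \<in> R \<Otimes>\<^sub>M fair \<rightarrow>\<^sub>M row_space"
  using measurable_comb_seq[of M "count_space UNIV :: bool measure"]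
  by (simp cong: measurable_cong_sets add: measurable_cong_sets[OF sets_pair_measure_cong[OF sets_R sets_fair] refl])

lemma nn_integral_R:
  assumes [measurable]: "f \<in> borel_measurable row_space"
  shows "(\<integral>\<^sup>+r. f r \<partial>R) = (\<integral>\<^sup>+a. (\<integral>\<^sup>+b. f (comb_seq M a b) \<partial>fair) \<partial>R)"
proof -
  have "(\<integral>\<^sup>+r. f r \<partial>R) = (\<integral>\<^sup>+r. f r \<partial>distr (R \<Otimes>\<^sub>M fair) row_space (\<lambda>(a, b). comb_seq M a b))"
    by (simp only: tail_fair)
  also have "\<dots> = (\<integral>\<^sup>+x. f (case x of (a, b) \<Rightarrow> comb_seq M a b) \<partial>(R \<Otimes>\<^sub>M fair))"
    by (intro nn_integral_distr) simp_all
  also have "\<dots> = (\<integral>\<^sup>+a. (\<integral>\<^sup>+b. f (comb_seq M a b) \<partial>fair) \<partial>R)"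
  proof -
    have "(\<lambda>x. f (case x of (a, b) \<Rightarrow> comb_seq M a b)) \<in> borel_measurable (R \<Otimes>\<^sub>M fair)"
      by (rule measurable_compose[OF measurable_comb_fair assms])
    from fair.nn_integral_fst[OF this] show ?thesis by simp
  qed
  finally show ?thesis .
qed

lemma AE_R_infinite: "AE r in R. infinite {i. r i}"
proof -
  have "(\<integral>\<^sup>+r. indicator {r. finite {i. r i}} r \<partial>R) =
      (\<integral>\<^sup>+a. (\<integral>\<^sup>+b. indicator {r. finite {i. r i}} (comb_seq M a b) \<partial>fair) \<partial>R)"
  proof (rule nn_integral_R)
    have "{r \<in> space row_space. finite {i. r i}} \<in> sets row_space" by measurable
    then show "indicator {r. finite {i. r i}} \<in> borel_measurable row_space" by simp
  qed
  also have "\<dots> = (\<integral>\<^sup>+a. 0 \<partial>R)"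
  proof (intro nn_integral_cong)
    fix a
    have "(\<integral>\<^sup>+b. indicator {r. finite {i. r i}} (comb_seq M a b) \<partial>fair) = (\<integral>\<^sup>+b. 0 \<partial>fair)"
      using AE_fair_infinite
      by (intro nn_integral_cong_AE) (auto elim!: eventually_mono simp: infinite_comb_seq)
    then show "(\<integral>\<^sup>+b. indicator {r. finite {i. r i}} (comb_seq M a b) \<partial>fair) = 0" by simp
  qed
  finally have "(\<integral>\<^sup>+r. indicator {r. finite {i. r i}} r \<partial>R) = 0" by simp
  moreover have E: "{r. finite {i. r i}} \<in> sets R"
    using pred_finite_row by (simp add: pred_def)
  ultimately have "emeasure R {r. finite {i. r i}} = 0" by simp
  then show ?thesis using E by (intro AE_I[of _ _ "{r. finite {i. r i}}"]) auto
qed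

lemma integrable_succs: "integrable R (\<lambda>a. f (succs a M))" for f :: "nat \<Rightarrow> real"
proof (rule integrable_const_bound[of _ "\<Sum>k\<le>M. \<bar>f k\<bar>"])
  show "AE a in R. norm (f (succs a M)) \<le> (\<Sum>k\<le>M. \<bar>f k\<bar>)"
    using succs_le[of _ M] by (auto intro!: AE_I2 member_le_sum)
qed measurable

text \<open>Given \<open>s\<close> successes among the first \<open>M\<close> coins, only a fair
  tail is left to integrate, with value \<open>f s\<close>. Everything else under \<open>R\<close>
  is an expectation over the finitely many values of \<open>s\<close>.\<close>

lemma has_integral_fails_before:
  fixes h :: "nat \<Rightarrow> real"
  assumes m: "M \<le> m" and h: "\<And>k. 0 \<le> h k"
    and int: "\<And>s. s \<le> M \<Longrightarrow> integrable fair (\<lambda>b. h ((M - s) + fails_before b (m - s)))"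
    and eq: "\<And>s. s \<le> M \<Longrightarrow> (\<integral>b. h ((M - s) + fails_before b (m - s)) \<partial>fair) = f s"
  shows "integrable R (\<lambda>r. h (fails_before r m))"
    and "(\<integral>r. h (fails_before r m) \<partial>R) = (\<integral>a. f (succs a M) \<partial>R)"
proof -
  have nn: "0 \<le> f s" if "s \<le> M" for s
    unfolding eq[OF that, symmetric] by (intro Bochner_Integration.integral_nonneg h)
  have "(\<integral>\<^sup>+r. ennreal (h (fails_before r m)) \<partial>R) =
      (\<integral>\<^sup>+a. (\<integral>\<^sup>+b. ennreal (h (fails_before (comb_seq M a b) m)) \<partial>fair) \<partial>R)"
    by (rule nn_integral_R) measurable
  also have "\<dots> = (\<integral>\<^sup>+a. ennreal (f (succs a M)) \<partial>R)"
  proof (intro nn_integral_cong)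
    fix a
    have s: "succs a M \<le> M" by (rule succs_le)
    have "(\<integral>\<^sup>+b. ennreal (h (fails_before (comb_seq M a b) m)) \<partial>fair) =
        (\<integral>\<^sup>+b. ennreal (h ((M - succs a M) + fails_before b (m - succs a M))) \<partial>fair)"
      using AE_fair_infinite m
      by (intro nn_integral_cong_AE) (auto elim!: eventually_mono simp: fails_before_comb_seq)
    also have "\<dots> = ennreal (f (succs a M))"
      using eq[OF s] int[OF s] h by (subst nn_integral_eq_integral) auto
    finally show "(\<integral>\<^sup>+b. ennreal (h (fails_before (comb_seq M a b) m)) \<partial>fair) = ennreal (f (succs a M))" .
  qed
  also have "\<dots> = ennreal (\<integral>a. f (succs a M) \<partial>R)"
    using nn succs_le by (intro nn_integral_eq_integral integrable_succs) auto
  finally have *: "(\<integral>\<^sup>+r. ennreal (h (fails_before r m)) \<partial>R) = ennreal (\<integral>a. f (succs a M) \<partial>R)" .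
  show i: "integrable R (\<lambda>r. h (fails_before r m))"
    using * h by (intro integrableI_nn_integral_finite) auto
  show "(\<integral>r. h (fails_before r m) \<partial>R) = (\<integral>a. f (succs a M) \<partial>R)"
    using * nn_integral_eq_integral[OF i] h nn succs_le
    by (simp add: Bochner_Integration.integral_nonneg ennreal_inj)
qed

section \<open>Moments, Laplace transform and support under the row law\<close>

definition \<delta> :: real where
  "\<delta> = (\<integral>r. 2 * real (succs r M) - real M \<partial>R)"

text \<open>The head contributes \<open>M - s\<close> failures and the tail \<open>m - s\<close> on
  average; together this is \<open>m\<close> minus the surplus \<open>2 * s - M\<close> of successes
  in the head.\<close>

lemma fails_before_mean:
  assumes m: "M \<le> m"
  shows "integrable R (\<lambda>r. real (fails_before r m))"
    and "(\<integral>r. real (fails_before r m) \<partial>R) = real m - \<delta>"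
proof -
  let ?f = "\<lambda>s. real m - (2 * real s - real M)"
  have int: "integrable fair (\<lambda>b. real ((M - s) + fails_before b (m - s)))" for s
    using integrable_fails_before by simp
  have eq: "(\<integral>b. real ((M - s) + fails_before b (m - s)) \<partial>fair) = ?f s" if "s \<le> M" for s
    using integrable_fails_before[of "m - s"] that m by (simp add: integral_fails_before of_nat_diff)
  show "integrable R (\<lambda>r. real (fails_before r m))"
    by (rule has_integral_fails_before(1)[OF m _ int eq]) auto
  have "(\<integral>r. real (fails_before r m) \<partial>R) = (\<integral>a. ?f (succs a M) \<partial>R)"
    by (rule has_integral_fails_before(2)[OF m _ int eq]) auto
  also have "\<dots> = real m - \<delta>"
    unfolding \<delta>_def using integrable_succs[of "\<lambda>s. 2 * real s - real M"]
    by (subst Bochner_Integration.integral_diff) auto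
  finally show "(\<integral>r. real (fails_before r m) \<partial>R) = real m - \<delta>" .
qed

lemma fails_before_second_moment:
  assumes m: "M \<le> m"
  shows "integrable R (\<lambda>r. (real (fails_before r m))\<^sup>2)"
    and "(\<integral>r. (real (fails_before r m))\<^sup>2 \<partial>R) \<le> (real m)\<^sup>2 + 2 * real m * (1 - \<delta>) + (real M)\<^sup>2"
proof -
  \<comment> \<open>Square of the conditional mean plus the conditional variance
    \<open>2 * (m - s)\<close> of the tail.\<close>
  let ?f = "\<lambda>s. (real m + (real M - 2 * real s))\<^sup>2 + 2 * (real m - real s)"
  have sq: "(real (k + l))\<^sup>2 = (real k)\<^sup>2 + (2 * real k * real l + (real l)\<^sup>2)" for k l
    by (simp add: power2_eq_square algebra_simps)
  have int: "integrable fair (\<lambda>b. (real ((M - s) + fails_before b (m - s)))\<^sup>2)" for s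
    unfolding sq using integrable_fails_before integrable_fails_before_sq by simp
  have eq: "(\<integral>b. (real ((M - s) + fails_before b (m - s)))\<^sup>2 \<partial>fair) = ?f s" if "s \<le> M" for s
  proof -
    have "(\<integral>b. (real ((M - s) + fails_before b (m - s)))\<^sup>2 \<partial>fair) =
        (real (M - s))\<^sup>2 + (2 * real (M - s) * real (m - s) + ((real (m - s))\<^sup>2 + 2 * real (m - s)))"
      unfolding sq using integrable_fails_before[of "m - s"] integrable_fails_before_sq[of "m - s"]
      by (simp add: integral_fails_before integral_fails_before_sq)
    then show ?thesis
      using that m by (simp add: of_nat_diff power2_eq_square algebra_simps)
  qed
  show "integrable R (\<lambda>r. (real (fails_before r m))\<^sup>2)"
    by (rule has_integral_fails_before(1)[where h = "\<lambda>k. (real k)\<^sup>2", OF m _ int eq]) auto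
  have "(\<integral>r. (real (fails_before r m))\<^sup>2 \<partial>R) = (\<integral>a. ?f (succs a M) \<partial>R)"
    by (rule has_integral_fails_before(2)[where h = "\<lambda>k. (real k)\<^sup>2", OF m _ int eq]) auto
  also have "\<dots> \<le> (\<integral>a. (real m)\<^sup>2 + 2 * real m + (real M)\<^sup>2 - 2 * real m * (2 * real (succs a M) - real M) \<partial>R)"
  proof (rule integral_mono)
    fix a
    have "(real M - 2 * real (succs a M))\<^sup>2 \<le> (real M)\<^sup>2"
      using succs_le[of a M] by (intro abs_le_square_iff[THEN iffD1]) auto
    then show "?f (succs a M) \<le>
        (real m)\<^sup>2 + 2 * real m + (real M)\<^sup>2 - 2 * real m * (2 * real (succs a M) - real M)"
      by (simp add: power2_eq_square algebra_simps)
  qed (rule integrable_succs[of ?f]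
      integrable_succs[of "\<lambda>s. (real m)\<^sup>2 + 2 * real m + (real M)\<^sup>2 - 2 * real m * (2 * real s - real M)"])+
  also have "\<dots> = (real m)\<^sup>2 + 2 * real m + (real M)\<^sup>2 - 2 * real m * \<delta>"
    unfolding \<delta>_def using integrable_succs[of "\<lambda>s. 2 * real s - real M"]
    by (subst Bochner_Integration.integral_diff) auto
  finally show "(\<integral>r. (real (fails_before r m))\<^sup>2 \<partial>R) \<le> (real m)\<^sup>2 + 2 * real m * (1 - \<delta>) + (real M)\<^sup>2"
    by (simp add: algebra_simps)
qed

text \<open>Two Bernoulli inequalities; the cross term \<open>a * b * x\<^sup>2\<close> of their
  product is absorbed by \<open>M\<^sup>2 * x\<^sup>2\<close>.\<close>

lemma bernoulli_product_ge:
  fixes x :: real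
  assumes x: "0 \<le> x" "x \<le> 1" and ab: "a + b = M"
  shows "1 + (real b - real a) * x - (real M)\<^sup>2 * x\<^sup>2 \<le> (1 - x) ^ a * (1 + x) ^ b"
proof -
  have 1: "1 - real a * x \<le> (1 - x) ^ a"
    using Bernoulli_inequality[of "- x" a] x by simp
  have 2: "1 + real b * x \<le> (1 + x) ^ b"
    using Bernoulli_inequality[of x b] x by simp
  have "1 + (real b - real a) * x - (real M)\<^sup>2 * x\<^sup>2 \<le> (1 - real a * x) * (1 + real b * x)"
  proof -
    have "real a * real b \<le> real M * real M" using ab by (intro mult_mono) auto
    then have "real a * real b * (x * x) \<le> real M * real M * (x * x)"
      by (intro mult_right_mono) auto
    then show ?thesis by (simp add: power2_eq_square algebra_simps)
  qed
  also have "\<dots> \<le> (1 - x) ^ a * (1 + x) ^ b"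
  proof (cases "0 \<le> 1 - real a * x")
    case True
    then show ?thesis using 1 2 x by (intro mult_mono) auto
  next
    \<comment> \<open>Here the two Bernoulli bounds cannot be multiplied, but the lower bound is
      then nonpositive.\<close>
    case False
    then have "(1 - real a * x) * (1 + real b * x) \<le> 0"
      using x by (intro mult_nonpos_nonneg) auto
    also have "0 \<le> (1 - x) ^ a * (1 + x) ^ b" using x by simp
    finally show ?thesis .
  qed
  finally show ?thesis .
qed

text \<open>At \<open>1 - x\<close> each geometric waiting time contributes
  \<open>1 / (1 + x)\<close>. After \<open>(1 + x) ^ m\<close> is factored out,
  \<open>(1 - x) ^ (M - s) * (1 + x) ^ s\<close> remains, whose first-order coefficient
  \<open>2 * s - M\<close> has mean \<delta>.\<close>

lemma fails_before_laplace:
  assumes m: "M \<le> m" and x: "0 \<le> x" "x \<le> (1::real)"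
  shows "(1 + \<delta> * x - (real M)\<^sup>2 * x\<^sup>2) / (1 + x) ^ m \<le> (\<integral>r. (1 - x) ^ fails_before r m \<partial>R)"
proof -
  let ?f = "\<lambda>s. (1 - x) ^ (M - s) * (1 / (1 + x)) ^ (m - s)"
  let ?c = "(1 / (1 + x)) ^ m"
  have int: "integrable fair (\<lambda>b. (1 - x) ^ ((M - s) + fails_before b (m - s)))" for s
    using integrable_power_fails_before[of "1 - x"] x by (simp add: power_add)
  have eq: "(\<integral>b. (1 - x) ^ ((M - s) + fails_before b (m - s)) \<partial>fair) = ?f s" for s
    using integral_power_fails_before[of "1 - x" "m - s"] x by (simp add: power_add)
  have "(\<integral>r. (1 - x) ^ fails_before r m \<partial>R) = (\<integral>a. ?f (succs a M) \<partial>R)"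
    by (rule has_integral_fails_before(2)[where h = "\<lambda>k. (1 - x) ^ k", OF m _ int eq]) (use x in auto)
  also have "\<dots> \<ge> (\<integral>a. ?c * (1 - (real M)\<^sup>2 * x\<^sup>2 + x * (2 * real (succs a M) - real M)) \<partial>R)"
  proof (rule integral_mono)
    fix a
    let ?s = "succs a M"
    have s: "?s \<le> M" by (rule succs_le)
    have "(1 / (1 + x)) ^ (m - ?s) * (1 / (1 + x)) ^ ?s = ?c"
      using s m by (simp flip: power_add)
    then have "(1 / (1 + x)) ^ (m - ?s) = ?c * (1 + x) ^ ?s"
      using x by (simp add: power_one_over divide_simps mult.commute split: if_splits)
    then have "?f ?s = ?c * ((1 - x) ^ (M - ?s) * (1 + x) ^ ?s)" by simp
    moreover have "1 + (real ?s - real (M - ?s)) * x - (real M)\<^sup>2 * x\<^sup>2 \<le> (1 - x) ^ (M - ?s) * (1 + x) ^ ?s"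
      using x s by (intro bernoulli_product_ge) auto
    moreover have "0 \<le> ?c" using x by simp
    moreover have "1 + (real ?s - real (M - ?s)) * x - (real M)\<^sup>2 * x\<^sup>2 =
        1 - (real M)\<^sup>2 * x\<^sup>2 + x * (2 * real ?s - real M)"
      using s by (simp add: of_nat_diff algebra_simps)
    ultimately show "?c * (1 - (real M)\<^sup>2 * x\<^sup>2 + x * (2 * real ?s - real M)) \<le> ?f ?s"
      by (metis mult_left_mono)
  qed (rule integrable_succs[of ?f]
      integrable_succs[of "\<lambda>s. ?c * (1 - (real M)\<^sup>2 * x\<^sup>2 + x * (2 * real s - real M))"])+
  moreover have "(\<integral>a. ?c * (1 - (real M)\<^sup>2 * x\<^sup>2 + x * (2 * real (succs a M) - real M)) \<partial>R) =
      ?c * (1 - (real M)\<^sup>2 * x\<^sup>2 + x * \<delta>)"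
    unfolding \<delta>_def using integrable_succs[of "\<lambda>s. 2 * real s - real M"]
    by (subst integral_mult_right_zero, subst Bochner_Integration.integral_add) auto
  moreover have "?c * (1 - (real M)\<^sup>2 * x\<^sup>2 + x * \<delta>) = (1 + \<delta> * x - (real M)\<^sup>2 * x\<^sup>2) / (1 + x) ^ m"
  proof -
    have "1 - (real M)\<^sup>2 * x\<^sup>2 + x * \<delta> = 1 + \<delta> * x - (real M)\<^sup>2 * x\<^sup>2" by simp
    then show ?thesis by (simp add: power_one_over)
  qed
  ultimately show ?thesis by linarith
qed

lemma fails_before_pos:
  assumes s: "0 < measure R {r. succs r M = s}" and m: "M \<le> m \<or> s < m" and k: "s < m \<or> k = 0"
  shows "0 < measure R {r. fails_before r m = (M - s) + k}"
proof -
  let ?q = "emeasure fair {b\<in>space fair. fails_before b (m - s) = k}"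
  let ?E = "{r. fails_before r m = (M - s) + k}" and ?A = "{r. succs r M = s}"
  have E: "?E \<in> sets R" by (rule sets_Collect_UNIV, simp) measurable
  have A: "?A \<in> sets R" by (rule sets_Collect_UNIV, simp) measurable
  have "(\<integral>\<^sup>+r. indicator ?E r \<partial>R) = (\<integral>\<^sup>+a. (\<integral>\<^sup>+b. indicator ?E (comb_seq M a b) \<partial>fair) \<partial>R)"
    using E by (intro nn_integral_R) simp
  also have "\<dots> \<ge> (\<integral>\<^sup>+a. indicator ?A a * ?q \<partial>R)"
  proof (intro nn_integral_mono)
    fix a
    show "indicator ?A a * ?q \<le> (\<integral>\<^sup>+b. indicator ?E (comb_seq M a b) \<partial>fair)"
    proof (cases "succs a M = s")
      case True
      have "?q = (\<integral>\<^sup>+b. indicator {b\<in>space fair. fails_before b (m - s) = k} b \<partial>fair)"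
        by (rule nn_integral_indicator[symmetric]) measurable
      also have "\<dots> \<le> (\<integral>\<^sup>+b. indicator ?E (comb_seq M a b) \<partial>fair)"
        using AE_fair_infinite m
        by (intro nn_integral_mono_AE)
          (auto elim!: eventually_mono simp: indicator_def fails_before_comb_seq True)
      finally show ?thesis using True by simp
    qed simp
  qed
  moreover have "(\<integral>\<^sup>+a. indicator ?A a * ?q \<partial>R) = emeasure R ?A * ?q"
    using A by (subst nn_integral_multc) auto
  moreover have "0 < emeasure R ?A * ?q"
    using s k emeasure_fails_before_pos[of "m - s" k]
    by (auto simp: ennreal_zero_less_mult_iff emeasure_eq_measure)
  ultimately have "0 < emeasure R ?E" using E by auto
  then show ?thesis by (simp add: emeasure_eq_measure)
qed

lemma fails_before_zero_pos:
  assumes "0 < measure R {r. succs r M = M}"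
  shows "0 < measure R {r. fails_before r m = 0}"
proof -
  \<comment> \<open>Raising the number of awaited successes to at least \<open>M\<close> meets the
    assumption of \<open>fails_before_pos\<close>; monotonicity then goes back to
    \<open>m\<close>.\<close>
  have "0 < measure R {r. fails_before r (m + M) = 0}"
    using fails_before_pos[OF assms, of "m + M" 0] by simp
  also have "\<dots> \<le> measure R {r. fails_before r m = 0}"
  proof (rule finite_measure_mono)
    show "{r. fails_before r (m + M) = 0} \<subseteq> {r. fails_before r m = 0}"
      using fails_before_mono[of m "m + M"] by (metis (mono_tags, lifting) Collect_mono le_add1 le_zero_eq)
    show "{r. fails_before r m = 0} \<in> sets R"
      by (rule sets_Collect_UNIV, simp) measurable
  qed
  finally show ?thesis .
qed

lemma fails_before_large_pos:
  assumes "0 < measure R {r. succs r M = 0}" and "0 < m"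
  shows "0 < measure R {r. fails_before r m = M + k}"
  using fails_before_pos[OF assms(1), of m k] assms(2) by simp

end

section \<open>The branching process with immigration\<close>

lemma measurable_fails_before_comp:
  assumes "r \<in> N \<rightarrow>\<^sub>M row_space" and "k \<in> N \<rightarrow>\<^sub>M count_space UNIV"
  shows "(\<lambda>x. fails_before (r x) (k x)) \<in> N \<rightarrow>\<^sub>M count_space UNIV"
  using measurable_compose[OF assms(1) measurable_fails_before] assms(2)
  by (rule measurable_compose_countable)

text \<open>The stationary population, realised as a function of the rows. In \<open>nat\<close> the
  supremum is meaningful only for bounded values, which is why the lemmas on it carry bounds as
  assumptions.\<close>

definition immig_lim :: "(nat \<Rightarrow> nat \<Rightarrow> bool) \<Rightarrow> nat" where
  "immig_lim y = Sup (range (\<lambda>n. immig n y))"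

lemma immig_le_lim: "(\<And>n. immig n y \<le> K) \<Longrightarrow> immig n y \<le> immig_lim y"
  unfolding immig_lim_def by (rule cSup_upper) (auto intro: bdd_aboveI[of _ K])

lemma immig_eventually_lim:
  assumes "\<And>n. immig n y \<le> K"
  shows "\<exists>N. \<forall>n\<ge>N. immig n y = immig_lim y"
proof -
  have "finite (range (\<lambda>n. immig n y))"
    using assms by (auto simp: finite_nat_set_iff_bounded_le)
  then have "Sup (range (\<lambda>n. immig n y)) \<in> range (\<lambda>n. immig n y)"
    by (subst cSup_eq_Max) (auto intro!: Max_in)
  then obtain N where N: "immig_lim y = immig N y" by (auto simp: immig_lim_def)
  have "immig n y = immig_lim y" if "n \<ge> N" for n
    using immig_mono[OF that, of y] immig_le_lim[OF assms, of n] N by linarith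
  then show ?thesis by blast
qed

lemma immig_lim_rec:
  assumes "\<And>n. immig n y \<le> K" "\<And>n. immig n (seq_tl y) \<le> L"
  shows "immig_lim y = fails_before (y 0) (immig_lim (seq_tl y) + 1)"
proof -
  obtain N N' where N: "\<And>n. n \<ge> N \<Longrightarrow> immig n y = immig_lim y"
    and N': "\<And>n. n \<ge> N' \<Longrightarrow> immig n (seq_tl y) = immig_lim (seq_tl y)"
    using immig_eventually_lim[OF assms(1)] immig_eventually_lim[OF assms(2)] by blast
  have "immig_lim y = immig (Suc (max N N')) y" by (rule N[symmetric]) simp
  also have "\<dots> = fails_before (y 0) (immig_lim (seq_tl y) + 1)"
    using N'[of "max N N'"] by simp
  finally show ?thesis .
qed

context row_law
begin

abbreviation S :: "(nat \<Rightarrow> nat \<Rightarrow> bool) measure" where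
  "S \<equiv> Pi\<^sub>M UNIV (\<lambda>_. R)"

lemma space_S [simp]: "space S = UNIV"
  by (simp add: space_PiM)

lemma measurable_seq_tl_S [measurable]: "seq_tl \<in> S \<rightarrow>\<^sub>M S"
  by (rule rows.measurable_seq_tl)

lemma measurable_hd_S: "(\<lambda>y. y 0) \<in> S \<rightarrow>\<^sub>M row_space"
proof -
  have "(\<lambda>y. y 0) \<in> S \<rightarrow>\<^sub>M R" by measurable
  then show ?thesis by (simp cong: measurable_cong_sets)
qed

text \<open>The Markov property: the first row is independent of the later ones, so the population
  that they produce can be frozen while the first row is integrated out.\<close>

lemma nn_integral_S_split:
  assumes [measurable]: "k \<in> S \<rightarrow>\<^sub>M count_space UNIV" "h \<in> borel_measurable (count_space UNIV)"
  shows "(\<integral>\<^sup>+y. h (fails_before (y 0) (k (seq_tl y))) \<partial>S) =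
    (\<integral>\<^sup>+y. (\<integral>\<^sup>+r. h (fails_before r (k y)) \<partial>R) \<partial>S)"
proof -
  interpret pair_sigma_finite R S by unfold_locales
  have m: "(\<lambda>(s, \<omega>). case_nat s \<omega>) \<in> R \<Otimes>\<^sub>M S \<rightarrow>\<^sub>M S"
    by measurable
  have f: "(\<lambda>y. h (fails_before (y 0) (k (seq_tl y)))) \<in> borel_measurable S"
    by (intro measurable_compose[OF measurable_fails_before_comp assms(2)] measurable_hd_S) measurable
  have "(\<integral>\<^sup>+y. h (fails_before (y 0) (k (seq_tl y))) \<partial>S) =
      (\<integral>\<^sup>+y. h (fails_before (y 0) (k (seq_tl y))) \<partial>distr (R \<Otimes>\<^sub>M S) S (\<lambda>(s, \<omega>). case_nat s \<omega>))"
    by (simp only: rows.PiM_iter)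
  also have "\<dots> = (\<integral>\<^sup>+x. h (fails_before ((case x of (s, \<omega>) \<Rightarrow> case_nat s \<omega>) 0)
      (k (seq_tl (case x of (s, \<omega>) \<Rightarrow> case_nat s \<omega>)))) \<partial>(R \<Otimes>\<^sub>M S))"
    by (rule nn_integral_distr[OF m]) (use f in simp)
  also have "\<dots> = (\<integral>\<^sup>+x. (case x of (r, y) \<Rightarrow> h (fails_before r (k y))) \<partial>(R \<Otimes>\<^sub>M S))"
    by (intro nn_integral_cong) (auto simp: seq_tl_def)
  also have "\<dots> = (\<integral>\<^sup>+y. (\<integral>\<^sup>+r. h (fails_before r (k y)) \<partial>R) \<partial>S)"
  proof -
    have "(\<lambda>x. k (snd x)) \<in> R \<Otimes>\<^sub>M S \<rightarrow>\<^sub>M count_space UNIV"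
      by measurable
    moreover have "fst \<in> R \<Otimes>\<^sub>M S \<rightarrow>\<^sub>M R" by measurable
    then have "fst \<in> R \<Otimes>\<^sub>M S \<rightarrow>\<^sub>M row_space" by (simp cong: measurable_cong_sets)
    ultimately have "(\<lambda>x. h (fails_before (fst x) (k (snd x)))) \<in> borel_measurable (R \<Otimes>\<^sub>M S)"
      by (intro measurable_compose[OF measurable_fails_before_comp assms(2)])
    then have "(\<lambda>(r, y). h (fails_before r (k y))) \<in> borel_measurable (R \<Otimes>\<^sub>M S)"
      by (simp add: case_prod_beta')
    from nn_integral_snd[OF this] show ?thesis by simp
  qed
  finally show ?thesis .
qed

lemma measurable_immig [measurable]: "immig n \<in> S \<rightarrow>\<^sub>M count_space UNIV"
proof (induction n)
  case 0
  have "immig 0 = (\<lambda>y. 0)" by (simp add: fun_eq_iff)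
  then show ?case by simp
next
  case (Suc n)
  note [measurable] = Suc
  have "immig (Suc n) = (\<lambda>y. fails_before (y 0) (immig n (seq_tl y) + 1))" by (simp add: fun_eq_iff)
  moreover have "(\<lambda>y. fails_before (y 0) (immig n (seq_tl y) + 1)) \<in> S \<rightarrow>\<^sub>M count_space UNIV"
    by (intro measurable_fails_before_comp measurable_hd_S) measurable
  ultimately show ?case by (simp only:)
qed

lemma measurable_immig_lim [measurable]: "immig_lim \<in> S \<rightarrow>\<^sub>M count_space UNIV"
proof -
  have "(\<lambda>y. Sup (range (\<lambda>n. immig n y))) \<in> S \<rightarrow>\<^sub>M count_space UNIV"
    unfolding image_def by measurable
  then show ?thesis by (simp add: immig_lim_def[abs_def])
qed

lemma integrable_fails_before_sq_R: "integrable R (\<lambda>r. (real (fails_before r m))\<^sup>2)"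
proof (rule Bochner_Integration.integrable_bound[OF fails_before_second_moment(1)[of "m + M"]])
  show "AE r in R. norm ((real (fails_before r m))\<^sup>2) \<le> norm ((real (fails_before r (m + M)))\<^sup>2)"
    by (intro AE_I2) (simp add: fails_before_mono power_mono)
qed measurable

lemma integrable_fails_before_R: "integrable R (\<lambda>r. real (fails_before r m))"
proof (rule Bochner_Integration.integrable_bound[OF fails_before_mean(1)[of "m + M"]])
  show "AE r in R. norm (real (fails_before r m)) \<le> norm (real (fails_before r (m + M)))"
    by (intro AE_I2) (simp add: fails_before_mono)
qed measurable

section \<open>Second moments and bounded means for drift above 2\<close>

definition step_const :: real where
  "step_const = 1 + 2 * \<bar>1 - \<delta>\<bar> + 3 * (real M)\<^sup>2 + 2 * real M * \<bar>1 - \<delta>\<bar> + 2 * real M * \<bar>\<delta> - 2\<bar>"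

text \<open>If \<open>M \<le> m + 1\<close> this is the moment formula for \<open>m\<close>
  individuals and one immigrant. The smaller populations are compared with \<open>M\<close> by
  monotonicity, and \<open>step_const\<close> is large enough for both cases.\<close>

lemma second_moment_step:
  "(\<integral>r. (real (fails_before r (m + 1)))\<^sup>2 \<partial>R) \<le> (real m)\<^sup>2 - 2 * (\<delta> - 2) * real m + step_const"
proof (cases "M \<le> m + 1")
  case True
  have "(\<integral>r. (real (fails_before r (m + 1)))\<^sup>2 \<partial>R) \<le>
      (real (m + 1))\<^sup>2 + 2 * real (m + 1) * (1 - \<delta>) + (real M)\<^sup>2"
    by (rule fails_before_second_moment(2)[OF True])
  also have "\<dots> = (real m)\<^sup>2 - 2 * (\<delta> - 2) * real m + (1 + 2 * (1 - \<delta>) + (real M)\<^sup>2)"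
    by (simp add: power2_eq_square algebra_simps)
  also have "1 + 2 * (1 - \<delta>) + (real M)\<^sup>2 \<le> step_const"
  proof -
    have "0 \<le> 2 * real M * \<bar>1 - \<delta>\<bar>" "0 \<le> 2 * real M * \<bar>\<delta> - 2\<bar>" by simp_all
    moreover have arith: "1 + 2 * d + m \<le> 1 + 2 * a + 3 * m + u + v"
      if "0 \<le> u" "0 \<le> v" "0 \<le> m" "d \<le> a" for a d u v m :: real
      using that by linarith
    ultimately show ?thesis unfolding step_const_def by (intro arith) auto
  qed
  finally show ?thesis by simp
next
  case False
  have "(\<integral>r. (real (fails_before r (m + 1)))\<^sup>2 \<partial>R) \<le> (\<integral>r. (real (fails_before r M))\<^sup>2 \<partial>R)"
    using False by (intro integral_mono integrable_fails_before_sq_R power_mono) (auto simp: fails_before_mono)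
  also have "\<dots> \<le> (real M)\<^sup>2 + 2 * real M * (1 - \<delta>) + (real M)\<^sup>2"
    by (rule fails_before_second_moment(2)) simp
  also have "\<dots> \<le> (real m)\<^sup>2 - 2 * (\<delta> - 2) * real m + step_const"
  proof -
    have "real M * (1 - \<delta>) \<le> real M * \<bar>1 - \<delta>\<bar>" by (intro mult_left_mono) auto
    moreover have "(\<delta> - 2) * real m \<le> real M * \<bar>\<delta> - 2\<bar>"
    proof -
      have "(\<delta> - 2) * real m \<le> \<bar>\<delta> - 2\<bar> * real M" using False by (intro mult_mono) auto
      then show ?thesis by (simp add: mult.commute)
    qed
    moreover have arith: "s + 2 * N * u + s \<le> q - 2 * w * l + (1 + 2 * a + 3 * s + 2 * N * a + 2 * N * c)"
      if "N * u \<le> N * a" "w * l \<le> N * c" "0 \<le> s" "0 \<le> q" "0 \<le> a" for N u a w l c s q :: real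
      using that by (simp add: mult.assoc)
    ultimately show ?thesis unfolding step_const_def by (intro arith) auto
  qed
  finally show ?thesis .
qed

lemma step_const_nonneg: "0 \<le> step_const"
  unfolding step_const_def by (intro add_nonneg_nonneg mult_nonneg_nonneg) auto

lemma nn_integral_immig_sq_le:
  "(\<integral>\<^sup>+y. ennreal ((real (immig (Suc n) y))\<^sup>2) \<partial>S) \<le>
    (\<integral>\<^sup>+y. ennreal ((real (immig n y))\<^sup>2 - 2 * (\<delta> - 2) * real (immig n y) + step_const) \<partial>S)"
proof -
  have "(\<integral>\<^sup>+y. ennreal ((real (immig (Suc n) y))\<^sup>2) \<partial>S) =
      (\<integral>\<^sup>+y. (\<integral>\<^sup>+r. ennreal ((real (fails_before r (immig n y + 1)))\<^sup>2) \<partial>R) \<partial>S)"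
    using nn_integral_S_split[of "\<lambda>y. immig n y + 1" "\<lambda>k. ennreal ((real k)\<^sup>2)"] by simp
  also have "\<dots> = (\<integral>\<^sup>+y. ennreal (\<integral>r. (real (fails_before r (immig n y + 1)))\<^sup>2 \<partial>R) \<partial>S)"
    by (intro nn_integral_cong nn_integral_eq_integral integrable_fails_before_sq_R) simp
  also have "\<dots> \<le> (\<integral>\<^sup>+y. ennreal ((real (immig n y))\<^sup>2 - 2 * (\<delta> - 2) * real (immig n y) + step_const) \<partial>S)"
    by (intro nn_integral_mono ennreal_leI second_moment_step)
  finally show ?thesis .
qed

lemma integrable_immig_sq: "integrable S (\<lambda>y. (real (immig n y))\<^sup>2)"
proof -
  have "(\<integral>\<^sup>+y. ennreal ((real (immig n y))\<^sup>2) \<partial>S) < \<infinity>"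
  proof (induction n)
    case (Suc n)
    then have i: "integrable S (\<lambda>y. (real (immig n y))\<^sup>2)" by (intro integrableI_bounded) auto
    have "(\<integral>\<^sup>+y. ennreal ((real (immig (Suc n) y))\<^sup>2) \<partial>S) \<le>
      (\<integral>\<^sup>+y. ennreal ((real (immig n y))\<^sup>2 - 2 * (\<delta> - 2) * real (immig n y) + step_const) \<partial>S)"
      by (rule nn_integral_immig_sq_le)
    also have "\<dots> \<le> (\<integral>\<^sup>+y. ennreal ((1 + 2 * \<bar>\<delta> - 2\<bar>) * (real (immig n y))\<^sup>2 + step_const) \<partial>S)"
    proof (intro nn_integral_mono ennreal_leI)
      fix y
      have "real (immig n y) \<le> (real (immig n y))\<^sup>2"
        by (cases "immig n y") (auto simp: power2_eq_square)
      then have "- (\<delta> - 2) * real (immig n y) \<le> \<bar>\<delta> - 2\<bar> * (real (immig n y))\<^sup>2"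
        by (intro mult_mono) auto
      then show "(real (immig n y))\<^sup>2 - 2 * (\<delta> - 2) * real (immig n y) + step_const \<le>
          (1 + 2 * \<bar>\<delta> - 2\<bar>) * (real (immig n y))\<^sup>2 + step_const"
        by (simp add: algebra_simps)
    qed
    also have "\<dots> = ennreal (\<integral>y. (1 + 2 * \<bar>\<delta> - 2\<bar>) * (real (immig n y))\<^sup>2 + step_const \<partial>S)"
      using i step_const_nonneg by (intro nn_integral_eq_integral) auto
    also have "\<dots> < \<infinity>" by simp
    finally show ?case .
  qed simp
  then show ?thesis by (intro integrableI_bounded) auto
qed

lemma integrable_immig: "integrable S (\<lambda>y. real (immig n y))"
proof (rule Bochner_Integration.integrable_bound[OF integrable_immig_sq[of n]])
  show "AE y in S. norm (real (immig n y)) \<le> norm ((real (immig n y))\<^sup>2)"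
  proof (intro AE_I2)
    fix y show "norm (real (immig n y)) \<le> norm ((real (immig n y))\<^sup>2)"
      by (cases "immig n y") (auto simp: power2_eq_square)
  qed
qed measurable

definition mean_immig :: "nat \<Rightarrow> real" where
  "mean_immig n = (\<integral>y. real (immig n y) \<partial>S)"

lemma mean_immig_mono: "m \<le> n \<Longrightarrow> mean_immig m \<le> mean_immig n"
  unfolding mean_immig_def by (intro integral_mono integrable_immig) (simp add: immig_mono)

text \<open>Summing the second moment inequality over the generations bounds the Cesaro averages of
  the means. Since the means increase, so are the means themselves bounded.\<close>

lemma mean_immig_bounded:
  assumes "2 < \<delta>"
  shows "mean_immig n \<le> step_const / (\<delta> - 2)"
proof -
  define q where "q n = (\<integral>y. (real (immig n y))\<^sup>2 \<partial>S)" for n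
  have step: "q (Suc k) \<le> q k - 2 * (\<delta> - 2) * mean_immig k + step_const" for k
  proof -
    let ?g = "\<lambda>y. (real (immig k y))\<^sup>2 - 2 * (\<delta> - 2) * real (immig k y) + step_const"
    have g: "integrable S ?g" using integrable_immig integrable_immig_sq by simp
    have nn: "0 \<le> ?g y" for y
      using order_trans[OF Bochner_Integration.integral_nonneg second_moment_step[of "immig k y"]] by simp
    have "(\<integral>\<^sup>+y. ennreal ((real (immig (Suc k) y))\<^sup>2) \<partial>S) = ennreal (q (Suc k))"
      unfolding q_def by (rule nn_integral_eq_integral[OF integrable_immig_sq]) simp
    moreover have "(\<integral>\<^sup>+y. ennreal (?g y) \<partial>S) = ennreal (\<integral>y. ?g y \<partial>S)"
      by (rule nn_integral_eq_integral[OF g]) (use nn in auto)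
    ultimately have "ennreal (q (Suc k)) \<le> ennreal (\<integral>y. ?g y \<partial>S)"
      using nn_integral_immig_sq_le[of k] by (simp only:)
    then have "q (Suc k) \<le> (\<integral>y. ?g y \<partial>S)"
      using nn by (subst (asm) ennreal_le_iff) (auto intro!: Bochner_Integration.integral_nonneg)
    also have "\<dots> = q k - 2 * (\<delta> - 2) * mean_immig k + step_const"
      using integrable_immig integrable_immig_sq
      by (simp add: q_def mean_immig_def rows.P.prob_space[simplified])
    finally show ?thesis .
  qed
  have sum: "q k + 2 * (\<delta> - 2) * (\<Sum>i<k. mean_immig i) \<le> real k * step_const" for k
  proof (induction k)
    case (Suc k)
    then show ?case using step[of k] by (simp add: algebra_simps)
  qed (simp add: q_def)
  show ?thesis
  proof (cases n)
    case 0
    then show ?thesis using assms step_const_nonneg by (simp add: mean_immig_def)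
  next
    case (Suc n')
    \<comment> \<open>The window from \<open>n\<close> to \<open>2 * n\<close> costs a factor 2,
      which cancels the 2 in \<open>2 * (\<delta> - 2)\<close>.\<close>
    have "real n * mean_immig n = (\<Sum>i\<in>{n..<2 * n}. mean_immig n)" by simp
    also have "\<dots> \<le> (\<Sum>i\<in>{n..<2 * n}. mean_immig i)"
      by (intro sum_mono mean_immig_mono) auto
    also have "\<dots> \<le> (\<Sum>i<2 * n. mean_immig i)"
      by (intro sum_mono2) (auto simp: mean_immig_def)
    finally have "2 * (\<delta> - 2) * (real n * mean_immig n) \<le> 2 * (\<delta> - 2) * (\<Sum>i<2 * n. mean_immig i)"
      using assms by (intro mult_left_mono) auto
    also have "\<dots> \<le> real (2 * n) * step_const"
    proof -
      have "0 \<le> q (2 * n)" unfolding q_def by (rule Bochner_Integration.integral_nonneg) simp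
      then show ?thesis using sum[of "2 * n"] by linarith
    qed
    finally have "real n * ((\<delta> - 2) * mean_immig n) \<le> real n * step_const" by (simp add: algebra_simps)
    then have "(\<delta> - 2) * mean_immig n \<le> step_const" using Suc by (simp del: of_nat_Suc)
    then show ?thesis using assms by (simp add: pos_le_divide_eq mult.commute)
  qed
qed

text \<open>By monotone convergence the pointwise supremum has a finite integral, hence is finite
  almost everywhere. A bounded increasing sequence of naturals is eventually constant.\<close>

lemma AE_immig_bounded:
  assumes C: "\<And>n. mean_immig n \<le> C"
  shows "AE y in S. \<exists>K. \<forall>n. immig n y \<le> K"
    and "integrable S (\<lambda>y. real (immig_lim y))"
    and "mean_immig \<longlonglongrightarrow> (\<integral>y. real (immig_lim y) \<partial>S)"
proof -
  let ?f = "\<lambda>y. SUP n. ennreal (real (immig n y))"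
  have inc: "incseq (\<lambda>n y. ennreal (real (immig n y)))"
    by (auto simp: incseq_def le_fun_def immig_mono)
  have "(\<integral>\<^sup>+y. ?f y \<partial>S) = (SUP n. \<integral>\<^sup>+y. ennreal (real (immig n y)) \<partial>S)"
    by (rule nn_integral_monotone_convergence_SUP[OF inc]) measurable
  also have "\<dots> = (SUP n. ennreal (mean_immig n))"
    by (simp add: mean_immig_def nn_integral_eq_integral[OF integrable_immig])
  also have "\<dots> \<le> ennreal C" by (intro SUP_least ennreal_leI C)
  finally have fin: "(\<integral>\<^sup>+y. ?f y \<partial>S) \<le> ennreal C" .
  have "AE y in S. ?f y \<noteq> \<infinity>"
    using fin by (intro nn_integral_PInf_AE) (auto simp: top_unique)
  then show ae: "AE y in S. \<exists>K. \<forall>n. immig n y \<le> K"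
  proof eventually_elim
    case (elim y)
    then have "?f y < top" unfolding infinity_ennreal_def top.not_eq_extremum .
    then obtain K where K: "?f y < of_nat K" using ennreal_Ex_less_of_nat by blast
    have "immig n y \<le> K" for n
    proof -
      have "ennreal (real (immig n y)) \<le> ?f y" by (rule SUP_upper) simp
      also note K
      finally show ?thesis by (simp add: ennreal_of_nat_eq_real_of_nat ennreal_less_iff)
    qed
    then show ?case by blast
  qed
  have lim: "AE y in S. (\<lambda>n. real (immig n y)) \<longlonglongrightarrow> real (immig_lim y)"
    using ae
  proof eventually_elim
    case (elim y)
    then obtain N where "\<forall>n\<ge>N. immig n y = immig_lim y" using immig_eventually_lim by blast
    then show ?case by (intro tendsto_eventually) (auto simp: eventually_sequentially)
  qed
  have m: "(\<lambda>y. real (immig_lim y)) \<in> borel_measurable S" by measurable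
  have "bdd_above (range mean_immig)" using C by (auto intro: bdd_aboveI[of _ C])
  then have "mean_immig \<longlonglongrightarrow> (SUP n. mean_immig n)"
    using mean_immig_mono by (intro LIMSEQ_incseq_SUP) (auto simp: incseq_def)
  then have l: "(\<lambda>n. \<integral>y. real (immig n y) \<partial>S) \<longlonglongrightarrow> (SUP n. mean_immig n)"
    unfolding mean_immig_def[abs_def] .
  have mono: "AE y in S. mono (\<lambda>n. real (immig n y))" by (intro AE_I2) (auto simp: mono_def immig_mono)
  show "integrable S (\<lambda>y. real (immig_lim y))"
    by (rule integrable_monotone_convergence[OF integrable_immig mono lim l m])
  have "(\<integral>y. real (immig_lim y) \<partial>S) = (SUP n. mean_immig n)"
    by (rule integral_monotone_convergence[OF integrable_immig mono lim l m])
  then show "mean_immig \<longlonglongrightarrow> (\<integral>y. real (immig_lim y) \<partial>S)"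
    using \<open>mean_immig \<longlonglongrightarrow> (SUP n. mean_immig n)\<close> by simp
qed

lemma AE_seq_tl: "AE y in S. P y \<Longrightarrow> AE y in S. P (seq_tl y)"
  by (rule AE_distrD[OF measurable_seq_tl_S]) (simp only: rows.distr_seq_tl)

lemma AE_immig_lim_rec:
  assumes C: "\<And>n. mean_immig n \<le> C"
  shows "AE y in S. immig_lim y = fails_before (y 0) (immig_lim (seq_tl y) + 1)"
  using AE_immig_bounded(1)[OF C] AE_seq_tl[OF AE_immig_bounded(1)[OF C]]
  by eventually_elim (use immig_lim_rec in blast)

end

section \<open>Infinite mean for drift at most 2\<close>

text \<open>This bound is uniform in \<open>x\<close> after division by \<open>x\<^sup>2\<close>; it
  is what lets one constant truncate the test function for all \<open>x\<close> at once.\<close>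

lemma exp_like_upper: "0 \<le> x \<Longrightarrow> x \<le> 1 \<Longrightarrow> (1 - x) ^ n - 1 + real n * x \<le> (real n * x)\<^sup>2" for x :: real
proof (induction n)
  case (Suc n)
  have "0 \<le> (1 - x) ^ n - 1 + real n * x"
    using Bernoulli_inequality[of "- x" n] Suc.prems by simp
  then have "x * ((1 - x) ^ n - 1 + real n * x) \<ge> 0" using Suc.prems by (intro mult_nonneg_nonneg)
  moreover have "(1 - x) ^ Suc n - 1 + real (Suc n) * x =
      ((1 - x) ^ n - 1 + real n * x) - x * ((1 - x) ^ n - 1 + real n * x) + real n * (x * x)"
    by (simp add: algebra_simps)
  moreover have "(real (Suc n) * x)\<^sup>2 = (real n * x)\<^sup>2 + 2 * (real n * (x * x)) + x * x"
    by (simp add: power2_eq_square algebra_simps)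
  moreover have "0 \<le> real n * (x * x)" "0 \<le> x * x" by simp_all
  ultimately show ?case using Suc.IH Suc.prems by linarith
qed simp

text \<open>The second-order Taylor coefficient of \<open>(1 - x) ^ n\<close>, obtained by recursion
  on \<open>n\<close> without derivatives.\<close>

lemma exp_like_limit:
  fixes x :: "nat \<Rightarrow> real"
  assumes x: "x \<longlonglongrightarrow> 0" "\<And>k. x k \<noteq> 0"
  shows "(\<lambda>k. ((1 - x k) ^ n - 1 + real n * x k) / (x k)\<^sup>2) \<longlonglongrightarrow> real n * (real n - 1) / 2"
proof (induction n)
  case (Suc n)
  have eq: "((1 - x k) ^ Suc n - 1 + real (Suc n) * x k) / (x k)\<^sup>2 =
      (1 - x k) * (((1 - x k) ^ n - 1 + real n * x k) / (x k)\<^sup>2) + real n" for k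
  proof -
    have "(1 - x k) ^ Suc n - 1 + real (Suc n) * x k =
        (1 - x k) * ((1 - x k) ^ n - 1 + real n * x k) + real n * (x k)\<^sup>2"
      by (simp add: power2_eq_square algebra_simps)
    moreover have "(a * b + c * s) / s = a * (b / s) + c" if "s \<noteq> 0" for a b c s :: real
      using that by (simp add: add_divide_distrib)
    ultimately show ?thesis using x(2)[of k] by simp
  qed
  have "(\<lambda>k. (1 - x k) * (((1 - x k) ^ n - 1 + real n * x k) / (x k)\<^sup>2) + real n) \<longlonglongrightarrow>
      (1 - 0) * (real n * (real n - 1) / 2) + real n"
    by (intro tendsto_intros x(1) Suc)
  then show ?case unfolding eq by (simp add: field_simps)
qed simp

text \<open>Writing \<open>(1 - x) ^ m\<close> as \<open>(1 - x\<^sup>2) ^ m / (1 + x) ^ m\<close>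
  isolates the gain, which is \<open>m * x\<^sup>2\<close> to leading order. Bernoulli gives
  \<open>(1 - x\<^sup>2) ^ m \<le> 1 / (1 + m * x\<^sup>2)\<close>.\<close>

lemma gain_lower_bound:
  fixes x :: real
  assumes x: "0 \<le> x" "x \<le> 1"
  shows "real m * x\<^sup>2 / ((1 + x) ^ m * (1 + real m * x\<^sup>2)) \<le> 1 / (1 + x) ^ m - (1 - x) ^ m"
proof -
  let ?p = "1 / (1 + x) ^ m" and ?u = "real m * x\<^sup>2"
  have u: "0 \<le> ?u" by simp
  have "(1 - x) * (1 + x) = 1 - x\<^sup>2" by (simp add: power2_eq_square algebra_simps)
  then have "(1 - x) ^ m * (1 + x) ^ m = (1 - x\<^sup>2) ^ m" by (simp only: power_mult_distrib[symmetric])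
  moreover have "0 < (1 + x) ^ m" using x by simp
  ultimately have eq: "(1 - x) ^ m = ?p * (1 - x\<^sup>2) ^ m"
    by (metis mult.commute mult_1 nonzero_mult_div_cancel_right less_irrefl times_divide_eq_left)
  have x2: "0 \<le> 1 - x\<^sup>2" using x by (simp add: power_le_one)
  have "1 + ?u \<le> (1 + x\<^sup>2) ^ m"
    by (rule Bernoulli_inequality) (rule order_trans[OF _ zero_le_power2], simp)
  then have "(1 - x\<^sup>2) ^ m * (1 + ?u) \<le> (1 - x\<^sup>2) ^ m * (1 + x\<^sup>2) ^ m"
    using x2 by (intro mult_left_mono) simp_all
  also have "\<dots> = ((1 - x\<^sup>2) * (1 + x\<^sup>2)) ^ m" by (rule power_mult_distrib[symmetric])
  also have "\<dots> \<le> 1"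
  proof (rule power_le_one)
    show "0 \<le> (1 - x\<^sup>2) * (1 + x\<^sup>2)" using x2 by simp
    have "(1 - x\<^sup>2) * (1 + x\<^sup>2) = 1 - x\<^sup>2 * x\<^sup>2" by (simp add: algebra_simps)
    then show "(1 - x\<^sup>2) * (1 + x\<^sup>2) \<le> 1" by simp
  qed
  finally have "(1 - x\<^sup>2) ^ m \<le> 1 / (1 + ?u)" using u by (simp add: pos_le_divide_eq add_pos_nonneg)
  then have "?p * (1 - 1 / (1 + ?u)) \<le> ?p * (1 - (1 - x\<^sup>2) ^ m)"
    using x by (intro mult_left_mono) auto
  moreover have "1 - 1 / (1 + v) = v / (1 + v)" if "0 \<le> v" for v :: real
    using that by (simp add: diff_divide_eq_iff)
  ultimately show ?thesis using eq u by (simp add: right_diff_distrib)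
qed

context row_law
begin

section \<open>Stationary law and submartingale test functions\<close>

definition step_mean :: "(nat \<Rightarrow> real) \<Rightarrow> nat \<Rightarrow> real" where
  "step_mean f m = (\<integral>r. f (fails_before r (m + 1)) \<partial>R)"

lemma integrable_linear_growth:
  assumes "\<And>k. \<bar>f k\<bar> \<le> c * (real k + 1)"
  shows "integrable R (\<lambda>r. f (fails_before r m))"
proof (rule Bochner_Integration.integrable_bound)
  show "integrable R (\<lambda>r. c * (real (fails_before r m) + 1))"
    using integrable_fails_before_R by simp
  show "AE r in R. norm (f (fails_before r m)) \<le> norm (c * (real (fails_before r m) + 1))"
    using assms by (auto intro!: AE_I2 order_trans[OF assms])
qed measurable

text \<open>The recursion for \<open>immig_lim\<close> expresses it as one step started from a copy
  of itself on the shifted rows. Linear growth is exactly what a finite mean allows to be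
  integrated.\<close>

lemma stationarity:
  assumes C: "\<And>n. mean_immig n \<le> C"
    and f: "\<And>k. 0 \<le> f k" "\<And>k. f k \<le> c * (real k + 1)"
  shows "integrable S (\<lambda>y. step_mean f (immig_lim y))"
    and "(\<integral>y. step_mean f (immig_lim y) \<partial>S) = (\<integral>y. f (immig_lim y) \<partial>S)"
    and "integrable S (\<lambda>y. f (immig_lim y))"
proof -
  have int: "integrable R (\<lambda>r. f (fails_before r m))" for m
    using f by (intro integrable_linear_growth[of _ c]) auto
  show intf: "integrable S (\<lambda>y. f (immig_lim y))"
  proof (rule Bochner_Integration.integrable_bound)
    show "integrable S (\<lambda>y. c * (real (immig_lim y) + 1))"
      using AE_immig_bounded(2)[OF C] by simp
    show "AE y in S. norm (f (immig_lim y)) \<le> norm (c * (real (immig_lim y) + 1))"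
      using f by (auto intro!: AE_I2 order_trans[OF f(2)])
  qed measurable
  have "(\<integral>\<^sup>+y. ennreal (f (immig_lim y)) \<partial>S) =
      (\<integral>\<^sup>+y. ennreal (f (fails_before (y 0) (immig_lim (seq_tl y) + 1))) \<partial>S)"
    using AE_immig_lim_rec[OF C] by (intro nn_integral_cong_AE) auto
  also have "\<dots> = (\<integral>\<^sup>+y. (\<integral>\<^sup>+r. ennreal (f (fails_before r (immig_lim y + 1))) \<partial>R) \<partial>S)"
    by (rule nn_integral_S_split[of "\<lambda>y. immig_lim y + 1" "\<lambda>k. ennreal (f k)"]) measurable
  also have "\<dots> = (\<integral>\<^sup>+y. ennreal (step_mean f (immig_lim y)) \<partial>S)"
    unfolding step_mean_def using f by (intro nn_integral_cong nn_integral_eq_integral int) auto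
  finally have eq: "(\<integral>\<^sup>+y. ennreal (step_mean f (immig_lim y)) \<partial>S) = ennreal (\<integral>y. f (immig_lim y) \<partial>S)"
    using nn_integral_eq_integral[OF intf] f by simp
  have nn: "0 \<le> step_mean f m" for m
    unfolding step_mean_def using f by (intro Bochner_Integration.integral_nonneg) auto
  show i: "integrable S (\<lambda>y. step_mean f (immig_lim y))"
    using eq nn by (intro integrableI_nn_integral_finite) auto
  show "(\<integral>y. step_mean f (immig_lim y) \<partial>S) = (\<integral>y. f (immig_lim y) \<partial>S)"
    using eq nn_integral_eq_integral[OF i] nn f
    by (simp add: Bochner_Integration.integral_nonneg ennreal_inj)
qed

text \<open>Under a stationary law \<open>step_mean f - f\<close> integrates to 0. Adding
  \<open>g\<close> makes it nonnegative, so its integral, that of \<open>g\<close>, is at least the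
  contribution of the atom \<open>m\<close>, where \<open>f\<close> vanishes before the
  step.\<close>

lemma stationary_atom_bound:
  assumes C: "\<And>n. mean_immig n \<le> C"
    and f: "\<And>k. 0 \<le> f k" "\<And>k. f k \<le> c * (real k + 1)"
    and g: "\<And>k. 0 \<le> g k" "\<And>k. g k \<le> d * (real k + 1)"
    and sub: "\<And>k. f k - g k \<le> step_mean f k" and m: "f m = 0"
  shows "step_mean f m * measure S {y. immig_lim y = m} \<le> (\<integral>y. g (immig_lim y) \<partial>S)"
proof -
  note st = stationarity[OF C f]
  have E: "{y. immig_lim y = m} \<in> sets S"
    by (rule sets_Collect_UNIV, simp) measurable
  have "step_mean f m * measure S {y. immig_lim y = m} =
      (\<integral>y. step_mean f m * indicator {y. immig_lim y = m} y \<partial>S)"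
    using E by simp
  also have "\<dots> \<le> (\<integral>y. step_mean f (immig_lim y) - f (immig_lim y) + g (immig_lim y) \<partial>S)"
  proof (rule integral_mono)
    show "integrable S (\<lambda>y. step_mean f m * indicator {y. immig_lim y = m} y)"
      using E by (intro integrable_mult_right) (simp add: rows.P.emeasure_eq_measure)
    show "integrable S (\<lambda>y. step_mean f (immig_lim y) - f (immig_lim y) + g (immig_lim y))"
      using st(1,3) stationarity(3)[OF C g] by simp
    fix y
    show "step_mean f m * indicator {y. immig_lim y = m} y \<le>
        step_mean f (immig_lim y) - f (immig_lim y) + g (immig_lim y)"
      using sub[of "immig_lim y"] g(1)[of "immig_lim y"] m by (auto simp: indicator_def)
  qed
  also have "\<dots> = (\<integral>y. g (immig_lim y) \<partial>S)"
    using st stationarity(3)[OF C g] by simp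
  finally show ?thesis .
qed

lemma immig_lim_atom: "\<exists>m. 0 < measure S {y. immig_lim y = m}"
proof (rule ccontr)
  assume "\<not> ?thesis"
  then have z: "measure S {y. immig_lim y = m} = 0" for m
    using measure_nonneg[of S "{y. immig_lim y = m}"] by (metis less_eq_real_def)
  have "AE y in S. immig_lim y \<noteq> m" for m
  proof -
    have E: "{y \<in> space S. immig_lim y = m} \<in> sets S" by measurable
    then have "{y. immig_lim y = m} \<in> null_sets S"
      using z[of m] by (simp add: null_sets_def rows.P.emeasure_eq_measure)
    then show ?thesis by (rule AE_I'[of _ S]) auto
  qed
  then have "AE y in S. \<forall>m. immig_lim y \<noteq> m" by (intro AE_all_countable[THEN iffD2]) blast
  then have "AE y in S. False" by eventually_elim auto
  then show False using rows.P.AE_False by simp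
qed

lemma step_mean_pos:
  assumes f: "\<And>k. 0 \<le> f k" "\<And>k. f k \<le> c * (real k + 1)"
  shows "f (M + k) * measure R {r. fails_before r (m + 1) = M + k} \<le> step_mean f m"
proof -
  have E: "{r. fails_before r (m + 1) = M + k} \<in> sets R"
    by (rule sets_Collect_UNIV, simp) measurable
  have "f (M + k) * measure R {r. fails_before r (m + 1) = M + k} =
      (\<integral>r. f (M + k) * indicator {r. fails_before r (m + 1) = M + k} r \<partial>R)"
    using E by simp
  also have "\<dots> \<le> step_mean f m"
    unfolding step_mean_def
  proof (rule integral_mono)
    show "integrable R (\<lambda>r. f (M + k) * indicator {r. fails_before r (m + 1) = M + k} r)"
      using E by (intro integrable_mult_right) (simp add: emeasure_eq_measure)
    show "integrable R (\<lambda>r. f (fails_before r (m + 1)))"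
      using f by (intro integrable_linear_growth[of _ c]) auto
  qed (use f in \<open>auto simp: indicator_def\<close>)
  finally show ?thesis .
qed

text \<open>For \<delta> \<le> 1 the mean population does not decrease in a step, so the test
  function is a submartingale without error. It gains strictly at the atom, where stationarity
  permits no gain.\<close>

lemma mean_immig_unbounded_le_1:
  assumes fail: "0 < measure R {r. succs r M = 0}" and \<delta>: "\<delta> \<le> 1"
    and C: "\<And>n. mean_immig n \<le> C"
  shows False
proof -
  obtain m where m: "0 < measure S {y. immig_lim y = m}" using immig_lim_atom by blast
  \<comment> \<open>\<open>m \<le> K\<close> makes the test function vanish at the atom;
    \<open>M \<le> K\<close> makes the mean formula valid where it is positive.\<close>
  define K where "K = max m M"
  define f where "f k = max 0 (real k - real K)" for k
  have f: "0 \<le> f k" "f k \<le> 1 * (real k + 1)" for k by (auto simp: f_def)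
  have int: "integrable R (\<lambda>r. f (fails_before r n))" for n
    using f by (intro integrable_linear_growth[of _ 1]) auto
  have sub: "f k - 0 \<le> step_mean f k" for k
  proof (cases "k \<le> K")
    case True
    then show ?thesis using f(1) by (auto simp: f_def[of k] step_mean_def intro!: Bochner_Integration.integral_nonneg)
  next
    case False
    then have "f k = real k - real K" by (simp add: f_def)
    also have "\<dots> \<le> real (k + 1) - \<delta> - real K" using \<delta> by simp
    also have "\<dots> = (\<integral>r. real (fails_before r (k + 1)) - real K \<partial>R)"
      using integrable_fails_before_R[of "k + 1"] fails_before_mean(2)[of "k + 1"] False
      by (simp add: K_def)
    also have "\<dots> \<le> step_mean f k"
      unfolding step_mean_def using integrable_fails_before_R int
      by (intro integral_mono) (auto simp: f_def)
    finally show ?thesis by simp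
  qed
  have "step_mean f m * measure S {y. immig_lim y = m} \<le> (\<integral>y. 0 \<partial>S)"
    by (rule stationary_atom_bound[where g = "\<lambda>_. 0" and d = 0, OF C f _ _ sub]) (auto simp: f_def K_def)
  moreover have "0 < f (M + (K + 1)) * measure R {r. fails_before r (m + 1) = M + (K + 1)}"
    using fails_before_large_pos[OF fail, of "m + 1" "K + 1"] by (intro mult_pos_pos) (auto simp: f_def)
  then have "0 < step_mean f m" using step_mean_pos[OF f] by (rule less_le_trans)
  ultimately show False using m by (simp add: mult_le_0_iff)
qed

text \<open>
  At the critical drift 2 the terms of order \<open>x\<^sup>2 * k\<close> in the one-step change of
  \<open>(1 - x) ^ k - 1 + k * x\<close> cancel. The constant \<open>b\<close> is chosen so that the linear correction pays
  for the error of order \<open>x\<^sup>2\<close>; what remains is \<open>x\<^sup>2 * h x k\<close>, where \<open>h x k \<le> k\<close> tends to 0 with \<open>x\<close>.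
\<close>

lemma mean_immig_unbounded_le_2:
  assumes fail: "0 < measure R {r. succs r M = 0}" and \<delta>: "1 < \<delta>" "\<delta> \<le> 2"
    and C: "\<And>n. mean_immig n \<le> C"
  shows False
proof -
  obtain m where m: "0 < measure S {y. immig_lim y = m}" using immig_lim_atom by blast
  \<comment> \<open>The errors are \<open>M\<^sup>2 * x\<^sup>2\<close> from
    \<open>fails_before_laplace\<close> and \<open>x\<^sup>2\<close> from the immigrant. A step
    lowers \<open>k\<close> by \<open>\<delta> - 1\<close> on average, so the correction returns
    \<open>x\<^sup>2 * b * (\<delta> - 1)\<close>.\<close>
  define b where "b = ((real M)\<^sup>2 + 1) / (\<delta> - 1)"
  have b: "0 \<le> b" "b * (\<delta> - 1) = (real M)\<^sup>2 + 1" using \<delta> by (auto simp: b_def)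
  \<comment> \<open>By \<open>exp_like_upper\<close>, subtracting \<open>x\<^sup>2 * K\<close> makes
    \<open>\<phi> x k\<close> nonpositive for \<open>k \<le> m + M\<close>, uniformly in
    \<open>x\<close>. So the truncated function vanishes at the atom, and where it is positive
    \<open>M \<le> k + 1\<close> holds and the moment formulas apply.\<close>
  define K where "K = (real (m + M))\<^sup>2"
  define \<phi> where "\<phi> x k = (1 - x) ^ k - 1 + real k * x - x\<^sup>2 * (b * real k + K)" for x :: real and k :: nat
  define f where "f x k = max 0 (\<phi> x k)" for x k
  \<comment> \<open>\<open>x\<^sup>2 * h x k\<close> is the amount by which the bound in
    \<open>gain_lower_bound\<close> falls short of its leading term
    \<open>k * x\<^sup>2\<close>.\<close>
  define h where "h x k = real k * (1 - 1 / ((1 + x) ^ k * (1 + real k * x\<^sup>2)))" for x :: real and k :: nat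
  have K0: "0 \<le> K" by (simp add: K_def)
  have f: "0 \<le> f x k" "f x k \<le> 1 * (real k + 1)" if x: "0 \<le> x" "x \<le> 1" for x k
  proof -
    have "(1 - x) ^ k \<le> 1" using x by (intro power_le_one) auto
    moreover have "real k * x \<le> real k" using x by (simp add: mult_left_le)
    moreover have "0 \<le> x\<^sup>2 * (b * real k + K)" using b K0 by simp
    ultimately show "f x k \<le> 1 * (real k + 1)" by (auto simp: f_def \<phi>_def)
  qed (simp add: f_def)
  have h: "0 \<le> h x k" "h x k \<le> 1 * (real k + 1)" if x: "0 \<le> x" for x k
  proof -
    have "1 * 1 \<le> (1 + x) ^ k * (1 + real k * x\<^sup>2)" using x by (intro mult_mono) auto
    then have "0 \<le> 1 / ((1 + x) ^ k * (1 + real k * x\<^sup>2))" "1 / ((1 + x) ^ k * (1 + real k * x\<^sup>2)) \<le> 1"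
      by (simp_all add: divide_le_eq_1)
    then show "0 \<le> h x k" "h x k \<le> 1 * (real k + 1)"
      unfolding h_def by (simp, intro order_trans[OF mult_left_le]) auto
  qed
  have large: "m + M < k" if "0 < \<phi> x k" and x: "0 < x" "x \<le> 1" for x k
  proof -
    have "0 < (real k * x)\<^sup>2 - x\<^sup>2 * (b * real k + K)"
      using that exp_like_upper[of x k] by (auto simp: \<phi>_def)
    also have "\<dots> \<le> x\<^sup>2 * ((real k)\<^sup>2 - K)"
      using b x by (simp add: power_mult_distrib algebra_simps)
    finally have "K < (real k)\<^sup>2" using x by (simp add: zero_less_mult_iff)
    then have "real (m + M) < real k" unfolding K_def by (rule power_less_imp_less_base) simp
    then show ?thesis by simp
  qed
  have int\<phi>: "integrable R (\<lambda>r. \<phi> x (fails_before r n))" if x: "0 \<le> x" "x \<le> 1" for x n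
  proof (rule integrable_linear_growth[of _ "1 + (b + K)"])
    fix k
    have "(1 - x) ^ k \<le> 1" "0 \<le> (1 - x) ^ k" using x by (auto intro: power_le_one)
    moreover have "real k * x \<le> real k" "0 \<le> real k * x" using x by (auto simp: mult_left_le)
    moreover have "x\<^sup>2 * (b * real k + K) \<le> 1 * ((b + K) * (real k + 1))"
      using b K0 x by (intro mult_mono) (auto simp: power_le_one algebra_simps)
    moreover have "0 \<le> x\<^sup>2 * (b * real k + K)" using b K0 by simp
    ultimately show "\<bar>\<phi> x k\<bar> \<le> (1 + (b + K)) * (real k + 1)"
      unfolding \<phi>_def by (simp add: abs_le_iff algebra_simps)
  qed
  have sub: "f x k - x\<^sup>2 * h x k \<le> step_mean (f x) k" if x: "0 < x" "x \<le> 1" for x k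
  proof (cases "0 < \<phi> x k")
    case False
    then have "f x k - x\<^sup>2 * h x k \<le> 0" using h(1)[of x k] x by (simp add: f_def)
    also have "0 \<le> step_mean (f x) k"
      unfolding step_mean_def by (intro Bochner_Integration.integral_nonneg) (simp add: f_def)
    finally show ?thesis .
  next
    case True
    then have k: "M \<le> k + 1" using large[OF True x] by simp
    let ?q = "1 / (1 + x) ^ (k + 1)" and ?p = "1 / (1 + x) ^ k" and ?n = "real (k + 1)"
    have "1 \<le> (1 + x) ^ (k + 1)" using x by (intro one_le_power) auto
    then have q0: "0 \<le> ?q" "?q \<le> 1" by (simp_all del: power_Suc)
    have "1 + x \<noteq> 0" using x by simp
    then have pq: "?q * (1 + x) = ?p" by simp
    have q1: "1 - ?n * x \<le> ?q"
    proof -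
      have "(1 - ?n * x) * (1 + x) ^ (k + 1) \<le> 1"
      proof (cases "0 \<le> 1 - ?n * x")
        case True
        have "1 - ?n * x \<le> (1 - x) ^ (k + 1)" using Bernoulli_inequality[of "- x" "k + 1"] x by simp
        then have "(1 - ?n * x) * (1 + x) ^ (k + 1) \<le> (1 - x) ^ (k + 1) * (1 + x) ^ (k + 1)"
          using x by (intro mult_right_mono) auto
        also have "\<dots> = (1 - x * x) ^ (k + 1)" by (simp only: power_mult_distrib[symmetric]) (simp add: algebra_simps)
        also have "\<dots> \<le> 1" using x by (intro power_le_one) (auto simp: mult_le_one)
        finally show ?thesis .
      next
        case False
        then have "(1 - ?n * x) * (1 + x) ^ (k + 1) \<le> 0" using x by (intro mult_nonpos_nonneg) auto
        then show ?thesis by simp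
      qed
      then show ?thesis using x by (subst pos_le_divide_eq) auto
    qed
    have i1: "integrable R (\<lambda>r. (1 - x) ^ fails_before r (k + 1))"
      using x by (intro integrable_const_bound[of _ 1]) (auto simp: power_le_one)
    have i2: "integrable R (\<lambda>r. real (fails_before r (k + 1)))" by (rule integrable_fails_before_R)
    have "(\<integral>r. \<phi> x (fails_before r (k + 1)) \<partial>R) =
        (\<integral>r. (1 - x) ^ fails_before r (k + 1) \<partial>R) - 1 + (?n - \<delta>) * x - x\<^sup>2 * (b * (?n - \<delta>) + K)"
      unfolding \<phi>_def using i1 i2 fails_before_mean(2)[OF k] by simp
    also have "\<dots> \<ge> ?q * (1 + \<delta> * x - (real M)\<^sup>2 * x\<^sup>2) - 1 + (?n - \<delta>) * x - x\<^sup>2 * (b * (?n - \<delta>) + K)"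
      using fails_before_laplace[OF k, of x] x by simp
    finally have lo: "?q * (1 + \<delta> * x - (real M)\<^sup>2 * x\<^sup>2) - 1 + (?n - \<delta>) * x - x\<^sup>2 * (b * (?n - \<delta>) + K)
        \<le> (\<integral>r. \<phi> x (fails_before r (k + 1)) \<partial>R)" by simp
    have "(\<integral>r. \<phi> x (fails_before r (k + 1)) \<partial>R) \<le> step_mean (f x) k"
      unfolding step_mean_def using x f
      by (intro integral_mono int\<phi> integrable_linear_growth[of _ 1]) (auto simp: f_def)
    moreover have "\<phi> x k - x\<^sup>2 * h x k \<le>
        ?q * (1 + \<delta> * x - (real M)\<^sup>2 * x\<^sup>2) - 1 + (?n - \<delta>) * x - x\<^sup>2 * (b * (?n - \<delta>) + K)"
    proof -
      \<comment> \<open>Splitting \<open>1 + \<delta> * x\<close> into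
        \<open>(1 + x) + (\<delta> - 1) * x\<close> turns \<open>?q\<close> into \<open>?p\<close>,
        which removes the immigrant from the main term.\<close>
      have e1: "?q * (1 + \<delta> * x - (real M)\<^sup>2 * x\<^sup>2) = ?p + ?q * ((\<delta> - 1) * x) - ?q * ((real M)\<^sup>2 * x\<^sup>2)"
        unfolding pq[symmetric] by (simp only: algebra_simps)
      have "x\<^sup>2 * h x k = real k * x\<^sup>2 - real k * x\<^sup>2 / ((1 + x) ^ k * (1 + real k * x\<^sup>2))"
        by (simp add: h_def algebra_simps)
      then have gain: "real k * x\<^sup>2 - x\<^sup>2 * h x k \<le> ?p - (1 - x) ^ k"
        using gain_lower_bound[of x k] x by simp
      \<comment> \<open>Here \<delta> \<le> 2 enters. The loss is at most
        \<open>(k + 1) * x\<^sup>2\<close>, and the gain cancels its part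
        \<open>k * x\<^sup>2\<close>.\<close>
      have d1: "(1 - ?q) * ((\<delta> - 1) * x) \<le> ?n * x * (1 * x)"
        using q0 q1 \<delta> x by (intro mult_mono) auto
      have d2: "?q * ((real M)\<^sup>2 * x\<^sup>2) \<le> (real M)\<^sup>2 * x\<^sup>2"
        using q0 by (intro mult_left_le_one_le) auto
      have d3: "x\<^sup>2 * (b * (\<delta> - 1)) = x\<^sup>2 * ((real M)\<^sup>2 + 1)" using b(2) by simp
      have lhs: "\<phi> x k = (1 - x) ^ k - 1 + (?n - 1) * x - x\<^sup>2 * (b * (?n - 1) + K)"
        by (simp add: \<phi>_def)
      have e2: "(?n - \<delta>) * x = (?n - 1) * x - (\<delta> - 1) * x" by (simp add: algebra_simps)
      have e3: "x\<^sup>2 * (b * (?n - \<delta>) + K) = x\<^sup>2 * (b * (?n - 1) + K) - x\<^sup>2 * (b * (\<delta> - 1))"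
        by (simp add: algebra_simps)
      have e4: "(1 - ?q) * ((\<delta> - 1) * x) = (\<delta> - 1) * x - ?q * ((\<delta> - 1) * x)" by (simp add: left_diff_distrib)
      have e5: "?n * x * (1 * x) = real k * x\<^sup>2 + x\<^sup>2" by (simp add: power2_eq_square algebra_simps)
      have e6: "x\<^sup>2 * ((real M)\<^sup>2 + 1) = (real M)\<^sup>2 * x\<^sup>2 + x\<^sup>2" by (simp add: algebra_simps)
      show ?thesis
        unfolding e1 e2 e3 lhs using gain d1 d2 d3 unfolding e4 e5 e6 by linarith
    qed
    moreover have "f x k = \<phi> x k" using True by (simp add: f_def)
    ultimately show ?thesis using lo by linarith
  qed
  \<comment> \<open>\<open>N - 1\<close> has to exceed twice the linear correction, so that the
    quadratic term \<open>N * (N - 1) / 2\<close> wins. A level of the form \<open>M + L\<close> is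
    attained from the atom in one step with positive probability.\<close>
  define L where "L = nat \<lceil>2 * (b + K + 2)\<rceil> + 1"
  define N where "N = M + L"
  define \<rho> where "\<rho> = measure R {r. fails_before r (m + 1) = N}"
  have \<rho>: "0 < \<rho>" unfolding \<rho>_def N_def by (rule fails_before_large_pos[OF fail]) simp
  let ?lim = "real N * (real N - 1) / 2 - (b * real N + K)"
  have lim_pos: "0 < ?lim"
  proof -
    have "2 * (b + K + 2) \<le> real N - 1" unfolding N_def L_def by linarith
    then have "real N * (2 * (b + K + 2)) \<le> real N * (real N - 1)" by (intro mult_left_mono) auto
    moreover have "1 \<le> real N" unfolding N_def L_def by simp
    then have "1 * K \<le> real N * K" using K0 by (intro mult_right_mono)
    ultimately show ?thesis using \<open>1 \<le> real N\<close> by (simp add: algebra_simps)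
  qed
  define x where "x n = 1 / real (Suc n)" for n
  have x: "0 < x n" "x n \<le> 1" for n by (auto simp: x_def)
  have x0: "x \<longlonglongrightarrow> 0" unfolding x_def by (rule LIMSEQ_Suc[OF lim_1_over_n])
  have main: "\<phi> (x n) N / (x n)\<^sup>2 * (\<rho> * measure S {y. immig_lim y = m}) \<le> (\<integral>y. h (x n) (immig_lim y) \<partial>S)" for n
  proof -
    have "0 \<le> h (x n) k" "h (x n) k \<le> 1 * (real k + 1)" for k using h[of "x n" k] x[of n] by auto
    note h' = this
    have fx: "0 \<le> f (x n) k" "f (x n) k \<le> 1 * (real k + 1)" for k using f[of "x n" k] x[of n] by auto
    have x2: "0 < (x n)\<^sup>2" "(x n)\<^sup>2 \<le> 1" using x[of n] by (auto simp: power_le_one)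
    have g1: "0 \<le> (x n)\<^sup>2 * h (x n) k" "(x n)\<^sup>2 * h (x n) k \<le> 1 * (real k + 1)" for k
      using h'[of k] x2 order_trans[OF mult_left_le_one_le[of "h (x n) k" "(x n)\<^sup>2"]] by simp_all
    have "\<not> 0 < \<phi> (x n) m" using large[of "x n" m] x[of n] by auto
    then have fm: "f (x n) m = 0" by (simp add: f_def max_def)
    have "\<phi> (x n) N * \<rho> \<le> f (x n) N * \<rho>" using \<rho> by (intro mult_right_mono) (auto simp: f_def)
    also have "\<dots> \<le> step_mean (f (x n)) m"
      unfolding \<rho>_def N_def by (rule step_mean_pos[OF fx])
    finally have "\<phi> (x n) N * \<rho> * measure S {y. immig_lim y = m} \<le> step_mean (f (x n)) m * measure S {y. immig_lim y = m}"
      by (intro mult_right_mono) auto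
    also have "\<dots> \<le> (\<integral>y. (x n)\<^sup>2 * h (x n) (immig_lim y) \<partial>S)"
      using x[of n] by (intro stationary_atom_bound[where g = "\<lambda>k. (x n)\<^sup>2 * h (x n) k", OF C fx g1 sub fm]) auto
    also have "\<dots> = (x n)\<^sup>2 * (\<integral>y. h (x n) (immig_lim y) \<partial>S)" by simp
    finally have "\<phi> (x n) N * \<rho> * measure S {y. immig_lim y = m} / (x n)\<^sup>2 \<le> (\<integral>y. h (x n) (immig_lim y) \<partial>S)"
      using x2 by (subst pos_divide_le_eq) (simp_all add: mult.commute)
    then show ?thesis by (simp add: mult.assoc)
  qed
  \<comment> \<open>Here the finite mean of the stationary law gives the dominating function: the
    error vanishes after division by \<open>x\<^sup>2\<close>, while the gain at the atom keeps a
    positive limit.\<close>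
  have "(\<lambda>n. \<integral>y. h (x n) (immig_lim y) \<partial>S) \<longlonglongrightarrow> (\<integral>y. 0 \<partial>S)"
  proof (rule integral_dominated_convergence[where w = "\<lambda>y. real (immig_lim y) + 1"])
    show "integrable S (\<lambda>y. real (immig_lim y) + 1)" using AE_immig_bounded(2)[OF C] by simp
    show "AE y in S. (\<lambda>n. h (x n) (immig_lim y)) \<longlonglongrightarrow> 0"
    proof (rule AE_I2)
      fix y
      let ?k = "immig_lim y"
      have "(\<lambda>n. h (x n) ?k) \<longlonglongrightarrow> real ?k * (1 - 1 / ((1 + 0) ^ ?k * (1 + real ?k * 0\<^sup>2)))"
        unfolding h_def by (intro tendsto_intros x0) simp
      then show "(\<lambda>n. h (x n) ?k) \<longlonglongrightarrow> 0" by simp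
    qed
    show "AE y in S. norm (h (x n) (immig_lim y)) \<le> real (immig_lim y) + 1" for n
    proof (rule AE_I2)
      fix y
      show "norm (h (x n) (immig_lim y)) \<le> real (immig_lim y) + 1"
        using h[of "x n" "immig_lim y"] x[of n] by simp
    qed
  qed measurable
  moreover have "(\<lambda>n. \<phi> (x n) N / (x n)\<^sup>2 * (\<rho> * measure S {y. immig_lim y = m})) \<longlonglongrightarrow>
      ?lim * (\<rho> * measure S {y. immig_lim y = m})"
  proof (intro tendsto_mult_right)
    have "(\<lambda>n. ((1 - x n) ^ N - 1 + real N * x n) / (x n)\<^sup>2 - (b * real N + K)) \<longlonglongrightarrow> ?lim"
      using x(1) by (intro tendsto_diff exp_like_limit x0 tendsto_const) (metis less_irrefl)
    moreover have "\<phi> (x n) N / (x n)\<^sup>2 = ((1 - x n) ^ N - 1 + real N * x n) / (x n)\<^sup>2 - (b * real N + K)" for n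
      using x(1)[of n] by (simp add: \<phi>_def diff_divide_distrib)
    ultimately show "(\<lambda>n. \<phi> (x n) N / (x n)\<^sup>2) \<longlonglongrightarrow> ?lim" by simp
  qed
  ultimately have "?lim * (\<rho> * measure S {y. immig_lim y = m}) \<le> (\<integral>y. 0 \<partial>S)"
    using main by (intro LIMSEQ_le) auto
  then show False using lim_pos \<rho> m by (simp add: mult_le_0_iff)
qed

lemma mean_immig_unbounded:
  assumes fail: "0 < measure R {r. succs r M = 0}" and \<delta>: "\<delta> \<le> 2"
  shows "\<exists>n. C < mean_immig n"
proof (rule ccontr)
  assume "\<not> ?thesis"
  then have C: "\<And>n. mean_immig n \<le> C" by (auto simp: not_less)
  show False
  proof (cases "\<delta> \<le> 1")
    case True
    then show ?thesis using mean_immig_unbounded_le_1[OF fail _ C] by simp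
  next
    case False
    then show ?thesis using mean_immig_unbounded_le_2[OF fail _ \<delta> C] by simp
  qed
qed

end

section \<open>From hitting times to the speed\<close>

text \<open>Unit steps exclude overshooting, so the first time at or above level \<open>n\<close> is
  a visit to \<open>n\<close>.\<close>

lemma hitting_time_props:
  assumes "int n \<le> walk c t" "t0 = (LEAST i. int n \<le> walk c i)"
  shows "walk c t0 = int n" "\<And>i. i < t0 \<Longrightarrow> walk c i < int n" "t0 \<le> t"
proof -
  have hit: "int n \<le> walk c t0" unfolding assms(2) by (rule LeastI[of "\<lambda>i. int n \<le> walk c i", OF assms(1)])
  show below: "\<And>i. i < t0 \<Longrightarrow> walk c i < int n"
    using not_less_Least[of _ "\<lambda>i. int n \<le> walk c i"] assms(2) by force
  show "t0 \<le> t" unfolding assms(2) by (rule Least_le[of "\<lambda>i. int n \<le> walk c i", OF assms(1)])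
  show "walk c t0 = int n"
  proof (cases t0)
    case 0
    then show ?thesis using hit by simp
  next
    case (Suc s)
    then have "walk c s < int n" using below by simp
    then have "walk c t0 \<le> int n" using Suc by (auto simp: walk_Suc)
    then show ?thesis using hit by simp
  qed
qed

lemma seq_tl_funpow_rows: "(seq_tl ^^ k) (rows j c) = rows (j + int k) c"
  by (simp add: seq_tl_funpow rows_def fun_eq_iff algebra_simps)

text \<open>Replacing the varying depth \<open>n - k\<close> by a fixed depth \<open>L\<close>, at
  the cost of the last \<open>L\<close> sites, gives a Birkhoff sum.\<close>

lemma sum_immig_ge:
  assumes "L \<le> n"
  shows "(\<Sum>k<n - L. immig L (rows (int k) c)) \<le> (\<Sum>k<n. immig (n - k) (rows (int k) c))"
proof -
  have "(\<Sum>k<n - L. immig L (rows (int k) c)) \<le> (\<Sum>k<n - L. immig (n - k) (rows (int k) c))"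
    by (intro sum_mono immig_mono) auto
  also have "\<dots> \<le> (\<Sum>k<n. immig (n - k) (rows (int k) c))"
    by (intro sum_mono2) auto
  finally show ?thesis .
qed

text \<open>If the walk stands at a high level \<open>n\<close> at time \<open>t\<close>, then
  \<open>t\<close> is at least the hitting time of \<open>n\<close>, which exceeds
  \<open>n / \<epsilon>\<close>. If it stands low, its position is bounded. Whether high levels are
  reached does not have to be known.\<close>

lemma speed_le:
  assumes inf: "\<And>k. infinite {i. c k i}"
    and avg: "(\<lambda>n. (\<Sum>k<n. real (immig L (rows (int k) c))) / real n) \<longlonglongrightarrow> e"
    and \<epsilon>: "0 < \<epsilon>" "1 / \<epsilon> < e"
  shows "eventually (\<lambda>t. real_of_int (walk c t) / real t \<le> \<epsilon>) sequentially"
proof -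
  let ?s = "\<lambda>n. \<Sum>k<n. immig L (rows (int k) c)"
  have "eventually (\<lambda>n. 1 / \<epsilon> < (\<Sum>k<n. real (immig L (rows (int k) c))) / real n) sequentially"
    using avg \<epsilon>(2) by (rule order_tendstoD)
  then obtain N where N: "\<And>n. n \<ge> N \<Longrightarrow> 1 / \<epsilon> < (\<Sum>k<n. real (immig L (rows (int k) c))) / real n"
    by (auto simp: eventually_sequentially)
  \<comment> \<open>\<open>2 * L\<close> gives \<open>n \<le> 2 * (n - L)\<close>, a factor that the
    2 in the hitting time bound pays for. \<open>Suc N + L\<close> puts \<open>n - L\<close> where
    the averages exceed \<open>1 / \<epsilon>\<close>.\<close>
  define N0 where "N0 = max (2 * L) (Suc N + L)"
  have lower: "real_of_int (walk c t) \<le> \<epsilon> * real t" if t: "int N0 \<le> walk c t" for t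
  proof -
    define n where "n = nat (walk c t)"
    have n: "int n = walk c t" "N0 \<le> n" using t by (auto simp: n_def)
    define t0 where "t0 = (LEAST i. int n \<le> walk c i)"
    note h = hitting_time_props[OF eq_refl[OF n(1)] t0_def]
    have nL: "L \<le> n" "N \<le> n - L" "0 < n - L" using n(2) by (auto simp: N0_def)
    have "2 * ?s (n - L) \<le> t0"
      using hitting_time_ge[OF inf h(2,1)] sum_immig_ge[OF nL(1), of c] by linarith
    then have "2 * (\<Sum>k<n - L. real (immig L (rows (int k) c))) \<le> real t"
      using h(3) by (simp flip: of_nat_sum)
    moreover have "real (n - L) / \<epsilon> < (\<Sum>k<n - L. real (immig L (rows (int k) c)))"
      using N[OF nL(2)] nL(3) \<epsilon>(1) by (simp add: field_simps)
    ultimately have "2 * real (n - L) / \<epsilon> \<le> real t" by simp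
    moreover have "real n \<le> 2 * real (n - L)" using n(2) nL(1) by (simp add: N0_def of_nat_diff)
    then have "real n / \<epsilon> \<le> 2 * real (n - L) / \<epsilon>" using \<epsilon>(1) by (intro divide_right_mono) auto
    ultimately have "real n / \<epsilon> \<le> real t" by linarith
    then have "real n \<le> \<epsilon> * real t" using \<epsilon>(1) by (simp add: pos_divide_le_eq mult.commute)
    then show ?thesis using n(1) by (metis of_int_of_nat_eq)
  qed
  obtain t1 :: nat where t1: "real N0 / \<epsilon> < real t1" using reals_Archimedean2 by blast
  show ?thesis unfolding eventually_sequentially
  proof (intro exI[of _ "Suc t1"] allI impI)
    fix t assume t: "Suc t1 \<le> t"
    have "real_of_int (walk c t) \<le> \<epsilon> * real t"
    proof (cases "int N0 \<le> walk c t")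
      case False
      then have "real_of_int (walk c t) \<le> real N0" by linarith
      also have "\<dots> \<le> \<epsilon> * real t1" using t1 \<epsilon>(1) by (simp add: pos_divide_less_eq mult.commute)
      also have "\<dots> \<le> \<epsilon> * real t" using t \<epsilon>(1) by simp
      finally show ?thesis .
    qed (rule lower)
    then show "real_of_int (walk c t) / real t \<le> \<epsilon>" using t by (simp add: pos_divide_le_eq)
  qed
qed

text \<open>With \<open>k t\<close> the last level hit by time \<open>t\<close>, the walk is at most
  \<open>k t\<close> and below that by at most the time since the hit. As \<open>T n / n\<close>
  converges, the gaps \<open>T (Suc n) - T n\<close> are negligible against
  \<open>n\<close>.\<close>

lemma speed_from_hitting_times:
  fixes X :: "nat \<Rightarrow> int"
  assumes step: "\<And>m n. m \<le> n \<Longrightarrow> \<bar>X n - X m\<bar> \<le> int (n - m)"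
    and T: "\<And>n. X (T n) = int n" "\<And>n i. i < T n \<Longrightarrow> X i < int n"
    and lim: "(\<lambda>n. real (T n) / real n) \<longlonglongrightarrow> c" and c: "0 < c" and X0: "X 0 = 0"
  shows "(\<lambda>t. real_of_int (X t) / real t) \<longlonglongrightarrow> 1 / c"
proof -
  have T_less: "T n < T (Suc n)" for n
  proof (rule ccontr)
    assume "\<not> T n < T (Suc n)"
    then have "T (Suc n) < T n \<or> T (Suc n) = T n" by auto
    then show False using T(1)[of n] T(1)[of "Suc n"] T(2)[of "T (Suc n)" n] by auto
  qed
  have T0: "T 0 = 0" using T(2)[of 0 0] X0 by force
  have T_mono: "strict_mono T" using T_less by (simp add: strict_mono_Suc_iff)
  define k where "k t = (GREATEST n. T n \<le> t)" for t
  have k1: "T (k t) \<le> t" for t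
    unfolding k_def
    by (rule GreatestI_nat[of _ 0 t]) (use T0 strict_mono_imp_increasing[OF T_mono] in \<open>auto intro: order_trans\<close>)
  have k2: "t < T (Suc (k t))" for t
  proof (rule ccontr)
    assume "\<not> t < T (Suc (k t))"
    then have "Suc (k t) \<le> k t"
      unfolding k_def[of t]
      by (intro Greatest_le_nat[of _ _ t]) (use strict_mono_imp_increasing[OF T_mono] in \<open>auto intro: order_trans\<close>)
    then show False by simp
  qed
  have k_lim: "filterlim k at_top sequentially"
    unfolding filterlim_at_top
  proof
    fix Z
    show "eventually (\<lambda>t. Z \<le> k t) sequentially"
      unfolding eventually_sequentially
    proof (intro exI[of _ "T Z"] allI impI)
      fix t assume "T Z \<le> t"
      then have "T Z < T (Suc (k t))" using k2[of t] by simp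
      then have "Z < Suc (k t)" using strict_mono_less[OF T_mono] by blast
      then show "Z \<le> k t" by simp
    qed
  qed
  have lim1: "(\<lambda>n. real (T (Suc n)) / real (Suc n)) \<longlonglongrightarrow> c" using lim by (rule LIMSEQ_Suc)
  have ratio: "(\<lambda>n. real n / real (Suc n)) \<longlonglongrightarrow> 1" by (rule LIMSEQ_n_over_Suc_n)
  have up: "(\<lambda>n. real n / real (T n)) \<longlonglongrightarrow> 1 / c"
    using tendsto_inverse[OF lim] c by (simp add: inverse_eq_divide)
  \<comment> \<open>The lower bound expressed in the quotients \<open>T n / n\<close>,
    \<open>T (Suc n) / Suc n\<close> and \<open>n / Suc n\<close>, whose limits are known.\<close>
  let ?l = "\<lambda>n. (real n / real (Suc n) - (real (T (Suc n)) / real (Suc n)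
    - real (T n) / real n * (real n / real (Suc n)))) / (real (T (Suc n)) / real (Suc n))"
  have "?l \<longlonglongrightarrow> (1 - (c - c * 1)) / c"
    using c by (intro tendsto_intros ratio lim lim1) auto
  then have lowlim: "?l \<longlonglongrightarrow> 1 / c" by simp
  have low_eq: "?l n = (real n - (real (T (Suc n)) - real (T n))) / real (T (Suc n))" if "0 < n" for n
  proof -
    have "real (T n) / real n * (real n / real (Suc n)) = real (T n) / real (Suc n)" using that by simp
    moreover have gen: "(a / s - (b / s - d / s)) / (b / s) = (a - (b - d)) / b" if "s \<noteq> 0" for a b d s :: real
      using that by (simp add: diff_divide_distrib[symmetric])
    ultimately show ?thesis by (simp only: gen[of "real (Suc n)"] of_nat_eq_0_iff nat.simps not_False_eq_True)
  qed
  have low: "(\<lambda>n. (real n - (real (T (Suc n)) - real (T n))) / real (T (Suc n))) \<longlonglongrightarrow> 1 / c"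
    by (rule Lim_transform_eventually[OF lowlim])
      (use eventually_gt_at_top[of 0] low_eq in \<open>rule eventually_mono\<close>)
  \<comment> \<open>With a positive numerator the denominator \<open>T (Suc (k t))\<close> may be
    lowered to \<open>t\<close>.\<close>
  have pos: "eventually (\<lambda>n. 0 < (real n - (real (T (Suc n)) - real (T n))) / real (T (Suc n))) sequentially"
    using order_tendstoD(1)[OF low, of 0] c by simp
  show ?thesis
  proof (rule tendsto_sandwich)
    show "(\<lambda>t. (real (k t) - (real (T (Suc (k t))) - real (T (k t)))) / real (T (Suc (k t)))) \<longlonglongrightarrow> 1 / c"
      by (rule filterlim_compose[OF low k_lim])
    show "(\<lambda>t. real (k t) / real (T (k t))) \<longlonglongrightarrow> 1 / c"
      by (rule filterlim_compose[OF up k_lim])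
    have kpos: "eventually (\<lambda>t. 0 < k t) sequentially"
      by (rule eventually_compose_filterlim[OF eventually_gt_at_top[of 0] k_lim])
    have Tpos: "0 < T n" if "0 < n" for n using strict_monoD[OF T_mono that] by simp
    show "eventually (\<lambda>t. real_of_int (X t) / real t \<le> real (k t) / real (T (k t))) sequentially"
      using kpos
    proof eventually_elim
      case (elim t)
      have "X t < int (Suc (k t))" using T(2) k2 by blast
      then have "real_of_int (X t) \<le> real (k t)" by linarith
      then have "real_of_int (X t) / real t \<le> real (k t) / real t" by (intro divide_right_mono) auto
      also have "\<dots> \<le> real (k t) / real (T (k t))" using k1[of t] Tpos[OF elim] by (intro divide_left_mono) auto
      finally show ?case .
    qed
    show "eventually (\<lambda>t. (real (k t) - (real (T (Suc (k t))) - real (T (k t)))) / real (T (Suc (k t)))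
        \<le> real_of_int (X t) / real t) sequentially"
      using kpos eventually_compose_filterlim[OF pos k_lim]
    proof eventually_elim
      case (elim t)
      let ?a = "real (k t) - (real (T (Suc (k t))) - real (T (k t)))"
      have a: "0 < ?a" using elim(2) by (simp add: zero_less_divide_iff)
      have "\<bar>X t - int (k t)\<bar> \<le> int (t - T (k t))" using step[OF k1, of t] T(1) by simp
      then have "int (k t) - int (t - T (k t)) \<le> X t" by linarith
      then have "real_of_int (int (k t) - int (t - T (k t))) \<le> real_of_int (X t)" by (simp only: of_int_le_iff)
      then have "real (k t) - (real t - real (T (k t))) \<le> real_of_int (X t)"
        using k1[of t] by (simp add: of_nat_diff)
      then have x: "?a \<le> real_of_int (X t)" using k2[of t] by linarith
      have t0: "0 < t" using k1[of t] Tpos[OF elim(1)] by simp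
      have "?a / real (T (Suc (k t))) \<le> ?a / real t"
        using a k2[of t] t0 by (intro divide_left_mono) auto
      also have "\<dots> \<le> real_of_int (X t) / real t" using x by (intro divide_right_mono) auto
      finally show ?case .
    qed
  qed
qed

lemma speed_eq:
  assumes inf: "\<And>k. infinite {i. c k i}"
    and avg: "\<And>L. (\<lambda>n. (\<Sum>k<n. real (immig L (rows (int k) c))) / real n) \<longlonglongrightarrow> e L"
    and avgD: "(\<lambda>n. (\<Sum>k<n. real (D (rows (int k) c))) / real n) \<longlonglongrightarrow> e'"
    and e: "e \<longlonglongrightarrow> e'" and e0: "0 \<le> e'"
    and D: "\<And>n k. 0 \<le> k \<Longrightarrow> immig n (rows k c) \<le> D (rows k c)"
    and W: "\<And>t. (\<Sum>j=1..t. no_immig D j (rows (- int j) c)) \<le> W"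
  shows "(\<lambda>t. real_of_int (walk c t) / real t) \<longlonglongrightarrow> 1 / (1 + 2 * e')"
proof -
  define U where "U n = n + 2 * (\<Sum>k<n. D (rows (int k) c)) + 2 * W" for n
  define T where "T n = (LEAST i. int n \<le> walk c i)" for n
  \<comment> \<open>Staying below \<open>n\<close> for \<open>Suc (U n)\<close> steps would
    contradict \<open>time_below_le\<close>, so every level is reached, with an explicit bound on
    the time.\<close>
  have ex: "\<exists>i\<le>U n. int n \<le> walk c i" for n
  proof (rule ccontr)
    assume neg: "\<not> ?thesis"
    then have below: "\<And>i. i < Suc (U n) \<Longrightarrow> walk c i < int n" by (meson less_Suc_eq_le not_le)
    have n: "0 < n"
    proof (rule ccontr)
      assume "\<not> 0 < n"
      then have "int n \<le> walk c 0" by simp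
      then show False using neg by blast
    qed
    have "Suc (U n) \<le> n + 2 * (\<Sum>k<n. D (rows (int k) c)) +
        2 * (\<Sum>j=1..Suc (U n). no_immig D j (rows (- int j) c))"
      by (rule time_below_le[OF inf below D n])
    then show False using W[of "Suc (U n)"] by (simp add: U_def)
  qed
  have T: "walk c (T n) = int n" "\<And>i. i < T n \<Longrightarrow> walk c i < int n" "T n \<le> U n" for n
  proof -
    obtain i where i: "i \<le> U n" "int n \<le> walk c i" using ex by blast
    note h = hitting_time_props[OF i(2) T_def]
    show "walk c (T n) = int n" "\<And>i. i < T n \<Longrightarrow> walk c i < int n" by (fact h)+
    show "T n \<le> U n" using h(3) i(1) by (rule order_trans)
  qed
  have up: "real (T n) / real n \<le> 1 + 2 * ((\<Sum>k<n. real (D (rows (int k) c))) / real n) + 2 * real W / real n"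
    if "0 < n" for n
  proof -
    have "real (T n) \<le> real (U n)" using T(3) by simp
    then have "real (T n) / real n \<le> real (U n) / real n" by (intro divide_right_mono) auto
    also have "\<dots> = 1 + 2 * ((\<Sum>k<n. real (D (rows (int k) c))) / real n) + 2 * real W / real n"
      using that by (simp add: U_def add_divide_distrib)
    finally show ?thesis .
  qed
  have uplim: "(\<lambda>n. 1 + 2 * ((\<Sum>k<n. real (D (rows (int k) c))) / real n) + 2 * real W / real n) \<longlonglongrightarrow> 1 + 2 * e' + 0"
    by (intro tendsto_intros avgD lim_const_over_n)
  have Tlim: "(\<lambda>n. real (T n) / real n) \<longlonglongrightarrow> 1 + 2 * e'"
  proof (rule order_tendstoI)
    fix a assume a: "1 + 2 * e' < a"
    have "eventually (\<lambda>n. 1 + 2 * ((\<Sum>k<n. real (D (rows (int k) c))) / real n) + 2 * real W / real n < a) sequentially"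
      using uplim a by (intro order_tendstoD) auto
    then show "eventually (\<lambda>n. real (T n) / real n < a) sequentially"
      using eventually_gt_at_top[of 0] by eventually_elim (use up in \<open>blast intro: le_less_trans\<close>)
  next
    fix a assume "a < 1 + 2 * e'"
    then have "(a - 1) / 2 < e'" by simp
    with e have "eventually (\<lambda>L. (a - 1) / 2 < e L) sequentially" by (rule order_tendstoD)
    then obtain L where L: "(a - 1) / 2 < e L" by (auto simp: eventually_sequentially)
    let ?s = "\<lambda>n. \<Sum>k<n. real (immig L (rows (int k) c))"
    \<comment> \<open>Level \<open>n + L\<close> has \<open>n\<close> sites with at least
      \<open>L\<close> generations to their right; the factor \<open>n / (n + L)\<close> corrects
      the normalisation.\<close>
    have "(\<lambda>n. 1 + 2 * (?s n / real n * (real n / real (n + L)))) \<longlonglongrightarrow> 1 + 2 * (e L * 1)"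
    proof (intro tendsto_intros avg)
      have "(\<lambda>n. 1 / (1 + real L / real n)) \<longlonglongrightarrow> 1 / (1 + 0)"
        by (intro tendsto_intros lim_const_over_n) auto
      moreover have "eventually (\<lambda>n. 1 / (1 + real L / real n) = real n / real (n + L)) sequentially"
        using eventually_gt_at_top[of 0] by eventually_elim (simp add: field_simps)
      ultimately show "(\<lambda>n. real n / real (n + L)) \<longlonglongrightarrow> 1"
        using Lim_transform_eventually by fastforce
    qed
    then have "eventually (\<lambda>n. a < 1 + 2 * (?s n / real n * (real n / real (n + L)))) sequentially"
      using L by (intro order_tendstoD) auto
    then have "eventually (\<lambda>n. a < real (T (n + L)) / real (n + L)) sequentially"
      using eventually_gt_at_top[of 0]
    proof eventually_elim
      case (elim n)
      have "(n + L) + 2 * (\<Sum>k<n. immig L (rows (int k) c)) \<le> T (n + L)"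
        using hitting_time_ge[OF inf T(2,1), of "n + L"] sum_immig_ge[of L "n + L" c] by simp
      then have "real ((n + L) + 2 * (\<Sum>k<n. immig L (rows (int k) c))) \<le> real (T (n + L))"
        by (simp only: of_nat_le_iff)
      then have "(real (n + L) + 2 * ?s n) / real (n + L) \<le> real (T (n + L)) / real (n + L)"
        by (intro divide_right_mono) auto
      moreover have "(real (n + L) + 2 * ?s n) / real (n + L) = 1 + 2 * (?s n / real n * (real n / real (n + L)))"
        using elim(2) by (simp add: add_divide_distrib del: of_nat_add)
      ultimately show ?case using elim(1) by linarith
    qed
    then show "eventually (\<lambda>n. a < real (T n) / real n) sequentially"
      by (subst (asm) eventually_sequentially_seg[of "\<lambda>n. a < real (T n) / real n" L]) 
  qed
  show ?thesis
    by (rule speed_from_hitting_times[OF abs_walk_diff_le T(1,2) Tlim]) (use e0 in auto)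
qed

section \<open>Speed under the averaged coin law\<close>

context row_law
begin

abbreviation C :: "(int \<Rightarrow> nat \<Rightarrow> bool) measure" where
  "C \<equiv> Pi\<^sub>M UNIV (\<lambda>_. R)"

lemma measurable_rows [measurable]: "rows k \<in> C \<rightarrow>\<^sub>M S"
  unfolding rows_def by (intro measurable_PiM_single') (auto simp: space_PiM)

lemma distr_rows: "distr C S (rows k) = S"
  using distr_PiM_reindex[of UNIV "\<lambda>_. R" "\<lambda>i::nat. k + int i" UNIV] prob_space_axioms
  by (simp add: rows_def[abs_def] restrict_def inj_on_def)

lemma AE_rows: "AE y in S. P y \<Longrightarrow> AE c in C. P (rows k c)"
  by (rule AE_distrD[OF measurable_rows]) (simp only: distr_rows)

lemma AE_C_infinite: "AE c in C. \<forall>k. infinite {i. c k i}"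
proof -
  interpret C: product_prob_space "\<lambda>_. R" "UNIV :: int set" by unfold_locales
  have "AE c in C. infinite {i. c k i}" for k
    using AE_R_infinite by (intro C.AE_component) auto
  then show ?thesis by (intro AE_all_countable[THEN iffD2]) blast
qed

lemma AE_average:
  fixes f :: "(nat \<Rightarrow> nat \<Rightarrow> bool) \<Rightarrow> real"
  assumes "integrable S f"
  shows "AE c in C. (\<lambda>n. (\<Sum>k<n. f (rows (int k) c)) / real n) \<longlonglongrightarrow> (\<integral>y. f y \<partial>S)"
  using AE_rows[OF rows.ergodic_theorem[OF assms], of 0] by (simp add: seq_tl_funpow_rows)

theorem speed_nonpos:
  assumes fail: "0 < measure R {r. succs r M = 0}" and \<delta>: "\<delta> \<le> 2"
  shows "AE c in C. \<forall>\<epsilon>>0. eventually (\<lambda>t. real_of_int (walk c t) / real t \<le> \<epsilon>) sequentially"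
proof -
  have "AE c in C. \<forall>L. (\<lambda>n. (\<Sum>k<n. real (immig L (rows (int k) c))) / real n) \<longlonglongrightarrow> mean_immig L"
    unfolding mean_immig_def by (intro AE_all_countable[THEN iffD2] allI AE_average integrable_immig)
  with AE_C_infinite show ?thesis
  proof eventually_elim
    case (elim c)
    show ?case
    proof (intro allI impI)
      fix \<epsilon> :: real assume "0 < \<epsilon>"
      moreover obtain L where "1 / \<epsilon> < mean_immig L" using mean_immig_unbounded[OF fail \<delta>] by blast
      ultimately show "eventually (\<lambda>t. real_of_int (walk c t) / real t \<le> \<epsilon>) sequentially"
        using elim by (intro speed_le[where c = c and L = L and e = "mean_immig L"]) auto
    qed
  qed
qed

section \<open>Extinction on the negative half-line\<close>

lemma measurable_no_immig [measurable]: "no_immig immig_lim n \<in> S \<rightarrow>\<^sub>M count_space UNIV"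
proof (induction n)
  case 0
  have "no_immig immig_lim 0 = immig_lim" by (simp add: fun_eq_iff)
  then show ?case by (simp add: measurable_immig_lim)
next
  case (Suc n)
  note [measurable] = Suc
  have "no_immig immig_lim (Suc n) = (\<lambda>y. fails_before (y 0) (no_immig immig_lim n (seq_tl y)))"
    by (simp add: fun_eq_iff)
  moreover have "(\<lambda>y. fails_before (y 0) (no_immig immig_lim n (seq_tl y))) \<in> S \<rightarrow>\<^sub>M count_space UNIV"
    by (intro measurable_fails_before_comp measurable_hd_S) measurable
  ultimately show ?case by (simp only:)
qed

text \<open>Both processes start from the stationary population and use the same coins, and
  immigration can only add. The domination provides tightness for the process without
  immigrants.\<close>

lemma AE_no_immig_le:
  assumes B: "\<And>n. mean_immig n \<le> B"
  shows "AE y in S. no_immig immig_lim n y \<le> immig_lim y"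
proof (induction n)
  case (Suc n)
  from AE_seq_tl[OF Suc] AE_immig_lim_rec[OF B] show ?case
    by eventually_elim (simp add: fails_before_mono)
qed simp

text \<open>A surviving population stays below a fixed level with a probability bounded away from
  zero, and from there it dies out in one step with a probability bounded away from zero.\<close>

lemma no_immig_extinct:
  assumes succ: "0 < measure R {r. succs r M = M}" and B: "\<And>n. mean_immig n \<le> B" and \<epsilon>: "0 < \<epsilon>"
  shows "\<exists>n. measure S {y. 1 \<le> no_immig immig_lim n y} < \<epsilon>"
proof (rule ccontr)
  assume "\<not> ?thesis"
  then have ge: "\<epsilon> \<le> measure S {y. 1 \<le> no_immig immig_lim n y}" for n by (auto simp: not_less)
  let ?D = "\<integral>y. real (immig_lim y) \<partial>S"
  have intD: "integrable S (\<lambda>y. real (immig_lim y))" by (rule AE_immig_bounded(2)[OF B])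
  have sets: "{y. P (no_immig immig_lim n y)} \<in> sets S" for P n
    by (rule sets_Collect_UNIV, simp) measurable
  \<comment> \<open>By Markov's inequality the dominating stationary population reaches
    \<open>K\<close> with probability at most \<open>\<epsilon> / 2\<close>.\<close>
  obtain K :: nat where K: "2 * ?D / \<epsilon> < real K" using reals_Archimedean2 by blast
  have "0 \<le> 2 * ?D / \<epsilon>" using \<epsilon> by (simp add: Bochner_Integration.integral_nonneg)
  then have K0: "0 < real K" using K by linarith
  define \<rho> where "\<rho> = measure R {r. fails_before r K = 0}"
  have \<rho>: "0 < \<rho>" "\<rho> \<le> 1" unfolding \<rho>_def using fails_before_zero_pos[OF succ] by auto
  have E: "{r. P (fails_before r k)} \<in> sets R" for k P
    by (rule sets_Collect_UNIV, simp) measurable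
  have large: "measure S {y. K < no_immig immig_lim n y} \<le> \<epsilon> / 2" for n
  proof -
    have mD: "{y \<in> space S. real K \<le> real (immig_lim y)} \<in> sets S" by measurable
    have "measure S {y. K < no_immig immig_lim n y} \<le> measure S {y \<in> space S. real K \<le> real (immig_lim y)}"
      using AE_no_immig_le[OF B, of n] mD sets
      by (intro rows.P.finite_measure_mono_AE) (auto elim!: eventually_mono)
    also have "\<dots> \<le> ?D / real K"
      using K0 intD by (intro integral_Markov_inequality_measure[where A = "{}"]) auto
    also have "\<dots> \<le> \<epsilon> / 2"
      using K K0 \<epsilon> by (simp add: field_simps)
    finally show ?thesis .
  qed
  \<comment> \<open>Survival has probability at least \<open>\<epsilon>\<close>, of which at most
    \<open>\<epsilon> / 2\<close> belongs to populations above \<open>K\<close>. The rest loses at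
    least the fraction \<open>\<rho>\<close>, an amount that is the same in every
    generation.\<close>
  have step: "measure S {y. 1 \<le> no_immig immig_lim (Suc n) y} \<le>
      measure S {y. 1 \<le> no_immig immig_lim n y} - \<rho> * (\<epsilon> / 2)" for n
  proof -
    let ?Z = "no_immig immig_lim n"
    let ?A = "{y. 1 \<le> ?Z y}" and ?B = "{y. 1 \<le> ?Z y \<and> ?Z y \<le> K}"
    have bound: "measure R {r. 1 \<le> fails_before r k} \<le> indicator {1..} k - \<rho> * indicator {1..K} k" for k
    proof (cases "1 \<le> k \<and> k \<le> K")
      case True
      have "{r. 1 \<le> fails_before r k} \<subseteq> space R - {r. fails_before r K = 0}"
        using fails_before_mono[of k K] True by (auto simp: Suc_le_eq) (metis le_zero_eq not_less_zero)
      then have "measure R {r. 1 \<le> fails_before r k} \<le> measure R (space R - {r. fails_before r K = 0})"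
        using sets.compl_sets[OF E[of "\<lambda>j. j = 0" K]] by (intro finite_measure_mono) auto
      also have "\<dots> = 1 - \<rho>" unfolding \<rho>_def using E[of "\<lambda>j. j = 0" K] by (subst prob_compl) auto
      finally show ?thesis using True by simp
    next
      case False
      then show ?thesis by (cases "k = 0") auto
    qed
    have "emeasure S {y. 1 \<le> no_immig immig_lim (Suc n) y} =
        (\<integral>\<^sup>+y. indicator {1..} (fails_before (y 0) (?Z (seq_tl y))) \<partial>S)"
    proof -
      have "emeasure S {y. 1 \<le> no_immig immig_lim (Suc n) y} =
          (\<integral>\<^sup>+y. indicator {y. 1 \<le> no_immig immig_lim (Suc n) y} y \<partial>S)"
        by (rule nn_integral_indicator[symmetric]) (rule sets)
      then show ?thesis by (simp add: indicator_def)
    qed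
    also have "\<dots> = (\<integral>\<^sup>+y. (\<integral>\<^sup>+r. indicator {1..} (fails_before r (?Z y)) \<partial>R) \<partial>S)"
      by (rule nn_integral_S_split) measurable
    also have "\<dots> = (\<integral>\<^sup>+y. emeasure R {r. 1 \<le> fails_before r (?Z y)} \<partial>S)"
    proof (intro nn_integral_cong)
      fix y
      have "emeasure R {r. 1 \<le> fails_before r (?Z y)} =
          (\<integral>\<^sup>+r. indicator {r. 1 \<le> fails_before r (?Z y)} r \<partial>R)"
        by (rule nn_integral_indicator[symmetric]) (rule E)
      then show "(\<integral>\<^sup>+r. indicator {1..} (fails_before r (?Z y)) \<partial>R) =
          emeasure R {r. 1 \<le> fails_before r (?Z y)}"
        by (simp add: indicator_def)
    qed
    also have "\<dots> \<le> (\<integral>\<^sup>+y. ennreal (indicator ?A y - \<rho> * indicator ?B y) \<partial>S)"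
    proof (intro nn_integral_mono)
      fix y
      show "emeasure R {r. 1 \<le> fails_before r (?Z y)} \<le> ennreal (indicator ?A y - \<rho> * indicator ?B y)"
        unfolding emeasure_eq_measure
        using bound[of "?Z y"] by (intro ennreal_leI) (simp add: indicator_def)
    qed
    also have "\<dots> = ennreal (measure S ?A - \<rho> * measure S ?B)"
    proof -
      have iA: "integrable S (indicator ?A :: _ \<Rightarrow> real)" "integrable S (\<lambda>y. \<rho> * indicator ?B y :: real)"
        using sets[of "\<lambda>k. 1 \<le> k" n] sets[of "\<lambda>k. 1 \<le> k \<and> k \<le> K" n]
        by (auto simp: rows.P.emeasure_eq_measure)
      have "(\<integral>\<^sup>+y. ennreal (indicator ?A y - \<rho> * indicator ?B y) \<partial>S) =
          ennreal (\<integral>y. indicator ?A y - \<rho> * indicator ?B y \<partial>S)"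
        using \<rho> by (intro nn_integral_eq_integral Bochner_Integration.integrable_diff iA)
          (auto simp: indicator_def)
      also have "(\<integral>y. indicator ?A y - \<rho> * indicator ?B y \<partial>S) = measure S ?A - \<rho> * measure S ?B"
        using iA sets[of "\<lambda>k. 1 \<le> k" n] sets[of "\<lambda>k. 1 \<le> k \<and> k \<le> K" n]
        by (subst Bochner_Integration.integral_diff) auto
      finally show ?thesis .
    qed
    finally have le: "measure S {y. 1 \<le> no_immig immig_lim (Suc n) y} \<le> measure S ?A - \<rho> * measure S ?B"
    proof -
      assume *: "emeasure S {y. 1 \<le> no_immig immig_lim (Suc n) y} \<le> ennreal (measure S ?A - \<rho> * measure S ?B)"
      have "measure S ?B \<le> measure S ?A"
        using sets[of "\<lambda>k. 1 \<le> k" n] by (intro rows.P.finite_measure_mono) auto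
      then have "\<rho> * measure S ?B \<le> measure S ?A"
        using \<rho> mult_left_le_one_le[of "measure S ?B" \<rho>] by (meson less_imp_le measure_nonneg order_trans)
      then show ?thesis using * unfolding rows.P.emeasure_eq_measure by (subst (asm) ennreal_le_iff) auto
    qed
    have "measure S ?A \<le> measure S ?B + measure S {y. K < ?Z y}"
    proof -
      have "?A \<subseteq> ?B \<union> {y. K < ?Z y}" by auto
      then have "measure S ?A \<le> measure S (?B \<union> {y. K < ?Z y})"
        using sets[of "\<lambda>k. 1 \<le> k \<and> k \<le> K" n] sets[of "\<lambda>k. K < k" n]
        by (intro rows.P.finite_measure_mono) auto
      also have "\<dots> \<le> measure S ?B + measure S {y. K < ?Z y}"
        using sets[of "\<lambda>k. 1 \<le> k \<and> k \<le> K" n] sets[of "\<lambda>k. K < k" n]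
        by (intro measure_Un_le) auto
      finally show ?thesis .
    qed
    then have "\<epsilon> / 2 \<le> measure S ?B" using ge[of n] large[of n] by linarith
    then have "\<rho> * (\<epsilon> / 2) \<le> \<rho> * measure S ?B" using \<rho> by (intro mult_left_mono) auto
    then show ?thesis using le by linarith
  qed
  have decay: "measure S {y. 1 \<le> no_immig immig_lim n y} \<le> 1 - real n * (\<rho> * (\<epsilon> / 2))" for n
  proof (induction n)
    case 0
    show ?case using rows.P.prob_le_1 by simp
  next
    case (Suc n)
    then show ?case using step[of n] by (simp add: distrib_right add_divide_distrib del: no_immig.simps)
  qed
  obtain n :: nat where "1 / (\<rho> * (\<epsilon> / 2)) < real n" using reals_Archimedean2 by blast
  then have "1 < real n * (\<rho> * (\<epsilon> / 2))" using \<rho> \<epsilon> by (subst (asm) pos_divide_less_eq) auto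
  then show False using decay[of n] measure_nonneg[of S "{y. 1 \<le> no_immig immig_lim n y}"] by linarith
qed

lemma no_immig_zero_stays:
  "no_immig D j (rows (- int j) c) = 0 \<Longrightarrow> j \<le> k \<Longrightarrow> no_immig D k (rows (- int k) c) = 0"
proof (induction k)
  case (Suc k)
  show ?case
  proof (cases "j = Suc k")
    case False
    then have "no_immig D k (rows (- int k) c) = 0" using Suc by simp
    then show ?thesis by simp
  qed (use Suc in simp)
qed simp

text \<open>Survival through all generations is less likely than survival through any single one,
  hence a null event. Along one coin array extinction is permanent, so almost surely only finitely
  many terms are nonzero.\<close>

lemma AE_no_immig_sum_bounded:
  assumes succ: "0 < measure R {r. succs r M = M}" and B: "\<And>n. mean_immig n \<le> B"
  shows "AE c in C. \<exists>W. \<forall>t. (\<Sum>j=1..t. no_immig immig_lim j (rows (- int j) c)) \<le> W"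
proof -
  interpret C: product_prob_space "\<lambda>_. R" "UNIV :: int set" by unfold_locales
  let ?Z = "\<lambda>j c. no_immig immig_lim j (rows (- int j) c)"
  have mZ: "(\<lambda>c. ?Z j c) \<in> C \<rightarrow>\<^sub>M count_space UNIV" for j
    by (rule measurable_compose[OF measurable_rows measurable_no_immig])
  have E: "{c\<in>space C. \<forall>j. 1 \<le> ?Z j c} \<in> sets C"
    using mZ by measurable
  have eq: "measure C {c\<in>space C. 1 \<le> ?Z j c} = measure S {y. 1 \<le> no_immig immig_lim j y}" for j
  proof -
    have m: "{y \<in> space S. 1 \<le> no_immig immig_lim j y} \<in> sets S" by measurable
    have "measure S {y. 1 \<le> no_immig immig_lim j y} =
        measure (distr C S (rows (- int j))) {y \<in> space S. 1 \<le> no_immig immig_lim j y}"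
      by (simp add: distr_rows)
    also have "\<dots> = measure C (rows (- int j) -` {y \<in> space S. 1 \<le> no_immig immig_lim j y} \<inter> space C)"
      by (rule measure_distr[OF measurable_rows m])
    also have "rows (- int j) -` {y \<in> space S. 1 \<le> no_immig immig_lim j y} \<inter> space C = {c\<in>space C. 1 \<le> ?Z j c}"
      by auto
    finally show ?thesis by simp
  qed
  have "measure C {c\<in>space C. \<forall>j. 1 \<le> ?Z j c} \<le> 0"
  proof (rule field_le_epsilon)
    fix e :: real assume "0 < e"
    then obtain n where n: "measure S {y. 1 \<le> no_immig immig_lim n y} < e"
      using no_immig_extinct[OF succ B] by blast
    have "measure C {c\<in>space C. \<forall>j. 1 \<le> ?Z j c} \<le> measure C {c\<in>space C. 1 \<le> ?Z n c}"
      using mZ by (intro C.P.finite_measure_mono) (auto intro: measurable)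
    then show "measure C {c\<in>space C. \<forall>j. 1 \<le> ?Z j c} \<le> 0 + e" using n eq[of n] by simp
  qed
  then have "emeasure C {c\<in>space C. \<forall>j. 1 \<le> ?Z j c} = 0"
    by (simp add: C.P.emeasure_eq_measure measure_le_0_iff)
  then have "AE c in C. \<not> (\<forall>j. 1 \<le> ?Z j c)"
    using E by (intro AE_I[of _ _ "{c\<in>space C. \<forall>j. 1 \<le> ?Z j c}"]) auto
  then show ?thesis
  proof eventually_elim
    case (elim c)
    then obtain j where j: "?Z j c = 0" by (auto simp: not_le)
    have "(\<Sum>i=1..t. ?Z i c) \<le> (\<Sum>i\<le>j. ?Z i c)" for t
    proof -
      have "(\<Sum>i=1..t. ?Z i c) = (\<Sum>i\<in>{1..t} \<inter> {..j}. ?Z i c)"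
        using no_immig_zero_stays[OF j] by (intro sum.mono_neutral_right) (auto simp: not_le)
      also have "\<dots> \<le> (\<Sum>i\<le>j. ?Z i c)" by (intro sum_mono2) auto
      finally show ?thesis .
    qed
    then show ?case by blast
  qed
qed

theorem speed_pos:
  assumes succ: "0 < measure R {r. succs r M = M}" and \<delta>: "2 < \<delta>"
  shows "\<exists>v. 0 < v \<and> v \<le> 1 \<and> (AE c in C. (\<lambda>t. real_of_int (walk c t) / real t) \<longlonglongrightarrow> v)"
proof -
  note B = mean_immig_bounded[OF \<delta>]
  let ?e = "\<integral>y. real (immig_lim y) \<partial>S"
  have e0: "0 \<le> ?e" by (intro Bochner_Integration.integral_nonneg) simp
  have avg: "AE c in C. \<forall>L. (\<lambda>n. (\<Sum>k<n. real (immig L (rows (int k) c))) / real n) \<longlonglongrightarrow> mean_immig L"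
    unfolding mean_immig_def by (intro AE_all_countable[THEN iffD2] allI AE_average integrable_immig)
  have avgD: "AE c in C. (\<lambda>n. (\<Sum>k<n. real (immig_lim (rows (int k) c))) / real n) \<longlonglongrightarrow> ?e"
    by (rule AE_average[OF AE_immig_bounded(2)[OF B]])
  have bdd: "AE c in C. \<forall>k. \<exists>K. \<forall>n. immig n (rows k c) \<le> K"
    by (intro AE_all_countable[THEN iffD2] allI AE_rows AE_immig_bounded(1)[OF B])
  have "AE c in C. (\<lambda>t. real_of_int (walk c t) / real t) \<longlonglongrightarrow> 1 / (1 + 2 * ?e)"
    using AE_C_infinite avg avgD bdd AE_no_immig_sum_bounded[OF succ B]
  proof eventually_elim
    case (elim c)
    then obtain W where W: "\<And>t. (\<Sum>j=1..t. no_immig immig_lim j (rows (- int j) c)) \<le> W" by blast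
    have D: "immig n (rows k c) \<le> immig_lim (rows k c)" for n k
      using elim(4) immig_le_lim by blast
    show ?case
      by (rule speed_eq[where D = immig_lim and e = mean_immig, OF _ _ elim(3) AE_immig_bounded(3)[OF B] e0 D W])
        (use elim in auto)
  qed
  moreover have "0 < 1 / (1 + 2 * e) \<and> 1 / (1 + 2 * e) \<le> 1" if "0 \<le> e" for e :: real
    using that by (simp add: divide_le_eq_1)
  ultimately show ?thesis using e0 by blast
qed

end

section \<open>Coins from a random cookie environment\<close>

text \<open>The index map is the identity when uniform variables are turned into coins or coins are
  negated, and the sign change of the sites when the walk is reflected.\<close>

lemma distr_PiM_map:
  fixes f :: "'a \<Rightarrow> 'b" and \<pi> :: "'i \<Rightarrow> 'i"
  assumes N: "prob_space N" and f: "f \<in> N \<rightarrow>\<^sub>M N'" and \<pi>: "inj \<pi>"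
  shows "distr (Pi\<^sub>M UNIV (\<lambda>_. N)) (Pi\<^sub>M UNIV (\<lambda>_. N')) (\<lambda>x i. f (x (\<pi> i))) =
    Pi\<^sub>M UNIV (\<lambda>_. distr N N' f)"
proof -
  interpret N: prob_space N by (rule N)
  interpret D: prob_space "distr N N' f" by (rule N.prob_space_distr[OF f])
  interpret Ns: product_prob_space "\<lambda>_. N" "UNIV :: 'i set" by unfold_locales
  interpret Ds: product_prob_space "\<lambda>_. distr N N' f" "UNIV :: 'i set" by unfold_locales
  have m: "(\<lambda>x i. f (x (\<pi> i))) \<in> Pi\<^sub>M UNIV (\<lambda>_. N) \<rightarrow>\<^sub>M Pi\<^sub>M UNIV (\<lambda>_. N')"
  proof (rule measurable_PiM_single')
    show "(\<lambda>x. f (x (\<pi> i))) \<in> Pi\<^sub>M UNIV (\<lambda>_. N) \<rightarrow>\<^sub>M N'" for i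
      by (rule measurable_compose[OF _ f]) (rule measurable_component_singleton, simp)
  qed (use measurable_space[OF f] in \<open>auto simp: space_PiM PiE_iff\<close>)
  have sets: "sets (Pi\<^sub>M UNIV (\<lambda>_::'i. distr N N' f)) = sets (Pi\<^sub>M UNIV (\<lambda>_. N'))"
    by (intro sets_PiM_cong) auto
  show ?thesis
  proof (rule Ds.PiM_eq)
    fix J :: "'i set" and F
    assume J: "finite J" "J \<subseteq> UNIV" "\<And>j. j \<in> J \<Longrightarrow> F j \<in> sets (distr N N' f)"
    let ?X = "prod_emb UNIV (\<lambda>_. distr N N' f) J (\<Pi>\<^sub>E j\<in>J. F j)"
    let ?G = "\<lambda>j. f -` F j \<inter> space N"
    have inv: "inv \<pi> (\<pi> j) = j" for j using \<pi> by simp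
    have G: "?G j \<in> sets N" if "j \<in> J" for j using J(3)[OF that] f by auto
    have "?X \<in> sets (Pi\<^sub>M UNIV (\<lambda>_. distr N N' f))" using J by (intro sets_PiM_I) auto
    then have X: "?X \<in> sets (Pi\<^sub>M UNIV (\<lambda>_. N'))" by (simp only: sets)
    have "emeasure (distr (Pi\<^sub>M UNIV (\<lambda>_. N)) (Pi\<^sub>M UNIV (\<lambda>_. N')) (\<lambda>x i. f (x (\<pi> i)))) ?X =
        emeasure (Pi\<^sub>M UNIV (\<lambda>_. N)) ((\<lambda>x i. f (x (\<pi> i))) -` ?X \<inter> space (Pi\<^sub>M UNIV (\<lambda>_. N)))"
      by (rule emeasure_distr[OF m X])
    also have "(\<lambda>x i. f (x (\<pi> i))) -` ?X \<inter> space (Pi\<^sub>M UNIV (\<lambda>_. N)) =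
        {x\<in>space (Pi\<^sub>M UNIV (\<lambda>_. N)). \<forall>i\<in>\<pi> ` J. x i \<in> ?G (inv \<pi> i)}"
      using measurable_space[OF f] by (auto simp: prod_emb_def PiE_iff space_PiM inv)
    also have "emeasure (Pi\<^sub>M UNIV (\<lambda>_. N)) \<dots> = (\<Prod>i\<in>\<pi> ` J. emeasure N (?G (inv \<pi> i)))"
      using J G by (intro Ns.emeasure_PiM_Collect) (auto simp: inv)
    also have "\<dots> = (\<Prod>j\<in>J. emeasure N (?G j))"
      using \<pi> by (subst prod.reindex) (auto simp: inv intro: inj_on_subset)
    also have "\<dots> = (\<Prod>j\<in>J. emeasure (distr N N' f) (F j))"
      using J(3) f by (intro prod.cong refl emeasure_distr[symmetric]) auto
    finally show "emeasure (distr (Pi\<^sub>M UNIV (\<lambda>_. N)) (Pi\<^sub>M UNIV (\<lambda>_. N')) (\<lambda>x i. f (x (\<pi> i)))) ?X =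
        (\<Prod>j\<in>J. emeasure (distr N N' f) (F j))" .
  qed (simp add: sets)
qed

lemma row_lawI:
  assumes R: "prob_space R" and sR: "sets R = sets row_space"
    and tail: "\<And>A. A \<in> sets row_space \<Longrightarrow>
      (\<integral>\<^sup>+a. (\<integral>\<^sup>+b. indicator A (comb_seq M a b) \<partial>fair) \<partial>R) = emeasure R A"
  shows "row_law R M"
proof -
  interpret R: prob_space R by (rule R)
  have m: "(\<lambda>(a, b). comb_seq M a b) \<in> R \<Otimes>\<^sub>M fair \<rightarrow>\<^sub>M row_space"
    using measurable_comb_seq[of M "count_space UNIV :: bool measure"]
      measurable_cong_sets[OF sets_pair_measure_cong[OF sR sets_fair] refl] by blast
  have "distr (R \<Otimes>\<^sub>M fair) row_space (\<lambda>(a, b). comb_seq M a b) = R"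
  proof (rule measure_eqI)
    fix A assume "A \<in> sets (distr (R \<Otimes>\<^sub>M fair) row_space (\<lambda>(a, b). comb_seq M a b))"
    then have A: "A \<in> sets row_space" by simp
    then have iA: "indicator A \<in> borel_measurable row_space" by simp
    have "emeasure (distr (R \<Otimes>\<^sub>M fair) row_space (\<lambda>(a, b). comb_seq M a b)) A =
        (\<integral>\<^sup>+r. indicator A r \<partial>distr (R \<Otimes>\<^sub>M fair) row_space (\<lambda>(a, b). comb_seq M a b))"
      by (rule nn_integral_indicator[symmetric]) (use A in simp)
    also have "\<dots> = (\<integral>\<^sup>+x. indicator A (case x of (a, b) \<Rightarrow> comb_seq M a b) \<partial>(R \<Otimes>\<^sub>M fair))"
      by (rule nn_integral_distr[OF m]) (use A in simp)
    also have "\<dots> = (\<integral>\<^sup>+a. (\<integral>\<^sup>+b. indicator A (comb_seq M a b) \<partial>fair) \<partial>R)"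
      using fair.nn_integral_fst[OF measurable_compose[OF m iA]] by simp
    also have "\<dots> = emeasure R A" by (rule tail[OF A])
    finally show "emeasure (distr (R \<Otimes>\<^sub>M fair) row_space (\<lambda>(a, b). comb_seq M a b)) A = emeasure R A" .
  qed (simp add: sR)
  then show ?thesis using sR by unfold_locales auto
qed

lemma borel_measurable_fair_comb_seq:
  assumes A: "A \<in> sets row_space"
  shows "(\<lambda>a. \<integral>\<^sup>+b. indicator A (comb_seq M a b) \<partial>fair) \<in> borel_measurable row_space"
    and "(\<lambda>b. indicator A (comb_seq M a b) :: ennreal) \<in> borel_measurable fair"
proof -
  have m: "(\<lambda>(a, b). comb_seq M a b) \<in> row_space \<Otimes>\<^sub>M fair \<rightarrow>\<^sub>M row_space"
    using measurable_comb_seq[of M "count_space UNIV :: bool measure"]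
      measurable_cong_sets[OF sets_pair_measure_cong[OF refl sets_fair] refl] by blast
  have iA: "(\<lambda>x. indicator A (case x of (a, b) \<Rightarrow> comb_seq M a b) :: ennreal) \<in> borel_measurable (row_space \<Otimes>\<^sub>M fair)"
    by (rule measurable_compose[OF m]) (use A in simp)
  show "(\<lambda>a. \<integral>\<^sup>+b. indicator A (comb_seq M a b) \<partial>fair) \<in> borel_measurable row_space"
    using fair.borel_measurable_nn_integral_fst[OF iA] by simp
  show "(\<lambda>b. indicator A (comb_seq M a b) :: ennreal) \<in> borel_measurable fair"
    using measurable_compose[OF measurable_Pair1'[of a row_space fair] iA] by simp
qed

text \<open>Coins arise by comparing cookies with independent uniform variables. The randomness
  besides the environment then has one law for all environments, so environment and coins live on a
  product measure.\<close>

definition unit_unif :: "real measure" where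
  "unit_unif = uniform_measure lborel {0..1}"

lemma sets_unit_unif [measurable_cong, simp]: "sets unit_unif = sets borel"
  by (simp add: unit_unif_def)

lemma space_unit_unif [simp]: "space unit_unif = UNIV"
  by (simp add: unit_unif_def)

lemma prob_space_unit_unif: "prob_space unit_unif"
  unfolding unit_unif_def by (rule prob_space_uniform_measure) auto

lemma emeasure_unit_unif_le:
  assumes "0 \<le> p" "p \<le> 1"
  shows "emeasure unit_unif {x. (x \<le> p) = e} = ennreal (if e then p else 1 - p)"
proof (cases e)
  case True
  have "{0..1} \<inter> {x. x \<le> p} = {0..p}" using assms by auto
  then show ?thesis using assms True divide_ennreal[of p 1] by (simp add: unit_unif_def)
next
  case False
  have "{0..1} \<inter> {x. \<not> x \<le> p} = {p<..1}" using assms by auto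
  then show ?thesis using assms False divide_ennreal[of "1 - p" 1] by (simp add: unit_unif_def)
qed

definition unif_row :: "(nat \<Rightarrow> real) measure" where
  "unif_row = Pi\<^sub>M UNIV (\<lambda>_. unit_unif)"

definition unif_array :: "(int \<Rightarrow> nat \<Rightarrow> real) measure" where
  "unif_array = Pi\<^sub>M UNIV (\<lambda>_. unif_row)"

interpretation unit_unif: prob_space unit_unif by (rule prob_space_unit_unif)

interpretation unif_seq: sequence_space unit_unif by unfold_locales

lemma unif_row_prob: "prob_space unif_row"
  unfolding unif_row_def by (rule unif_seq.P.prob_space_axioms)

interpretation unif_row: prob_space unif_row by (rule unif_row_prob)

interpretation unif_rows: product_prob_space "\<lambda>_. unif_row" "UNIV :: int set" by unfold_locales

lemma unif_array_prob: "prob_space unif_array"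
  unfolding unif_array_def by (rule unif_rows.P.prob_space_axioms)

interpretation unif_array: prob_space unif_array by (rule unif_array_prob)

lemma space_unif_row [simp]: "space unif_row = UNIV"
  by (simp add: unif_row_def space_PiM)

lemma space_unif_array [simp]: "space unif_array = UNIV"
  by (simp add: unif_array_def space_PiM)

lemma measurable_unif_row_nth [measurable]: "(\<lambda>v. v i) \<in> unif_row \<rightarrow>\<^sub>M borel"
proof -
  have "(\<lambda>v. v i) \<in> unif_row \<rightarrow>\<^sub>M unit_unif" unfolding unif_row_def by measurable
  then show ?thesis by (simp cong: measurable_cong_sets)
qed

lemma measurable_unif_array_nth [measurable]: "(\<lambda>u. u z) \<in> unif_array \<rightarrow>\<^sub>M unif_row"
  unfolding unif_array_def by measurable

text \<open>Coins are numbered from 0, cookies from 1.\<close>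

definition coin_row :: "(nat \<Rightarrow> real) \<Rightarrow> (nat \<Rightarrow> real) \<Rightarrow> nat \<Rightarrow> bool" where
  "coin_row w v i \<longleftrightarrow> v i \<le> w (Suc i)"

definition coins :: "(int \<Rightarrow> nat \<Rightarrow> real) \<Rightarrow> (int \<Rightarrow> nat \<Rightarrow> real) \<Rightarrow> int \<Rightarrow> nat \<Rightarrow> bool" where
  "coins \<omega> u z = coin_row (\<omega> z) (u z)"

lemma measurable_cookie_row_nth: "(\<lambda>w. w (Suc i)) \<in> cookie_row \<rightarrow>\<^sub>M borel"
  unfolding cookie_row_def by (rule measurable_component_singleton) simp

lemma measurable_coin_row:
  "(\<lambda>(w, v). coin_row w v) \<in> cookie_row \<Otimes>\<^sub>M unif_row \<rightarrow>\<^sub>M row_space"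
proof (rule measurable_PiM_single')
  fix i
  have [measurable]: "(\<lambda>x. fst x (Suc i)) \<in> cookie_row \<Otimes>\<^sub>M unif_row \<rightarrow>\<^sub>M borel"
    using measurable_compose[OF measurable_fst measurable_cookie_row_nth] .
  have "Measurable.pred (cookie_row \<Otimes>\<^sub>M unif_row) (\<lambda>x. snd x i \<le> fst x (Suc i))"
    by measurable
  then show "(\<lambda>x. (case x of (w, v) \<Rightarrow> coin_row w v) i) \<in> cookie_row \<Otimes>\<^sub>M unif_row \<rightarrow>\<^sub>M count_space UNIV"
    by (simp add: case_prod_beta' coin_row_def)
qed auto

lemma measurable_coin_row2: "coin_row w \<in> unif_row \<rightarrow>\<^sub>M row_space"
proof (rule measurable_PiM_single')
  fix i
  have "Measurable.pred unif_row (\<lambda>v. v i \<le> w (Suc i))" by measurable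
  then show "(\<lambda>v. coin_row w v i) \<in> unif_row \<rightarrow>\<^sub>M count_space UNIV" by (simp add: coin_row_def)
qed auto

lemma emeasure_coin_row_cylinder:
  assumes J: "finite J" and w: "\<And>i. i \<in> J \<Longrightarrow> 0 \<le> w (Suc i) \<and> w (Suc i) \<le> 1"
  shows "emeasure unif_row {v. \<forall>i\<in>J. coin_row w v i = e i} =
    ennreal (\<Prod>i\<in>J. if e i then w (Suc i) else 1 - w (Suc i))"
proof -
  have "emeasure unif_row {v. \<forall>i\<in>J. coin_row w v i = e i} =
      emeasure unif_row {v\<in>space unif_row. \<forall>i\<in>J. v i \<in> {x. (x \<le> w (Suc i)) = e i}}"
    by (simp add: coin_row_def)
  also have "\<dots> = (\<Prod>i\<in>J. emeasure unit_unif {x. (x \<le> w (Suc i)) = e i})"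
    unfolding unif_row_def using J by (intro unif_seq.emeasure_PiM_Collect) auto
  also have "\<dots> = (\<Prod>i\<in>J. ennreal (if e i then w (Suc i) else 1 - w (Suc i)))"
    using w by (intro prod.cong refl emeasure_unit_unif_le) auto
  also have "\<dots> = ennreal (\<Prod>i\<in>J. if e i then w (Suc i) else 1 - w (Suc i))"
    using w by (intro prod_ennreal) auto
  finally show ?thesis .
qed

lemma distr_unif_row_half: "distr unif_row row_space (\<lambda>v i. v i \<le> 1 / 2) = fair"
proof -
  have m: "(\<lambda>x. x \<le> 1 / 2) \<in> unit_unif \<rightarrow>\<^sub>M count_space UNIV" by measurable
  have "distr unit_unif (count_space UNIV) (\<lambda>x. x \<le> 1 / 2) = coin"
  proof (rule measure_eqI_countable[of _ UNIV])
    fix a :: bool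
    have "emeasure (distr unit_unif (count_space UNIV) (\<lambda>x. x \<le> 1 / 2)) {a} =
        emeasure unit_unif {x. (x \<le> 1 / 2) = a}"
      by (subst emeasure_distr[OF m]) (auto intro!: arg_cong[of _ _ "emeasure unit_unif"])
    also have "\<dots> = emeasure coin {a}"
      by (subst emeasure_unit_unif_le) (auto simp: emeasure_pmf_single)
    finally show "emeasure (distr unit_unif (count_space UNIV) (\<lambda>x. x \<le> 1 / 2)) {a} = emeasure coin {a}" .
  qed auto
  then show ?thesis
    using distr_PiM_map[OF prob_space_unit_unif m, of "\<lambda>i::nat. i"] by (simp add: unif_row_def fair_def)
qed

section \<open>The averaged law of the coins\<close>

locale cookie_law =
  fixes M :: nat and P :: "(int \<Rightarrow> nat \<Rightarrow> real) measure"
  assumes env: "env_law M P" and iid: "iid_sites P"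
begin

sublocale prob_space P
  using env by (simp add: env_law_def)

lemma sets_P [measurable_cong]: "sets P = sets (env_space M)"
  using env by (simp add: env_law_def)

lemma space_P: "\<omega> \<in> space P \<Longrightarrow> \<omega> \<in> cookie_envs M"
  using sets_eq_imp_space_eq[OF sets_P] by (auto simp: env_space_def space_restrict_space)

lemma measurable_site: "(\<lambda>\<omega>. \<omega> z) \<in> P \<rightarrow>\<^sub>M cookie_row"
proof -
  have "(\<lambda>\<omega>. \<omega> z) \<in> env_space M \<rightarrow>\<^sub>M cookie_row"
    unfolding env_space_def by (intro measurable_restrict_space1 measurable_component_singleton) simp
  then show ?thesis by (simp cong: measurable_cong_sets add: measurable_cong_sets[OF sets_P refl])
qed

lemma env_bounds:
  assumes "\<omega> \<in> space P"
  shows "0 \<le> \<omega> z (Suc i)" "\<omega> z (Suc i) \<le> 1" "M \<le> i \<Longrightarrow> \<omega> z (Suc i) = 1 / 2"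
proof -
  have \<omega>: "(\<forall>i\<in>{1..M}. \<omega> z i \<in> {0..1}) \<and> (\<forall>i>M. \<omega> z i = 1 / 2)"
    using space_P[OF assms] by (simp add: cookie_envs_def)
  show half: "M \<le> i \<Longrightarrow> \<omega> z (Suc i) = 1 / 2" using \<omega> by simp
  have "\<omega> z (Suc i) \<in> {0..1}"
  proof (cases "M \<le> i")
    case False
    then have "Suc i \<in> {1..M}" by simp
    with \<omega> show ?thesis by blast
  qed (use half in simp)
  then show "0 \<le> \<omega> z (Suc i)" "\<omega> z (Suc i) \<le> 1" by auto
qed

definition \<rho> :: "(nat \<Rightarrow> real) measure" where
  "\<rho> = distr P cookie_row (\<lambda>\<omega>. \<omega> 0)"

lemma \<rho>_site: "distr P cookie_row (\<lambda>\<omega>. \<omega> z) = \<rho>"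
  using iid by (simp add: iid_sites_def \<rho>_def)

lemma prob_\<rho>: "prob_space \<rho>"
  unfolding \<rho>_def by (intro prob_space_distr measurable_site)

lemma sets_\<rho> [measurable_cong, simp]: "sets \<rho> = sets cookie_row"
  by (simp add: \<rho>_def)

text \<open>The law of one row of coins averaged over the cookies. Given the cookies the coins are
  independent; after averaging the first \<open>M\<close> of them need not be.\<close>

definition R :: "(nat \<Rightarrow> bool) measure" where
  "R = distr (\<rho> \<Otimes>\<^sub>M unif_row) row_space (\<lambda>(w, v). coin_row w v)"

lemma measurable_coin_row_\<rho>: "(\<lambda>(w, v). coin_row w v) \<in> \<rho> \<Otimes>\<^sub>M unif_row \<rightarrow>\<^sub>M row_space"
  using measurable_coin_row measurable_cong_sets[OF sets_pair_measure_cong[OF sets_\<rho> refl] refl] by blast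

lemma prob_R: "prob_space R"
proof -
  interpret \<rho>: prob_space \<rho> by (rule prob_\<rho>)
  interpret pair_prob_space \<rho> unif_row by unfold_locales
  show ?thesis unfolding R_def by (rule prob_space_distr[OF measurable_coin_row_\<rho>])
qed

lemma nn_integral_R:
  assumes f: "f \<in> borel_measurable row_space"
  shows "(\<integral>\<^sup>+r. f r \<partial>R) = (\<integral>\<^sup>+\<omega>. (\<integral>\<^sup>+v. f (coin_row (\<omega> z) v) \<partial>unif_row) \<partial>P)"
proof -
  have m: "(\<lambda>x. f (case x of (w, v) \<Rightarrow> coin_row w v)) \<in> borel_measurable (\<rho> \<Otimes>\<^sub>M unif_row)"
    by (rule measurable_compose[OF measurable_coin_row_\<rho> f])
  have "(\<integral>\<^sup>+r. f r \<partial>R) = (\<integral>\<^sup>+x. f (case x of (w, v) \<Rightarrow> coin_row w v) \<partial>(\<rho> \<Otimes>\<^sub>M unif_row))"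
    unfolding R_def by (rule nn_integral_distr[OF measurable_coin_row_\<rho>]) (use f in simp)
  also have "\<dots> = (\<integral>\<^sup>+w. (\<integral>\<^sup>+v. f (coin_row w v) \<partial>unif_row) \<partial>\<rho>)"
    using unif_row.nn_integral_fst[OF m] by simp
  also have "\<dots> = (\<integral>\<^sup>+w. (\<integral>\<^sup>+v. f (coin_row w v) \<partial>unif_row) \<partial>distr P cookie_row (\<lambda>\<omega>. \<omega> z))"
    by (simp only: \<rho>_site)
  also have "\<dots> = (\<integral>\<^sup>+\<omega>. (\<integral>\<^sup>+v. f (coin_row (\<omega> z) v) \<partial>unif_row) \<partial>P)"
  proof (rule nn_integral_distr[OF measurable_site])
    have "(\<lambda>x. \<integral>\<^sup>+v. f (case (x, v) of (w, v) \<Rightarrow> coin_row w v) \<partial>unif_row) \<in> borel_measurable \<rho>"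
      by (rule unif_row.borel_measurable_nn_integral_fst[OF m])
    then show "(\<lambda>w. \<integral>\<^sup>+v. f (coin_row w v) \<partial>unif_row) \<in> borel_measurable (distr P cookie_row (\<lambda>\<omega>. \<omega> z))"
      by (simp add: \<rho>_site)
  qed
  finally show ?thesis .
qed

lemma emeasure_R_cylinder:
  assumes J: "finite J"
  shows "emeasure R {r. \<forall>i\<in>J. r i = e i} =
    (\<integral>\<^sup>+\<omega>. ennreal (\<Prod>i\<in>J. if e i then \<omega> 0 (Suc i) else 1 - \<omega> 0 (Suc i)) \<partial>P)"
proof -
  have E: "{r. \<forall>i\<in>J. r i = e i} \<in> sets row_space"
    by (rule sets_Collect_UNIV, simp) (use J in measurable)
  have "emeasure R {r. \<forall>i\<in>J. r i = e i} = (\<integral>\<^sup>+r. indicator {r. \<forall>i\<in>J. r i = e i} r \<partial>R)"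
    by (rule nn_integral_indicator[symmetric]) (use E in \<open>simp add: R_def\<close>)
  also have "\<dots> = (\<integral>\<^sup>+\<omega>. (\<integral>\<^sup>+v. indicator {r. \<forall>i\<in>J. r i = e i} (coin_row (\<omega> 0) v) \<partial>unif_row) \<partial>P)"
    by (rule nn_integral_R) (use E in simp)
  also have "\<dots> = (\<integral>\<^sup>+\<omega>. ennreal (\<Prod>i\<in>J. if e i then \<omega> 0 (Suc i) else 1 - \<omega> 0 (Suc i)) \<partial>P)"
  proof (intro nn_integral_cong)
    fix \<omega> assume \<omega>: "\<omega> \<in> space P"
    have m: "{v. \<forall>i\<in>J. coin_row (\<omega> 0) v i = e i} \<in> sets unif_row"
      using measurable_sets[OF measurable_coin_row2 E, of "\<omega> 0"] by (simp add: vimage_def)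
    have "(\<integral>\<^sup>+v. indicator {r. \<forall>i\<in>J. r i = e i} (coin_row (\<omega> 0) v) \<partial>unif_row) =
        (\<integral>\<^sup>+v. indicator {v. \<forall>i\<in>J. coin_row (\<omega> 0) v i = e i} v \<partial>unif_row)"
      by (intro nn_integral_cong) (auto simp: indicator_def)
    also have "\<dots> = emeasure unif_row {v. \<forall>i\<in>J. coin_row (\<omega> 0) v i = e i}"
      by (rule nn_integral_indicator[OF m])
    also have "\<dots> = ennreal (\<Prod>i\<in>J. if e i then \<omega> 0 (Suc i) else 1 - \<omega> 0 (Suc i))"
      using env_bounds[OF \<omega>] by (intro emeasure_coin_row_cylinder J) auto
    finally show "(\<integral>\<^sup>+v. indicator {r. \<forall>i\<in>J. r i = e i} (coin_row (\<omega> 0) v) \<partial>unif_row) =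
      ennreal (\<Prod>i\<in>J. if e i then \<omega> 0 (Suc i) else 1 - \<omega> 0 (Suc i))" .
  qed
  finally show ?thesis .
qed

text \<open>From index \<open>M\<close> on all cookies equal \<open>1 / 2\<close>, so these coins
  depend on the uniform variables alone. Splicing two independent uniform rows at \<open>M\<close>
  reproduces the uniform law and redraws just these coins.\<close>

lemma row_law_R: "row_law R M"
proof (rule row_lawI[OF prob_R])
  show sR: "sets R = sets row_space" by (simp add: R_def)
  fix A assume A: "A \<in> sets row_space"
  let ?h = "\<lambda>v i. v i \<le> (1 / 2 :: real)"
  have hm: "?h \<in> unif_row \<rightarrow>\<^sub>M row_space"
    using measurable_coin_row2[of "\<lambda>_. 1 / 2"] by (simp add: coin_row_def[abs_def])
  have iA: "indicator A \<in> borel_measurable row_space" using A by simp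
  have "(\<integral>\<^sup>+a. (\<integral>\<^sup>+b. indicator A (comb_seq M a b) \<partial>fair) \<partial>R) =
      (\<integral>\<^sup>+\<omega>. (\<integral>\<^sup>+v. (\<integral>\<^sup>+b. indicator A (comb_seq M (coin_row (\<omega> 0) v) b) \<partial>fair) \<partial>unif_row) \<partial>P)"
    by (rule nn_integral_R[OF borel_measurable_fair_comb_seq(1)[OF A]])
  also have "\<dots> = (\<integral>\<^sup>+\<omega>. (\<integral>\<^sup>+v. indicator A (coin_row (\<omega> 0) v) \<partial>unif_row) \<partial>P)"
  proof (rule nn_integral_cong)
    fix \<omega> assume \<omega>: "\<omega> \<in> space P"
    let ?g = "\<lambda>v. indicator A (coin_row (\<omega> 0) v) :: ennreal"
    have g: "?g \<in> borel_measurable unif_row" by (rule measurable_compose[OF measurable_coin_row2 iA])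
    have cm: "(\<lambda>(v, v'). comb_seq M v v') \<in> unif_row \<Otimes>\<^sub>M unif_row \<rightarrow>\<^sub>M unif_row"
      unfolding unif_row_def by (rule measurable_comb_seq)
    have "(\<integral>\<^sup>+v. ?g v \<partial>unif_row) = (\<integral>\<^sup>+v. ?g v \<partial>distr (unif_row \<Otimes>\<^sub>M unif_row) unif_row (\<lambda>(v, v'). comb_seq M v v'))"
      using unif_seq.PiM_comb_seq[of M] by (simp add: unif_row_def)
    also have "\<dots> = (\<integral>\<^sup>+x. ?g (case x of (v, v') \<Rightarrow> comb_seq M v v') \<partial>(unif_row \<Otimes>\<^sub>M unif_row))"
      by (rule nn_integral_distr[OF cm]) (use g in simp)
    also have "\<dots> = (\<integral>\<^sup>+v. (\<integral>\<^sup>+v'. ?g (comb_seq M v v') \<partial>unif_row) \<partial>unif_row)"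
      using unif_row.nn_integral_fst[OF measurable_compose[OF cm g]] by simp
    also have "\<dots> = (\<integral>\<^sup>+v. (\<integral>\<^sup>+b. indicator A (comb_seq M (coin_row (\<omega> 0) v) b) \<partial>fair) \<partial>unif_row)"
    proof (intro nn_integral_cong)
      fix v
      have eq: "coin_row (\<omega> 0) (comb_seq M v v') = comb_seq M (coin_row (\<omega> 0) v) (?h v')" for v'
      proof (rule ext)
        fix x
        show "coin_row (\<omega> 0) (comb_seq M v v') x = comb_seq M (coin_row (\<omega> 0) v) (?h v') x"
        proof (cases "M \<le> x")
          case True
          then have half: "\<omega> 0 (Suc x) = 1 / 2" by (rule env_bounds(3)[OF \<omega>])
          show ?thesis unfolding coin_row_def comb_seq_def half using True by simp
        qed (simp add: coin_row_def comb_seq_def)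
      qed
      have "(\<integral>\<^sup>+b. indicator A (comb_seq M (coin_row (\<omega> 0) v) b) \<partial>fair) =
          (\<integral>\<^sup>+b. indicator A (comb_seq M (coin_row (\<omega> 0) v) b) \<partial>distr unif_row row_space ?h)"
        by (simp only: distr_unif_row_half)
      also have "\<dots> = (\<integral>\<^sup>+v'. indicator A (comb_seq M (coin_row (\<omega> 0) v) (?h v')) \<partial>unif_row)"
        by (rule nn_integral_distr[OF hm]) (use borel_measurable_fair_comb_seq(2)[OF A] in \<open>simp add: distr_unif_row_half\<close>)
      finally show "(\<integral>\<^sup>+v'. ?g (comb_seq M v v') \<partial>unif_row) =
          (\<integral>\<^sup>+b. indicator A (comb_seq M (coin_row (\<omega> 0) v) b) \<partial>fair)"
        by (simp only: eq)
    qed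
    finally show "(\<integral>\<^sup>+v. (\<integral>\<^sup>+b. indicator A (comb_seq M (coin_row (\<omega> 0) v) b) \<partial>fair) \<partial>unif_row) =
        (\<integral>\<^sup>+v. ?g v \<partial>unif_row)" by simp
  qed
  also have "\<dots> = (\<integral>\<^sup>+r. indicator A r \<partial>R)" by (rule nn_integral_R[symmetric]) (use A in simp)
  also have "\<dots> = emeasure R A" by (rule nn_integral_indicator) (use A sR in simp)
  finally show "(\<integral>\<^sup>+a. (\<integral>\<^sup>+b. indicator A (comb_seq M a b) \<partial>fair) \<partial>R) = emeasure R A" .
qed

lemma measurable_coins:
  "(\<lambda>(\<omega>, u). coins \<omega> u) \<in> P \<Otimes>\<^sub>M unif_array \<rightarrow>\<^sub>M Pi\<^sub>M UNIV (\<lambda>_. R)"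
proof (rule measurable_PiM_single')
  fix z
  have "(\<lambda>x. (fst x z, snd x z)) \<in> P \<Otimes>\<^sub>M unif_array \<rightarrow>\<^sub>M cookie_row \<Otimes>\<^sub>M unif_row"
    by (intro measurable_Pair measurable_compose[OF measurable_fst measurable_site]
        measurable_compose[OF measurable_snd measurable_unif_array_nth])
  from measurable_compose[OF this measurable_coin_row]
  have "(\<lambda>x. coin_row (fst x z) (snd x z)) \<in> P \<Otimes>\<^sub>M unif_array \<rightarrow>\<^sub>M row_space" by simp
  then have "(\<lambda>x. coin_row (fst x z) (snd x z)) \<in> P \<Otimes>\<^sub>M unif_array \<rightarrow>\<^sub>M R"
    by (simp add: R_def)
  then show "(\<lambda>x. (case x of (\<omega>, u) \<Rightarrow> coins \<omega> u) z) \<in> P \<Otimes>\<^sub>M unif_array \<rightarrow>\<^sub>M R"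
    by (simp add: case_prod_beta' coins_def)
qed (auto simp: R_def space_PiM)

text \<open>For a fixed environment the rows are independent, with probabilities depending only on
  the cookies of their own site. Independence of the sites lets the expectation of the product
  factor.\<close>

lemma distr_coins:
  "distr (P \<Otimes>\<^sub>M unif_array) (Pi\<^sub>M UNIV (\<lambda>_. R)) (\<lambda>(\<omega>, u). coins \<omega> u) = Pi\<^sub>M UNIV (\<lambda>_. R)"
proof -
  interpret R: prob_space R by (rule prob_R)
  interpret Rs: product_prob_space "\<lambda>_. R" "UNIV :: int set" by unfold_locales
  have sR: "sets R = sets row_space" "space R = UNIV" by (simp_all add: R_def)
  show ?thesis
  proof (rule Rs.PiM_eq)
    fix J :: "int set" and F assume J: "finite J" "J \<subseteq> UNIV" "\<And>j. j \<in> J \<Longrightarrow> F j \<in> sets R"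
    let ?X = "prod_emb UNIV (\<lambda>_. R) J (\<Pi>\<^sub>E j\<in>J. F j)"
    let ?h = "\<lambda>j w. emeasure unif_row {v. coin_row w v \<in> F j}"
    have X: "?X \<in> sets (Pi\<^sub>M UNIV (\<lambda>_. R))" using J by (intro sets_PiM_I) auto
    have Fs: "{v. coin_row w v \<in> F j} \<in> sets unif_row" if "j \<in> J" for w j
      using measurable_sets[OF measurable_coin_row2, of "F j" w] J(3)[OF that] sR by (simp add: vimage_def)
    have hm: "?h j \<in> borel_measurable cookie_row" if "j \<in> J" for j
    proof -
      have "{x\<in>space (cookie_row \<Otimes>\<^sub>M unif_row). (case x of (w, v) \<Rightarrow> coin_row w v) \<in> F j}
          \<in> sets (cookie_row \<Otimes>\<^sub>M unif_row)"
        using measurable_sets[OF measurable_coin_row, of "F j"] J(3)[OF that] sR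
        by (simp add: vimage_def Int_def conj_commute)
      from unif_row.measurable_emeasure_Pair[OF this]
      have "(\<lambda>w. emeasure unif_row (Pair w -` {x\<in>space (cookie_row \<Otimes>\<^sub>M unif_row). (case x of (w, v) \<Rightarrow> coin_row w v) \<in> F j}))
          \<in> borel_measurable cookie_row" .
      then show ?thesis
        by (rule measurable_cong[THEN iffD1, rotated])
          (auto simp: space_pair_measure intro!: arg_cong[of _ _ "emeasure unif_row"])
    qed
    have hint: "(\<integral>\<^sup>+\<omega>. ?h j (\<omega> j) \<partial>P) = emeasure R (F j)" if "j \<in> J" for j
    proof -
      have "emeasure R (F j) = (\<integral>\<^sup>+r. indicator (F j) r \<partial>R)"
        by (rule nn_integral_indicator[symmetric]) (use J that in simp)
      also have "\<dots> = (\<integral>\<^sup>+\<omega>. (\<integral>\<^sup>+v. indicator (F j) (coin_row (\<omega> j) v) \<partial>unif_row) \<partial>P)"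
        by (rule nn_integral_R) (use J(3)[OF that] sR in simp)
      also have "\<dots> = (\<integral>\<^sup>+\<omega>. ?h j (\<omega> j) \<partial>P)"
      proof (intro nn_integral_cong)
        fix \<omega>
        have "(\<integral>\<^sup>+v. indicator (F j) (coin_row (\<omega> j) v) \<partial>unif_row) =
            (\<integral>\<^sup>+v. indicator {v. coin_row (\<omega> j) v \<in> F j} v \<partial>unif_row)"
          by (intro nn_integral_cong) (auto simp: indicator_def)
        also have "\<dots> = ?h j (\<omega> j)" by (rule nn_integral_indicator[OF Fs[OF that]])
        finally show "(\<integral>\<^sup>+v. indicator (F j) (coin_row (\<omega> j) v) \<partial>unif_row) = ?h j (\<omega> j)" .
      qed
      finally show ?thesis by simp
    qed
    have "emeasure (distr (P \<Otimes>\<^sub>M unif_array) (Pi\<^sub>M UNIV (\<lambda>_. R)) (\<lambda>(\<omega>, u). coins \<omega> u)) ?X =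
        emeasure (P \<Otimes>\<^sub>M unif_array) ((\<lambda>(\<omega>, u). coins \<omega> u) -` ?X \<inter> space (P \<Otimes>\<^sub>M unif_array))"
      by (rule emeasure_distr[OF measurable_coins X])
    also have "\<dots> = (\<integral>\<^sup>+\<omega>. emeasure unif_array (Pair \<omega> -` ((\<lambda>(\<omega>, u). coins \<omega> u) -` ?X \<inter> space (P \<Otimes>\<^sub>M unif_array))) \<partial>P)"
      by (rule unif_array.emeasure_pair_measure_alt) (rule measurable_sets[OF measurable_coins X])
    also have "\<dots> = (\<integral>\<^sup>+\<omega>. (\<Prod>j\<in>J. ?h j (\<omega> j)) \<partial>P)"
    proof (intro nn_integral_cong)
      fix \<omega> assume \<omega>: "\<omega> \<in> space P"
      have "Pair \<omega> -` ((\<lambda>(\<omega>, u). coins \<omega> u) -` ?X \<inter> space (P \<Otimes>\<^sub>M unif_array)) =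
          {u\<in>space unif_array. \<forall>j\<in>J. u j \<in> {v. coin_row (\<omega> j) v \<in> F j}}"
        using \<omega> by (auto simp: prod_emb_def PiE_iff space_pair_measure coins_def sR space_PiM)
      also have "emeasure unif_array \<dots> = (\<Prod>j\<in>J. ?h j (\<omega> j))"
        unfolding unif_array_def using J Fs by (intro unif_rows.emeasure_PiM_Collect) auto
      finally show "emeasure unif_array (Pair \<omega> -` ((\<lambda>(\<omega>, u). coins \<omega> u) -` ?X \<inter> space (P \<Otimes>\<^sub>M unif_array))) =
          (\<Prod>j\<in>J. ?h j (\<omega> j))" .
    qed
    also have "\<dots> = (\<Prod>j\<in>J. (\<integral>\<^sup>+\<omega>. ?h j (\<omega> j) \<partial>P))"
    proof (rule indep_vars_nn_integral[OF J(1)])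
      have "indep_vars (\<lambda>_. cookie_row) (\<lambda>z \<omega>. \<omega> z) J"
        by (rule indep_vars_subset[of _ _ UNIV]) (use iid in \<open>auto simp: iid_sites_def\<close>)
      then show "indep_vars (\<lambda>_. borel) (\<lambda>j \<omega>. ?h j (\<omega> j)) J"
        by (rule indep_vars_compose2) (rule hm)
    qed simp
    also have "\<dots> = (\<Prod>j\<in>J. emeasure R (F j))" using hint by (intro prod.cong) auto
    finally show "emeasure (distr (P \<Otimes>\<^sub>M unif_array) (Pi\<^sub>M UNIV (\<lambda>_. R)) (\<lambda>(\<omega>, u). coins \<omega> u)) ?X =
        (\<Prod>j\<in>J. emeasure R (F j))" .
  qed simp
qed

end

section \<open>Quenched path probabilities\<close>

definition past :: "(nat \<Rightarrow> int) \<Rightarrow> nat \<Rightarrow> nat" where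
  "past x i = card {j. j < i \<and> x j = x i}"

text \<open>\<open>visits\<close> includes the present visit, so that cookie
  \<open>Suc (past x i)\<close> belongs to coin \<open>past x i\<close>.\<close>

lemma visits_eq_past: "card {j. j \<le> i \<and> x j = x i} = Suc (past x i)"
proof -
  have "{j. j \<le> i \<and> x j = x i} = insert i {j. j < i \<and> x j = x i}" by auto
  then show ?thesis by (simp add: past_def)
qed

lemma past_less: "i < j \<Longrightarrow> x i = x j \<Longrightarrow> past x i < past x j"
  unfolding past_def by (rule psubset_card_mono) auto

text \<open>No coin is used at two different times, hence the probability of a path is a product
  over its steps.\<close>

lemma inj_past: "inj_on (\<lambda>i. (x i, past x i)) A"
proof (rule inj_onI)
  fix i j assume "(x i, past x i) = (x j, past x j)"
  then show "i = j" using past_less[of i j x] past_less[of j i x] by (cases i j rule: linorder_cases) auto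
qed

lemma walk_follows_iff:
  "(\<forall>i\<le>n. walk c i = x i) \<longleftrightarrow>
    x 0 = 0 \<and> (\<forall>i<n. x (Suc i) = (if c (x i) (past x i) then x i + 1 else x i - 1))"
proof (induction n)
  case (Suc n)
  have "(\<forall>i\<le>Suc n. walk c i = x i) \<longleftrightarrow> (\<forall>i\<le>n. walk c i = x i) \<and> walk c (Suc n) = x (Suc n)"
    by (auto simp: le_Suc_eq)
  also have "\<dots> \<longleftrightarrow> (\<forall>i\<le>n. walk c i = x i) \<and> x (Suc n) = (if c (x n) (past x n) then x n + 1 else x n - 1)"
  proof (intro conj_cong refl)
    assume a: "\<forall>i\<le>n. walk c i = x i"
    then have "leaves c n (walk c n) = past x n"
      unfolding leaves_eq_card past_def by (intro arg_cong[of _ _ card]) auto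
    then show "walk c (Suc n) = x (Suc n) \<longleftrightarrow> x (Suc n) = (if c (x n) (past x n) then x n + 1 else x n - 1)"
      using a by (auto simp: walk_Suc)
  qed
  also have "\<dots> \<longleftrightarrow> x 0 = 0 \<and> (\<forall>i<Suc n. x (Suc i) = (if c (x i) (past x i) then x i + 1 else x i - 1))"
    unfolding Suc by (auto simp: less_Suc_eq)
  finally show ?case .
qed auto

definition step_prob :: "(int \<Rightarrow> nat \<Rightarrow> real) \<Rightarrow> (nat \<Rightarrow> int) \<Rightarrow> nat \<Rightarrow> real" where
  "step_prob \<omega> x i =
    (if x (Suc i) = x i + 1 then \<omega> (x i) (Suc (past x i))
     else if x (Suc i) = x i - 1 then 1 - \<omega> (x i) (Suc (past x i)) else 0)"

definition path_prob :: "(int \<Rightarrow> nat \<Rightarrow> real) \<Rightarrow> (nat \<Rightarrow> int) \<Rightarrow> nat \<Rightarrow> real" where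
  "path_prob \<omega> x n = (if x 0 = 0 then \<Prod>i<n. step_prob \<omega> x i else 0)"

text \<open>The required coins are grouped by site, since independence is available first between
  rows and then within a row.\<close>

lemma emeasure_coins_cylinder:
  assumes \<omega>: "\<And>z i. 0 \<le> \<omega> z (Suc i) \<and> \<omega> z (Suc i) \<le> 1" and I: "finite I"
  shows "emeasure unif_array {u. \<forall>p\<in>I. coins \<omega> u (fst p) (snd p) = e p} =
    ennreal (\<Prod>p\<in>I. if e p then \<omega> (fst p) (Suc (snd p)) else 1 - \<omega> (fst p) (Suc (snd p)))"
proof -
  let ?Z = "fst ` I" and ?J = "\<lambda>z. I `` {z}"
  let ?g = "\<lambda>z k. if e (z, k) then \<omega> z (Suc k) else 1 - \<omega> z (Suc k)"
  have J: "finite (?J z)" for z using I by (auto intro: finite_Image)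
  have Sig: "Sigma ?Z ?J = I" by (auto simp: image_iff) force
  let ?X = "\<lambda>z. {v. \<forall>k\<in>?J z. coin_row (\<omega> z) v k = e (z, k)}"
  have X: "?X z \<in> sets unif_row" for z
  proof -
    have "{r \<in> space row_space. \<forall>k\<in>?J z. r k = e (z, k)} \<in> sets row_space" using J by measurable
    from measurable_sets[OF measurable_coin_row2 this, of "\<omega> z"] show ?thesis by (simp add: vimage_def)
  qed
  have "{u. \<forall>p\<in>I. coins \<omega> u (fst p) (snd p) = e p} = {u\<in>space unif_array. \<forall>z\<in>?Z. u z \<in> ?X z}"
    by (force simp: coins_def)
  also have "emeasure unif_array \<dots> = (\<Prod>z\<in>?Z. emeasure unif_row (?X z))"
    unfolding unif_array_def using I X by (intro unif_rows.emeasure_PiM_Collect) auto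
  also have "\<dots> = (\<Prod>z\<in>?Z. ennreal (\<Prod>k\<in>?J z. ?g z k))"
    using \<omega> by (intro prod.cong refl emeasure_coin_row_cylinder J) auto
  also have "\<dots> = ennreal (\<Prod>z\<in>?Z. \<Prod>k\<in>?J z. ?g z k)"
    using \<omega> by (intro prod_ennreal prod_nonneg) auto
  also have "(\<Prod>z\<in>?Z. \<Prod>k\<in>?J z. ?g z k) = (\<Prod>(z, k)\<in>Sigma ?Z ?J. ?g z k)"
    using I J by (intro prod.Sigma) auto
  also have "\<dots> = (\<Prod>p\<in>I. if e p then \<omega> (fst p) (Suc (snd p)) else 1 - \<omega> (fst p) (Suc (snd p)))"
    unfolding Sig by (intro prod.cong) (auto simp: case_prod_beta')
  finally show ?thesis .
qed

lemma emeasure_walk_path: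
  assumes \<omega>: "\<And>z i. 0 \<le> \<omega> z (Suc i) \<and> \<omega> z (Suc i) \<le> 1"
  shows "emeasure unif_array {u. \<forall>i\<le>n. walk (coins \<omega> u) i = x i} = ennreal (path_prob \<omega> x n)"
proof (cases "x 0 = 0 \<and> (\<forall>i<n. x (Suc i) = x i + 1 \<or> x (Suc i) = x i - 1)")
  case False
  have "{u. \<forall>i\<le>n. walk (coins \<omega> u) i = x i} = {}"
    using False unfolding walk_follows_iff by (auto split: if_splits)
  moreover have "path_prob \<omega> x n = 0"
    using False by (auto simp: path_prob_def step_prob_def intro!: prod_zero)
  ultimately show ?thesis by (simp only: emeasure_empty ennreal_0)
next
  case True
  let ?f = "\<lambda>i. (x i, past x i)"
  \<comment> \<open>The outcome that the path demands of coin \<open>p\<close>; by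
    \<open>inj_past\<close> only one step can make a demand on it.\<close>
  define e where "e p \<longleftrightarrow> (\<exists>i<n. ?f i = p \<and> x (Suc i) = x i + 1)" for p
  have e: "e (?f i) \<longleftrightarrow> x (Suc i) = x i + 1" if "i < n" for i
    using that inj_onD[OF inj_past[of x UNIV]] unfolding e_def by blast
  have "{u. \<forall>i\<le>n. walk (coins \<omega> u) i = x i} =
      {u. \<forall>p\<in>?f ` {..<n}. coins \<omega> u (fst p) (snd p) = e p}"
    using True e unfolding walk_follows_iff by (auto split: if_splits)
  also have "emeasure unif_array \<dots> =
      ennreal (\<Prod>p\<in>?f ` {..<n}. if e p then \<omega> (fst p) (Suc (snd p)) else 1 - \<omega> (fst p) (Suc (snd p)))"
    by (rule emeasure_coins_cylinder[where \<omega> = \<omega>, OF \<omega>]) simp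
  also have "(\<Prod>p\<in>?f ` {..<n}. if e p then \<omega> (fst p) (Suc (snd p)) else 1 - \<omega> (fst p) (Suc (snd p))) =
      (\<Prod>i<n. step_prob \<omega> x i)"
    using True e by (subst prod.reindex[OF inj_past]) (auto simp: step_prob_def intro!: prod.cong)
  finally show ?thesis using True by (simp add: path_prob_def)
qed

lemma step_prob_eq_0:
  "x (Suc n) \<noteq> x n + 1 \<Longrightarrow> x (Suc n) \<noteq> x n - 1 \<Longrightarrow> step_prob \<omega> x n = 0"
  by (simp add: step_prob_def)

text \<open>The event that the path is followed up to time \<open>n\<close> belongs to the history,
  and on it the prescribed conditional probability is constant. Integrating the conditional
  expectation over this event gives one factor of the product.\<close>

lemma measure_erw_path:
  assumes erw: "erw \<omega> 0 Q X"
  shows "measure Q {s\<in>space Q. \<forall>i\<le>n. X i s = x i} = path_prob \<omega> x n"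
proof -
  interpret Q: prob_space Q using erw by (simp add: erw_def)
  have X [measurable]: "X n \<in> Q \<rightarrow>\<^sub>M count_space UNIV" for n using erw by (simp add: erw_def)
  show ?thesis
  proof (induction n)
    case 0
    have 1: "measure Q {s\<in>space Q. X 0 s = 0} = 1" using erw by (simp add: erw_def)
    show ?case
    proof (cases "x 0 = 0")
      case True
      then show ?thesis using 1 by (simp add: path_prob_def)
    next
      case False
      have "AE s in Q. X 0 s = 0"
      proof -
        have "{s\<in>space Q. X 0 s = 0} \<in> sets Q" by measurable
        then show ?thesis using Q.AE_in_set_eq_1[of "{s\<in>space Q. X 0 s = 0}"] 1 by auto
      qed
      then have "AE s in Q. \<not> (\<forall>i\<le>0. X i s = x i)" 
        by (rule eventually_mono) (use False in auto)
      then have "measure Q {s\<in>space Q. \<forall>i\<le>0. X i s = x i} = 0"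
        by (subst Q.prob_eq_0) auto
      then show ?thesis using False by (simp add: path_prob_def)
    qed
  next
    case (Suc n)
    let ?H = "history Q X n"
    let ?A = "{s\<in>space Q. \<forall>i\<le>n. X i s = x i}"
    let ?U = "{s\<in>space Q. X (Suc n) s = X n s + 1}" and ?D = "{s\<in>space Q. X (Suc n) s = X n s - 1}"
    let ?p = "\<omega> (x n) (Suc (past x n))"
    have A: "?A \<in> sets Q" and U: "?U \<in> sets Q" and D: "?D \<in> sets Q" by measurable
    have hist: "(\<lambda>s. \<lambda>i\<in>{..n}. X i s) \<in> Q \<rightarrow>\<^sub>M Pi\<^sub>M {..n} (\<lambda>_. count_space UNIV)"
      by measurable
    have sub: "subalgebra Q ?H"
      unfolding subalgebra_def history_def
      using measurable_sets[OF hist] by (auto simp: sets_vimage_algebra2 space_PiM)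
    interpret H: finite_measure_subalgebra Q ?H by unfold_locales (rule sub)
    have AH: "?A \<in> sets ?H"
    proof -
      have "{y\<in>space (Pi\<^sub>M {..n} (\<lambda>_. count_space UNIV)). \<forall>i\<in>{..n}. y i = x i} \<in> sets (Pi\<^sub>M {..n} (\<lambda>_. count_space UNIV))"
        by measurable
      then have "(\<lambda>s. \<lambda>i\<in>{..n}. X i s) -` {y\<in>space (Pi\<^sub>M {..n} (\<lambda>_. count_space UNIV)). \<forall>i\<in>{..n}. y i = x i} \<inter> space Q \<in> sets ?H"
        unfolding history_def by (rule in_vimage_algebra)
      also have "(\<lambda>s. \<lambda>i\<in>{..n}. X i s) -` {y\<in>space (Pi\<^sub>M {..n} (\<lambda>_. count_space UNIV)). \<forall>i\<in>{..n}. y i = x i} \<inter> space Q = ?A"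
        by (auto simp: space_PiM)
      finally show ?thesis .
    qed
    have on_A: "\<omega> (X n s) (visits X n s) = ?p" if "s \<in> ?A" for s
    proof -
      have "{i. i \<le> n \<and> X i s = X n s} = {i. i \<le> n \<and> x i = x n}" using that by auto
      then show ?thesis using that by (simp add: visits_def visits_eq_past)
    qed
    have cond: "measure Q (?A \<inter> B) = q * measure Q ?A"
      if B: "B \<in> sets Q" and ae: "AE s in Q. real_cond_exp Q ?H (indicator B) s = h s"
        and h: "\<And>s. s \<in> ?A \<Longrightarrow> h s = q" for B h q
    proof -
      have "measure Q (?A \<inter> B) = (\<integral>s\<in>?A. indicator B s \<partial>Q)"
        using A B by (simp add: set_lebesgue_integral_def indicator_inter_arith[symmetric])
      also have "\<dots> = (\<integral>s\<in>?A. real_cond_exp Q ?H (indicator B) s \<partial>Q)"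
        using B by (intro H.real_cond_exp_intA AH) (simp add: Q.emeasure_eq_measure)
      also have "\<dots> = (\<integral>s\<in>?A. q \<partial>Q)"
        unfolding set_lebesgue_integral_def
      proof (rule integral_cong_AE)
        show "AE s in Q. indicat_real ?A s *\<^sub>R real_cond_exp Q ?H (indicator B) s = indicat_real ?A s *\<^sub>R q"
          using ae
        proof eventually_elim
          case (elim s)
          show ?case
          proof (cases "s \<in> ?A")
            case True
            show ?thesis by (simp only: elim h[OF True])
          next
            case False
            then have "indicat_real ?A s = 0" by (rule indicator_simps(2))
            then show ?thesis by (simp only: scaleR_zero_left)
          qed
        qed
      qed (use A in auto)
      also have "\<dots> = q * measure Q ?A" using A by (simp add: set_lebesgue_integral_def)
      finally show ?thesis .
    qed
    have "AE s in Q. real_cond_exp Q ?H (indicator ?U) s = \<omega> (X n s) (visits X n s)"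
      using erw unfolding erw_def by blast
    from cond[OF U this on_A] have mU: "measure Q (?A \<inter> ?U) = ?p * measure Q ?A" .
    have "AE s in Q. real_cond_exp Q ?H (indicator ?D) s = 1 - \<omega> (X n s) (visits X n s)"
      using erw unfolding erw_def by blast
    moreover have "1 - \<omega> (X n s) (visits X n s) = 1 - ?p" if "s \<in> ?A" for s
      by (simp only: on_A[OF that])
    ultimately have mD: "measure Q (?A \<inter> ?D) = (1 - ?p) * measure Q ?A"
      by (rule cond[OF D])
    let ?B = "{s\<in>space Q. \<forall>i\<le>Suc n. X i s = x i}"
    have B: "?B = {s\<in>?A. X (Suc n) s = x (Suc n)}" by (auto simp: le_Suc_eq)
    have "measure Q ?B = measure Q ?A * step_prob \<omega> x n"
    proof -
      consider "x (Suc n) = x n + 1" | "x (Suc n) = x n - 1"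
        | "x (Suc n) \<noteq> x n + 1" "x (Suc n) \<noteq> x n - 1" by blast
      then show ?thesis
      proof cases
        case 1
        then have "?B = ?A \<inter> ?U" unfolding B by auto
        then show ?thesis using mU 1 by (simp add: step_prob_def)
      next
        case 2
        then have "?B = ?A \<inter> ?D" unfolding B by auto
        then show ?thesis using mD 2 by (simp add: step_prob_def)
      next
        case 3
        \<comment> \<open>The up and down probabilities add up to 1, so any other step is a null
          event.\<close>
        have "?B \<subseteq> ?A - (?A \<inter> ?U \<union> ?A \<inter> ?D)" unfolding B using 3 by auto
        then have "measure Q ?B \<le> measure Q (?A - (?A \<inter> ?U \<union> ?A \<inter> ?D))"
          using A U D by (intro Q.finite_measure_mono) auto
        also have "\<dots> = measure Q ?A - measure Q (?A \<inter> ?U \<union> ?A \<inter> ?D)"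
          using A U D by (intro Q.finite_measure_Diff) auto
        also have "measure Q (?A \<inter> ?U \<union> ?A \<inter> ?D) = measure Q (?A \<inter> ?U) + measure Q (?A \<inter> ?D)"
          using A U D by (intro Q.finite_measure_Union) auto
        also have "measure Q ?A - \<dots> = 0" unfolding mU mD by (simp add: algebra_simps)
        finally have "measure Q ?B = 0" by (simp add: measure_le_0_iff)
        then show ?thesis using step_prob_eq_0[OF 3] by simp
      qed
    qed
    then show ?case using Suc by (simp add: path_prob_def)
  qed
qed

section \<open>From the walk driven by coins to an arbitrary excited random walk\<close>

lemma measurable_walk_aux:
  assumes c: "\<And>z i. (\<lambda>x. c x z i) \<in> N \<rightarrow>\<^sub>M count_space (UNIV :: bool set)"
  shows "(\<lambda>x. walk (c x) n) \<in> N \<rightarrow>\<^sub>M count_space UNIV \<and> (\<forall>z. (\<lambda>x. leaves (c x) n z) \<in> N \<rightarrow>\<^sub>M count_space UNIV)"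
proof (induction n)
  case (Suc n)
  then have W [measurable]: "(\<lambda>x. walk (c x) n) \<in> N \<rightarrow>\<^sub>M count_space UNIV"
    and L [measurable]: "\<And>z. (\<lambda>x. leaves (c x) n z) \<in> N \<rightarrow>\<^sub>M count_space UNIV" by auto
  have LW: "(\<lambda>x. leaves (c x) n (walk (c x) n)) \<in> N \<rightarrow>\<^sub>M count_space UNIV"
    by (rule measurable_compose_countable[OF L W])
  have "(\<lambda>x. c x z (leaves (c x) n (walk (c x) n))) \<in> N \<rightarrow>\<^sub>M count_space UNIV" for z
    by (rule measurable_compose_countable[OF c LW])
  from measurable_compose_countable[OF this W]
  have [measurable]: "Measurable.pred N (\<lambda>x. c x (walk (c x) n) (leaves (c x) n (walk (c x) n)))" .
  show ?case unfolding walk_Suc leaves_Suc by measurable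
qed (simp add: walk_def[symmetric])

text \<open>Convergence depends on the trajectory only, and the law of a trajectory is determined by
  the probabilities of its initial segments. The hypothesis concerns the environment alone, so one
  null set of environments serves all walks on all probability spaces.\<close>

theorem AE_erw_transfer:
  assumes \<omega>: "\<And>z i. 0 \<le> \<omega> z (Suc i) \<and> \<omega> z (Suc i) \<le> 1" and erw: "erw \<omega> 0 Q X"
    and ae: "AE u in unif_array. (\<lambda>n. real_of_int (walk (coins \<omega> u) n) / real n) \<longlonglongrightarrow> v"
  shows "AE s in Q. (\<lambda>n. real_of_int (X n s) / real n) \<longlonglongrightarrow> v"
proof -
  interpret Q: prob_space Q using erw by (simp add: erw_def)
  have X [measurable]: "X n \<in> Q \<rightarrow>\<^sub>M count_space UNIV" for n using erw by (simp add: erw_def)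
  let ?S = "stream_space (count_space (UNIV :: int set))"
  let ?f = "\<lambda>u. to_stream (walk (coins \<omega> u))" and ?g = "\<lambda>s. to_stream (\<lambda>n. X n s)"
  have W [measurable]: "(\<lambda>u. walk (coins \<omega> u) n) \<in> unif_array \<rightarrow>\<^sub>M count_space UNIV" for n
  proof -
    have "(\<lambda>u. coins \<omega> u z i) \<in> unif_array \<rightarrow>\<^sub>M count_space UNIV" for z i
    proof -
      have [measurable]: "(\<lambda>u. u z i) \<in> unif_array \<rightarrow>\<^sub>M borel"
        by (rule measurable_compose[OF measurable_unif_array_nth measurable_unif_row_nth])
      have "Measurable.pred unif_array (\<lambda>u. u z i \<le> \<omega> z (Suc i))" by measurable
      then show ?thesis by (simp add: coins_def coin_row_def)
    qed
    then show ?thesis using measurable_walk_aux[where c = "coins \<omega>" and N = unif_array] by blast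
  qed
  have f: "?f \<in> unif_array \<rightarrow>\<^sub>M ?S"
    by (rule measurable_stream_space2) (simp add: to_stream_def)
  have g: "?g \<in> Q \<rightarrow>\<^sub>M ?S"
    by (rule measurable_stream_space2) (simp add: to_stream_def)
  have eq: "distr unif_array ?S ?f = distr Q ?S ?g"
  proof (rule stream_space_eq_sstart[of UNIV])
    show "prob_space (distr unif_array ?S ?f)" "prob_space (distr Q ?S ?g)"
      using f g by (auto intro: unif_array.prob_space_distr Q.prob_space_distr)
    fix xs :: "int list" assume xs: "xs \<noteq> []"
    define n where "n = length xs - 1"
    have len: "i < length xs \<longleftrightarrow> i \<le> n" for i using xs by (cases xs) (auto simp: n_def)
    have st: "y \<in> sstart UNIV xs \<longleftrightarrow> (\<forall>i\<le>n. y !! i = xs ! i)" for y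
      using sstart_eq[of y UNIV xs] len by simp
    have S: "sstart UNIV xs \<in> sets ?S" by (rule sstart_sets)
    have "emeasure (distr unif_array ?S ?f) (sstart UNIV xs) =
        emeasure unif_array {u. \<forall>i\<le>n. walk (coins \<omega> u) i = xs ! i}"
      by (subst emeasure_distr[OF f S]) (auto simp: st to_stream_def intro!: arg_cong[of _ _ "emeasure unif_array"])
    also have "\<dots> = ennreal (path_prob \<omega> (\<lambda>i. xs ! i) n)" by (rule emeasure_walk_path[where \<omega> = \<omega>, OF \<omega>])
    also have "\<dots> = emeasure Q {s\<in>space Q. \<forall>i\<le>n. X i s = xs ! i}"
      using measure_erw_path[OF erw, of n "\<lambda>i. xs ! i"] by (simp add: Q.emeasure_eq_measure)
    also have "\<dots> = emeasure (distr Q ?S ?g) (sstart UNIV xs)"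
      by (subst emeasure_distr[OF g S]) (auto simp: st to_stream_def intro!: arg_cong[of _ _ "emeasure Q"])
    finally show "emeasure (distr unif_array ?S ?f) (sstart UNIV xs) = emeasure (distr Q ?S ?g) (sstart UNIV xs)" .
  qed simp_all
  let ?P = "\<lambda>y. (\<lambda>n. real_of_int (y !! n) / real n) \<longlonglongrightarrow> v"
  have P: "{y \<in> space ?S. ?P y} \<in> sets ?S"
  proof -
    have "(\<lambda>y. ?P y) = (\<lambda>y. \<forall>k. \<exists>N. \<forall>n. N \<le> n \<longrightarrow> \<bar>real_of_int (y !! n) / real n - v\<bar> < inverse (real (Suc k)))"
    proof (intro ext iffI)
      fix y :: "int stream" assume y: "?P y"
      have "0 < inverse (real (Suc k))" for k by simp
      from LIMSEQ_D[OF y this]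
      show "\<forall>k. \<exists>N. \<forall>n. N \<le> n \<longrightarrow> \<bar>real_of_int (y !! n) / real n - v\<bar> < inverse (real (Suc k))"
        by (simp only: real_norm_def) blast
    next
      fix y :: "int stream"
      assume a: "\<forall>k. \<exists>N. \<forall>n. N \<le> n \<longrightarrow> \<bar>real_of_int (y !! n) / real n - v\<bar> < inverse (real (Suc k))"
      show "?P y"
      proof (rule LIMSEQ_I)
        fix r :: real assume "0 < r"
        then obtain k where k: "inverse (real (Suc k)) < r" using reals_Archimedean by blast
        from a obtain N where "\<forall>n. N \<le> n \<longrightarrow> \<bar>real_of_int (y !! n) / real n - v\<bar> < inverse (real (Suc k))" by blast
        with k show "\<exists>no. \<forall>n\<ge>no. norm (real_of_int (y !! n) / real n - v) < r"
          by (intro exI[of _ N]) (auto intro: less_trans)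
      qed
    qed
    moreover have "{y \<in> space ?S. \<forall>k. \<exists>N. \<forall>n. N \<le> n \<longrightarrow> \<bar>real_of_int (y !! n) / real n - v\<bar> < inverse (real (Suc k))} \<in> sets ?S"
      by measurable
    ultimately show ?thesis by simp
  qed
  have "AE y in distr unif_array ?S ?f. ?P y"
    using ae by (subst AE_distr_iff[OF f P]) (simp add: to_stream_def)
  then have "AE y in distr Q ?S ?g. ?P y" by (simp only: eq)
  then show ?thesis by (subst (asm) AE_distr_iff[OF g P]) (simp add: to_stream_def)
qed

section \<open>Reflection and the law of large numbers\<close>

definition flip_row :: "(nat \<Rightarrow> bool) \<Rightarrow> nat \<Rightarrow> bool" where
  "flip_row r i \<longleftrightarrow> \<not> r i"

definition reflect :: "(int \<Rightarrow> nat \<Rightarrow> bool) \<Rightarrow> int \<Rightarrow> nat \<Rightarrow> bool" where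
  "reflect c z = flip_row (c (- z))"

lemma walk_reflect: "walk (reflect c) n = - walk c n"
proof -
  have "walk (reflect c) n = - walk c n \<and> (\<forall>z. leaves (reflect c) n z = leaves c n (- z))"
  proof (induction n)
    case (Suc n)
    then show ?case by (auto simp: walk_Suc leaves_Suc reflect_def flip_row_def)
  qed simp
  then show ?thesis ..
qed

lemma succs_flip_row: "succs (flip_row r) n = fails r n"
  by (simp add: succs_def fails_def flip_row_def)

lemma succs_eq_full_iff: "succs r n = n \<longleftrightarrow> (\<forall>i\<in>{..<n}. r i = True)"
proof (induction n)
  case (Suc n)
  then show ?case using succs_le[of r n] by (auto simp: succs_Suc lessThan_Suc)
qed simp

lemma succs_eq_0_iff: "succs r n = 0 \<longleftrightarrow> (\<forall>i\<in>{..<n}. r i = False)"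
  by (auto simp: succs_def)

lemma measurable_flip_row: "flip_row \<in> row_space \<rightarrow>\<^sub>M row_space"
  by (rule measurable_PiM_single') (auto simp: flip_row_def space_PiM)

lemma distr_fair_flip: "distr fair row_space flip_row = fair"
proof -
  have "distr coin (count_space UNIV) Not = coin"
  proof (rule measure_eqI_countable[of _ UNIV])
    fix a :: bool
    have "emeasure (distr coin (count_space UNIV) Not) {a} = emeasure coin {\<not> a}"
      by (subst emeasure_distr) (auto intro!: arg_cong[of _ _ "emeasure coin"])
    then show "emeasure (distr coin (count_space UNIV) Not) {a} = emeasure coin {a}"
      by (cases a) (simp_all add: emeasure_pmf_single)
  qed auto
  then show ?thesis
    using distr_PiM_map[of coin Not "count_space UNIV" "\<lambda>i::nat. i"] prob_space_measure_pmf[of "bernoulli_pmf (1 / 2)"]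
    by (simp add: fair_def flip_row_def[abs_def])
qed

lemma flip_comb_seq: "flip_row (comb_seq n a b) = comb_seq n (flip_row a) (flip_row b)"
  by (simp add: fun_eq_iff flip_row_def comb_seq_def)

context row_law
begin

definition R_flip :: "(nat \<Rightarrow> bool) measure" where
  "R_flip = distr R row_space flip_row"

lemma measurable_flip_R: "flip_row \<in> R \<rightarrow>\<^sub>M row_space"
  using measurable_flip_row by (simp cong: measurable_cong_sets)

text \<open>Fair coins stay fair when negated, and negation commutes with splicing at
  \<open>M\<close>.\<close>

lemma row_law_flip: "row_law R_flip M"
proof (rule row_lawI)
  show "prob_space R_flip" unfolding R_flip_def by (rule prob_space_distr[OF measurable_flip_R])
  show "sets R_flip = sets row_space" by (simp add: R_flip_def)
  fix A assume A: "A \<in> sets row_space"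
  have B: "flip_row -` A \<in> sets row_space" using measurable_sets[OF measurable_flip_row A] by simp
  have "(\<integral>\<^sup>+a. (\<integral>\<^sup>+b. indicator A (comb_seq M a b) \<partial>fair) \<partial>R_flip) =
      (\<integral>\<^sup>+a. (\<integral>\<^sup>+b. indicator A (comb_seq M (flip_row a) b) \<partial>fair) \<partial>R)"
    unfolding R_flip_def
    by (rule nn_integral_distr[OF measurable_flip_R]) (use borel_measurable_fair_comb_seq(1)[OF A] in simp)
  also have "\<dots> = (\<integral>\<^sup>+a. (\<integral>\<^sup>+b. indicator (flip_row -` A) (comb_seq M a b) \<partial>fair) \<partial>R)"
  proof (rule nn_integral_cong)
    fix a
    have "(\<integral>\<^sup>+b. indicator A (comb_seq M (flip_row a) b) \<partial>fair) =
        (\<integral>\<^sup>+b. indicator A (comb_seq M (flip_row a) b) \<partial>distr fair row_space flip_row)"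
      by (simp only: distr_fair_flip)
    also have "\<dots> = (\<integral>\<^sup>+b. indicator A (comb_seq M (flip_row a) (flip_row b)) \<partial>fair)"
    proof (rule nn_integral_distr)
      show "flip_row \<in> fair \<rightarrow>\<^sub>M row_space" using measurable_flip_row by (simp cong: measurable_cong_sets)
    qed (use borel_measurable_fair_comb_seq(2)[OF A] in \<open>simp add: distr_fair_flip\<close>)
    finally show "(\<integral>\<^sup>+b. indicator A (comb_seq M (flip_row a) b) \<partial>fair) =
        (\<integral>\<^sup>+b. indicator (flip_row -` A) (comb_seq M a b) \<partial>fair)"
      by (simp add: flip_comb_seq[symmetric] indicator_vimage)
  qed
  also have "\<dots> = (\<integral>\<^sup>+r. indicator (flip_row -` A) r \<partial>R)"
    by (rule nn_integral_R[symmetric]) (use B in simp)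
  also have "\<dots> = emeasure R (flip_row -` A)" by (rule nn_integral_indicator) (use B in simp)
  also have "\<dots> = emeasure R_flip A"
    unfolding R_flip_def using emeasure_distr[OF measurable_flip_R A] by simp
  finally show "(\<integral>\<^sup>+a. (\<integral>\<^sup>+b. indicator A (comb_seq M a b) \<partial>fair) \<partial>R_flip) = emeasure R_flip A" .
qed

lemma measure_flip:
  assumes "k \<le> M"
  shows "measure R_flip {r. succs r M = k} = measure R {r. succs r M = M - k}"
proof -
  have "{r \<in> space row_space. succs r M = k} \<in> sets row_space" by measurable
  then have "{r. succs r M = k} \<in> sets row_space" by simp
  from measure_distr[OF measurable_flip_R this]
  have "measure R_flip {r. succs r M = k} = measure R {r. succs (flip_row r) M = k}"
    by (simp add: R_flip_def vimage_def)
  also have "{r. succs (flip_row r) M = k} = {r. succs r M = M - k}"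
  proof (rule Collect_cong)
    fix r show "succs (flip_row r) M = k \<longleftrightarrow> succs r M = M - k"
      using succs_plus_fails[of r M] assms unfolding succs_flip_row by linarith
  qed
  finally show ?thesis .
qed

lemma \<delta>_flip: "row_law.\<delta> R_flip M = - \<delta>"
proof -
  interpret F: row_law R_flip M by (rule row_law_flip)
  have "F.\<delta> = (\<integral>r. 2 * real (succs (flip_row r) M) - real M \<partial>R)"
    unfolding F.\<delta>_def unfolding R_flip_def
    by (rule integral_distr[OF measurable_flip_R]) measurable
  also have "\<dots> = (\<integral>r. - (2 * real (succs r M) - real M) \<partial>R)"
  proof (rule Bochner_Integration.integral_cong[OF refl])
    fix r
    have "real (succs r M) + real (fails r M) = real M"
      using succs_plus_fails[of r M] by (simp flip: of_nat_add)
    then show "2 * real (succs (flip_row r) M) - real M = - (2 * real (succs r M) - real M)"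
      unfolding succs_flip_row by linarith
  qed
  also have "\<dots> = - \<delta>" unfolding \<delta>_def by (rule Bochner_Integration.integral_minus)
  finally show ?thesis .
qed

lemma AE_reflect:
  assumes "AE c in Pi\<^sub>M UNIV (\<lambda>_. R_flip). Q c"
  shows "AE c in C. Q (reflect c)"
proof -
  have m: "reflect \<in> C \<rightarrow>\<^sub>M Pi\<^sub>M UNIV (\<lambda>_. row_space)"
  proof (rule measurable_PiM_single')
    show "(\<lambda>c. reflect c z) \<in> C \<rightarrow>\<^sub>M row_space" for z
      unfolding reflect_def by (rule measurable_compose[OF _ measurable_flip_R]) (rule measurable_component_singleton, simp)
  qed (auto simp: space_PiM)
  have "distr C (Pi\<^sub>M UNIV (\<lambda>_. row_space)) reflect = Pi\<^sub>M UNIV (\<lambda>_. R_flip)"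
    unfolding R_flip_def
    using distr_PiM_map[OF prob_space_axioms measurable_flip_R, of "uminus :: int \<Rightarrow> int"]
    by (simp add: reflect_def[abs_def])
  then show ?thesis using assms by (intro AE_distrD[OF m]) (simp only:)
qed

theorem speed_dichotomy:
  assumes succ: "0 < measure R {r. succs r M = M}" and fail: "0 < measure R {r. succs r M = 0}"
  shows "\<exists>v. v \<in> {-1..1} \<and> (AE c in C. (\<lambda>t. real_of_int (walk c t) / real t) \<longlonglongrightarrow> v) \<and>
    (\<delta> < -2 \<longrightarrow> v < 0) \<and> (\<delta> \<in> {-2..2} \<longrightarrow> v = 0) \<and> (2 < \<delta> \<longrightarrow> 0 < v)"
proof -
  interpret F: row_law R_flip M by (rule row_law_flip)
  have succ': "0 < measure R_flip {r. succs r M = M}" and fail': "0 < measure R_flip {r. succs r M = 0}"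
    using succ fail measure_flip[of M] measure_flip[of 0] by simp_all
  consider "2 < \<delta>" | "\<delta> < -2" | "-2 \<le> \<delta>" "\<delta> \<le> 2" by linarith
  then show ?thesis
  proof cases
    case 1
    then obtain v where "0 < v" "v \<le> 1" "AE c in C. (\<lambda>t. real_of_int (walk c t) / real t) \<longlonglongrightarrow> v"
      using speed_pos[OF succ] by blast
    then show ?thesis using 1 by (intro exI[of _ v]) auto
  next
    case 2
    then obtain v where v: "0 < v" "v \<le> 1"
      "AE c in Pi\<^sub>M UNIV (\<lambda>_. R_flip). (\<lambda>t. real_of_int (walk c t) / real t) \<longlonglongrightarrow> v"
      using F.speed_pos[OF succ'] \<delta>_flip by auto
    from AE_reflect[OF v(3)] have "AE c in C. (\<lambda>t. real_of_int (walk c t) / real t) \<longlonglongrightarrow> - v"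
    proof eventually_elim
      case (elim c)
      from tendsto_minus[OF elim] show ?case by (simp add: walk_reflect)
    qed
    then show ?thesis using 2 v by (intro exI[of _ "- v"]) auto
  next
    case 3
    have up: "AE c in C. \<forall>\<epsilon>>0. eventually (\<lambda>t. real_of_int (walk c t) / real t \<le> \<epsilon>) sequentially"
      using speed_nonpos[OF fail] 3 by simp
    have "AE c in Pi\<^sub>M UNIV (\<lambda>_. R_flip). \<forall>\<epsilon>>0. eventually (\<lambda>t. real_of_int (walk c t) / real t \<le> \<epsilon>) sequentially"
      using F.speed_nonpos[OF fail'] 3 \<delta>_flip by simp
    from AE_reflect[OF this] up have "AE c in C. (\<lambda>t. real_of_int (walk c t) / real t) \<longlonglongrightarrow> 0"
    proof eventually_elim
      case (elim c)
      show ?case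
      \<comment> \<open>The upper bounds for the walk and for its reflection enclose the quotient
        between \<open>- e / 2\<close> and \<open>e / 2\<close>.\<close>
      proof (rule tendstoI)
        fix e :: real assume "0 < e"
        then have "0 < e / 2" by simp
        with elim(1,2) have
          "eventually (\<lambda>t. real_of_int (walk (reflect c) t) / real t \<le> e / 2) sequentially"
          "eventually (\<lambda>t. real_of_int (walk c t) / real t \<le> e / 2) sequentially" by blast+
        then show "eventually (\<lambda>t. dist (real_of_int (walk c t) / real t) 0 < e) sequentially"
        proof eventually_elim
          case (elim t)
          then have "- (real_of_int (walk c t) / real t) \<le> e / 2" by (simp add: walk_reflect)
          then show ?case using elim(2) \<open>0 < e\<close> unfolding dist_real_def diff_zero abs_less_iff by linarith
        qed
      qed
    qed
    then show ?thesis using 3 by (intro exI[of _ 0]) auto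
  qed
qed

end

section \<open>Drift, ellipticity and the quenched limit\<close>

context cookie_law
begin

interpretation L: row_law R M by (rule row_law_R)

lemma measurable_cookie: "(\<lambda>\<omega>. \<omega> z (Suc i)) \<in> borel_measurable P"
  by (rule measurable_compose[OF measurable_site measurable_cookie_row_nth])

lemma measure_R_cylinder:
  assumes J: "finite J"
  shows "measure R {r. \<forall>i\<in>J. r i = e i} = (\<integral>\<omega>. (\<Prod>i\<in>J. if e i then \<omega> 0 (Suc i) else 1 - \<omega> 0 (Suc i)) \<partial>P)"
proof -
  let ?f = "\<lambda>\<omega>. \<Prod>i\<in>J. if e i then \<omega> 0 (Suc i) else 1 - \<omega> (0::int) (Suc i)"
  have b: "0 \<le> ?f \<omega>" "?f \<omega> \<le> 1" if "\<omega> \<in> space P" for \<omega>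
    using env_bounds[OF that] by (auto intro!: prod_nonneg prod_le_1)
  have [measurable]: "?f \<in> borel_measurable P"
    using measurable_cookie by (intro borel_measurable_prod) auto
  have i: "integrable P ?f" by (rule integrable_const_bound[of _ 1]) (use b in auto)
  have "emeasure R {r. \<forall>i\<in>J. r i = e i} = ennreal (\<integral>\<omega>. ?f \<omega> \<partial>P)"
    unfolding emeasure_R_cylinder[OF J] using b by (intro nn_integral_eq_integral i) auto
  moreover have "0 \<le> (\<integral>\<omega>. ?f \<omega> \<partial>P)" using b by (intro Bochner_Integration.integral_nonneg_AE) auto
  ultimately show ?thesis by (simp add: measure_def)
qed

text \<open>Linearity of the integral suffices: \<open>\<delta>\<close> only involves the marginal
  success probabilities, which are the mean cookies, and the dependence between coins does not
  matter.\<close>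

lemma drift_eq: "L.\<delta> = drift M P"
proof -
  have E: "{r. r i} \<in> sets R" for i
    by (rule sets_Collect_UNIV, simp) measurable
  have int: "integrable P (\<lambda>\<omega>. \<omega> 0 (Suc i))" for i
    by (rule integrable_const_bound[of _ 1]) (use env_bounds measurable_cookie in auto)
  have p: "measure R {r. r i} = (\<integral>\<omega>. \<omega> 0 (Suc i) \<partial>P)" for i
    using measure_R_cylinder[of "{i}" "\<lambda>_. True"] by simp
  have ind: "integrable R (indicator {r. r i} :: _ \<Rightarrow> real)" for i
    using E[of i] by (simp add: L.emeasure_eq_measure)
  have "L.\<delta> = (\<integral>r. (\<Sum>i<M. 2 * indicator {r. r i} r - 1) \<partial>R)"
  proof -
    have "2 * real (succs r n) - real n = (\<Sum>i<n. 2 * indicator {r. r i} r - 1)" for r n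
      by (induction n) (auto simp: succs_Suc)
    then show ?thesis by (simp only: L.\<delta>_def)
  qed
  also have "\<dots> = (\<Sum>i<M. 2 * (\<integral>\<omega>. \<omega> 0 (Suc i) \<partial>P) - 1)"
    using ind E p by (subst Bochner_Integration.integral_sum) auto
  also have "\<dots> = (\<integral>\<omega>. (\<Sum>i<M. 2 * \<omega> 0 (Suc i) - 1) \<partial>P)"
    using int by (subst Bochner_Integration.integral_sum) (auto simp: prob_space)
  also have "\<dots> = drift M P"
    unfolding drift_def by (simp add: sum.atLeast1_atMost_eq)
  finally show ?thesis .
qed

text \<open>The two expectations in \<open>elliptic\<close> are the averaged probabilities that the
  first \<open>M\<close> coins of a row all succeed or all fail. The former lets any population die
  out in one step, the latter lets it jump to any level from \<open>M\<close> on.\<close>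

lemma ellipticity:
  assumes "elliptic M P"
  shows "0 < measure R {r. succs r M = M}" "0 < measure R {r. succs r M = 0}"
  using assms unfolding elliptic_def succs_eq_full_iff succs_eq_0_iff
  by (simp_all add: measure_R_cylinder prod.atLeast1_atMost_eq del: eq_True eq_False)

theorem law_of_large_numbers:
  assumes "elliptic M P"
  shows "\<exists>v. v \<in> {-1..1} \<and>
    (AE \<omega> in P. \<forall>(Q :: 's measure) X. erw \<omega> 0 Q X \<longrightarrow>
       (AE s in Q. (\<lambda>n. real_of_int (X n s) / real n) \<longlonglongrightarrow> v)) \<and>
    (drift M P < -2 \<longrightarrow> v < 0) \<and> (drift M P \<in> {-2..2} \<longrightarrow> v = 0) \<and> (drift M P > 2 \<longrightarrow> v > 0)"
proof -
  obtain v where v: "v \<in> {-1..1}"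
    "AE c in Pi\<^sub>M UNIV (\<lambda>_. R). (\<lambda>t. real_of_int (walk c t) / real t) \<longlonglongrightarrow> v"
    "(drift M P < -2 \<longrightarrow> v < 0) \<and> (drift M P \<in> {-2..2} \<longrightarrow> v = 0) \<and> (2 < drift M P \<longrightarrow> 0 < v)"
    using L.speed_dichotomy[OF ellipticity[OF assms]] unfolding drift_eq by blast
  interpret pair: pair_sigma_finite P unif_array by unfold_locales
  have "AE x in P \<Otimes>\<^sub>M unif_array.
      (\<lambda>t. real_of_int (walk (case x of (\<omega>, u) \<Rightarrow> coins \<omega> u) t) / real t) \<longlonglongrightarrow> v"
    by (rule AE_distrD[OF measurable_coins]) (simp only: distr_coins v(2))
  then have "AE x in P \<Otimes>\<^sub>M unif_array.
      (\<lambda>t. real_of_int (walk (coins (fst x) (snd x)) t) / real t) \<longlonglongrightarrow> v"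
    by (simp add: case_prod_beta')
  \<comment> \<open>Fubini: the almost sure limit under the product measure holds for almost every
    environment, almost surely in the uniform variables.\<close>
  from pair.AE_pair[OF this]
  have "AE \<omega> in P. AE u in unif_array. (\<lambda>t. real_of_int (walk (coins \<omega> u) t) / real t) \<longlonglongrightarrow> v"
    by simp
  with AE_space have "AE \<omega> in P. \<forall>(Q :: 's measure) X. erw \<omega> 0 Q X \<longrightarrow>
       (AE s in Q. (\<lambda>n. real_of_int (X n s) / real n) \<longlonglongrightarrow> v)"
  proof eventually_elim
    case (elim \<omega>)
    have "0 \<le> \<omega> z (Suc i) \<and> \<omega> z (Suc i) \<le> 1" for z i using env_bounds[OF elim(1)] by simp
    from AE_erw_transfer[where \<omega> = \<omega>, OF this _ elim(2)] show ?case by blast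
  qed
  then show ?thesis using v by blast
qed

end

theorem theorem2:
  fixes M :: nat and P :: "(int \<Rightarrow> nat \<Rightarrow> real) measure"
  assumes "M \<ge> 1"
    and "env_law M P"
    and "iid_sites P"
    and "elliptic M P"
  shows "\<exists>v::real. v \<in> {-1..1} \<and>
    (AE \<omega> in P. \<forall>(Q :: 's measure) X. erw \<omega> 0 Q X \<longrightarrow>
       (AE s in Q. (\<lambda>n. real_of_int (X n s) / real n) \<longlonglongrightarrow> v)) \<and>
    (drift M P < -2 \<longrightarrow> v < 0) \<and>
    (drift M P \<in> {-2..2} \<longrightarrow> v = 0) \<and>
    (drift M P > 2 \<longrightarrow> v > 0)"
proof -
  interpret cookie_law M P using assms by unfold_locales
  show ?thesis by (rule law_of_large_numbers[OF assms(4)])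
qed

end
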